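(* Fix $0<c_m<c_M$, $\varepsilon>0$, $V>0$ and let $$\mathscr{K}_V=\{c\in\mathscr{K}:\ TV(c)\le V\}.$$ (i) Every $c\in\mathscr{K}$ of bounded variation satisfies the minimal amplitude hypothesis with respect to $\mathscr{A}^c_\varepsilon$, uniformly for $c\in\mathscr{K}_V$; that is, $$\mathfrak{r}_c^2=\inf_{y\in[0,H],\ (\mu_k,\lambda)\in\mathscr{A}^c_\varepsilon}\big[u_{\lambda,k}(y)^2+u_{\lambda,k}'(y)^2\big]>0\qquad\text{and}\qquad \mathfrak{r}_V^2:=\inf_{c\in\mathscr{K}_V}\mathfrak{r}_c^2>0 .$$ (ii) For any interval $(a,b)\subseteq(0,H)$ there exists a constant $\mathfrak{f}_{a,b}>0$ such that, for every $c\in\mathscr{K}_V$ and every normalized $u_{\lambda,k}$ associated with $(\mu_k,\lambda)\in\mathscr{A}^c_\varepsilon$, $$\int_a^bu_{\lambda,k}(y)^2c(y)^{-1}dy\ge\mathfrak{f}_{a,b}.$$ (iii) Let $\omega=\omega'\times(a,b)$ with $\omega'\subseteq\Omega'$ nonempty and open and $(a,b)\subseteq(0,H)$. If $\omega'\ne\Omega'$, assume that the family $\{\phi_k\}_{k\ge1}$ does not concentrate in $\Omega'\setminus\omega'$. Then there exists $\mathfrak{f}_\omega>0$ such that the eigenfunctions $v_\lambda(x',y)=u_{\lambda,k}(y)\phi_k(x')$ satisfy $$\mathfrak{f}_\omega\le\frac{\|v_\lambda\|_{L^2(\omega)}}{\|v_\lambda\|_{L^2(\Omega)}}\le1$$ uniformly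 for all $c\in\mathscr{K}_V$ and all $(\mu_k,\lambda)\in\mathscr{A}^c_\varepsilon$.
   Context: Let $d\ge 1$, let $\Omega'\subset\mathbb{R}^d$ be an open bounded smooth domain, $H>0$, $\Omega=\Omega'\times(0,H)$ with points $x=(x',y)$. Let $(\mu_k^2,\phi_k)_{k\ge1}$, $\mu_k>0$, be the eigenvalues (nondecreasing, counted with multiplicity) and corresponding orthonormal eigenfunctions of $-\Delta_{x'}$ in $L^2(\Omega')$ with domain $H^2(\Omega')\cap H^1_0(\Omega')$. For fixed $0<c_m<c_M$, $\mathscr{K}$ is the set of all $c\in L^\infty(0,H)$ with $\operatorname{ess\,inf}c=c_m$ and $\operatorname{ess\,sup}c=c_M$. For $c\in\mathscr{K}$, $A_k=c(y)\big(\mu_k^2-\frac{d^2}{dy^2}\big)$ acts in $L^2((0,H),c(y)^{-1}dy)$ with domain $H^2(0,H)\cap H^1_0(0,H)$; its eigenvalues are simple; for an eigenvalue $\lambda$ of $A_k$, $u_{\lambda,k}$ is the real eigenfunction normalized by $\int_0^Hu_{\lambda,k}^2c^{-1}dy=1$. The function $v_\lambda=\phi_ku_{\lambda,k}$ is an eigenfunction of $-\tilde c\,\Delta$, $\tilde c(x',y)=c(y)$, with Dirichlet conditions in $\Omega$. Define $\mathscr{A}^c_\varepsilon=\{(\mu_k,\lambda): k\ge1,\ \lambda\text{ an eigenvalue of }A_k,\ \lambda\ge(c_M+\varepsilon)\mu_k^2\}$. The minimal amplitude hypothesis with respect to $\mathscr{A}^c_\varepsilon$ is the condition $\mathfrak{r}_c>0$,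 with $\mathfrak{r}_c$ as displayed in (i). $TV(c)$ is the total variation of $c$. The family $\{\phi_k\}$ "does not concentrate in $\Omega'\setminus\omega'$" means that no subsequence satisfies $\|\phi_{k_j}\|^2_{L^2(\omega')}/\|\phi_{k_j}\|^2_{L^2(\Omega')}\to0$, i.e. $\liminf_{k\to\infty}\|\phi_k\|^2_{L^2(\omega')}/\|\phi_k\|^2_{L^2(\Omega')}>0$. *)

theory Defs
  imports "HOL-Analysis.Analysis" "HOL-Probability.Essential_Supremum"
begin

section \<open>Smooth functions and smooth domains\<close>

primrec Ck_on :: "nat \<Rightarrow> 'a::real_normed_vector set \<Rightarrow> ('a \<Rightarrow> 'b::real_normed_vector) \<Rightarrow> bool" where
  "Ck_on 0 S f \<longleftrightarrow> continuous_on S f"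
| "Ck_on (Suc n) S f \<longleftrightarrow> (\<forall>x\<in>S. f differentiable (at x)) \<and>
     (\<forall>v. Ck_on n S (\<lambda>x. frechet_derivative f (at x) v))"

definition smooth_on :: "'a::real_normed_vector set \<Rightarrow> ('a \<Rightarrow> 'b::real_normed_vector) \<Rightarrow> bool" where
  "smooth_on S f \<longleftrightarrow> (\<forall>n. Ck_on n S f)"

text \<open>Near each boundary point the set is the strict sublevel set of a smooth function
  with nonvanishing gradient.\<close>

definition smooth_boundary :: "'a::euclidean_space set \<Rightarrow> bool" where
  "smooth_boundary S \<longleftrightarrow>
     (\<forall>p\<in>frontier S. \<exists>U (g :: 'a \<Rightarrow> real). open U \<and> p \<in> U \<and> smooth_on U g \<and>
        (\<forall>x\<in>U. frechet_derivative g (at x) \<noteq> (\<lambda>v. 0)) \<and>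
        S \<inter> U = {x \<in> U. g x < 0})"

definition bounded_smooth_domain :: "'a::euclidean_space set \<Rightarrow> bool" where
  "bounded_smooth_domain S \<longleftrightarrow>
     open S \<and> connected S \<and> S \<noteq> {} \<and> bounded S \<and> smooth_boundary S"

section \<open>Sobolev spaces\<close>

text \<open>Elements of \<open>L\<^sup>2(S)\<close> are represented by functions; only their values almost everywhere
  on \<open>S\<close> matter.\<close>

definition L2 :: "'a::euclidean_space set \<Rightarrow> ('a \<Rightarrow> 'b::euclidean_space) set" where
  "L2 S = {f \<in> borel_measurable (lebesgue_on S). integrable (lebesgue_on S) (\<lambda>x. (norm (f x))\<^sup>2)}"

definition L2_norm :: "'a::euclidean_space set \<Rightarrow> ('a \<Rightarrow> 'b::euclidean_space) \<Rightarrow> real" where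
  "L2_norm S f = sqrt (integral\<^sup>L (lebesgue_on S) (\<lambda>x. (norm (f x))\<^sup>2))"

definition test_function ::
  "'a::euclidean_space set \<Rightarrow> ('a \<Rightarrow> 'b::euclidean_space) \<Rightarrow> bool" where
  "test_function S \<psi> \<longleftrightarrow>
     smooth_on UNIV \<psi> \<and> (\<exists>K. compact K \<and> K \<subseteq> S \<and> (\<forall>x. x \<notin> K \<longrightarrow> \<psi> x = 0))"

definition has_weak_deriv ::
  "'a::euclidean_space set \<Rightarrow> 'a \<Rightarrow> ('a \<Rightarrow> 'b::euclidean_space) \<Rightarrow> ('a \<Rightarrow> 'b) \<Rightarrow> bool" where
  "has_weak_deriv S i f g \<longleftrightarrow>
     (\<forall>\<psi> :: 'a \<Rightarrow> real. test_function S \<psi> \<longrightarrow>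
        integral\<^sup>L (lebesgue_on S) (\<lambda>x. frechet_derivative \<psi> (at x) i *\<^sub>R f x) =
        - integral\<^sup>L (lebesgue_on S) (\<lambda>x. \<psi> x *\<^sub>R g x))"

text \<open>A representative of the weak derivative, which is unique up to null sets. It is only
  meaningful for functions that have a weak derivative in \<open>L\<^sup>2(S)\<close>.\<close>

definition wderiv ::
  "'a::euclidean_space set \<Rightarrow> 'a \<Rightarrow> ('a \<Rightarrow> 'b::euclidean_space) \<Rightarrow> 'a \<Rightarrow> 'b" where
  "wderiv S i f = (SOME g. g \<in> L2 S \<and> has_weak_deriv S i f g)"

definition H1 :: "'a::euclidean_space set \<Rightarrow> ('a \<Rightarrow> 'b::euclidean_space) set" where
  "H1 S = {f \<in> L2 S. \<forall>i\<in>Basis. \<exists>g\<in>L2 S. has_weak_deriv S i f g}"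

definition H2 :: "'a::euclidean_space set \<Rightarrow> ('a \<Rightarrow> 'b::euclidean_space) set" where
  "H2 S = {f \<in> H1 S. \<forall>i\<in>Basis. wderiv S i f \<in> H1 S}"

text \<open>The closure of the test functions in the \<open>H\<^sup>1\<close> norm.\<close>

definition H10 :: "'a::euclidean_space set \<Rightarrow> ('a \<Rightarrow> 'b::euclidean_space) set" where
  "H10 S = {f \<in> H1 S. \<exists>\<psi> :: nat \<Rightarrow> 'a \<Rightarrow> 'b.
     (\<forall>n. test_function S (\<psi> n)) \<and>
     (\<lambda>n. L2_norm S (\<lambda>x. \<psi> n x - f x)) \<longlonglongrightarrow> 0 \<and>
     (\<forall>i\<in>Basis. (\<lambda>n. L2_norm S (\<lambda>x. frechet_derivative (\<psi> n) (at x) i - wderiv S i f x))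
        \<longlonglongrightarrow> 0)}"

definition laplacian ::
  "'a::euclidean_space set \<Rightarrow> ('a \<Rightarrow> 'b::euclidean_space) \<Rightarrow> 'a \<Rightarrow> 'b" where
  "laplacian S f = (\<lambda>x. \<Sum>i\<in>Basis. wderiv S i (wderiv S i f) x)"

section \<open>The Dirichlet Laplacian on the cross-section\<close>

definition dirichlet_eigenfunction ::
  "'a::euclidean_space set \<Rightarrow> real \<Rightarrow> ('a \<Rightarrow> complex) \<Rightarrow> bool" where
  "dirichlet_eigenfunction S \<nu> f \<longleftrightarrow>
     f \<in> H2 S \<inter> H10 S \<and> \<not> (AE x in lebesgue_on S. f x = 0) \<and>
     (AE x in lebesgue_on S. - laplacian S f x = \<nu> *\<^sub>R f x)"

text \<open>\<open>(\<mu>\<^sub>k\<^sup>2, \<phi>\<^sub>k)\<close>, \<open>k \<ge> 1\<close>, lists all eigenvalues in nondecreasing order, with orthonormal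
  eigenfunctions. Each eigenvalue occurs as often as its multiplicity: the \<open>\<phi>\<^sub>k\<close> with
  \<open>\<mu>\<^sub>k\<^sup>2 = \<nu>\<close>, which are orthonormal, span the eigenspace of \<open>\<nu>\<close>. The value at \<open>k = 0\<close> is
  irrelevant.\<close>

definition dirichlet_eigensystem ::
  "'a::euclidean_space set \<Rightarrow> (nat \<Rightarrow> real) \<Rightarrow> (nat \<Rightarrow> 'a \<Rightarrow> complex) \<Rightarrow> bool" where
  "dirichlet_eigensystem S \<mu> \<phi> \<longleftrightarrow>
     (\<forall>k\<ge>1. \<mu> k > 0) \<and>
     (\<forall>j\<ge>1. \<forall>k\<ge>j. \<mu> j \<le> \<mu> k) \<and>
     (\<forall>k\<ge>1. dirichlet_eigenfunction S ((\<mu> k)\<^sup>2) (\<phi> k)) \<and>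
     (\<forall>j\<ge>1. \<forall>k\<ge>1. integral\<^sup>L (lebesgue_on S) (\<lambda>x. \<phi> j x * cnj (\<phi> k x)) =
        (if j = k then 1 else 0)) \<and>
     (\<forall>\<nu> f. dirichlet_eigenfunction S \<nu> f \<longrightarrow>
        finite {k. k \<ge> 1 \<and> (\<mu> k)\<^sup>2 = \<nu>} \<and>
        (\<exists>a :: nat \<Rightarrow> complex. AE x in lebesgue_on S.
           f x = (\<Sum>k\<in>{k. k \<ge> 1 \<and> (\<mu> k)\<^sup>2 = \<nu>}. a k * \<phi> k x)))"

text \<open>The family \<open>f\<close> does not concentrate in \<open>S - S'\<close>.\<close>

definition not_concentrating ::
  "'a::euclidean_space set \<Rightarrow> 'a set \<Rightarrow> (nat \<Rightarrow> 'a \<Rightarrow> complex) \<Rightarrow> bool" where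
  "not_concentrating S S' f \<longleftrightarrow>
     \<not> (\<exists>r :: nat \<Rightarrow> nat. strict_mono r \<and>
          (\<lambda>j. (L2_norm S' (f (r j)))\<^sup>2 / (L2_norm S (f (r j)))\<^sup>2) \<longlonglongrightarrow> 0)"

section \<open>Coefficients\<close>

definition essinf :: "'a measure \<Rightarrow> ('a \<Rightarrow> ereal) \<Rightarrow> ereal" where
  "essinf M f = - esssup M (\<lambda>x. - f x)"

text \<open>Measurability together with finite essential bounds makes these functions elements of
  \<open>L\<^sup>\<infinity>(0,h)\<close>.\<close>

definition Kset :: "real \<Rightarrow> real \<Rightarrow> real \<Rightarrow> (real \<Rightarrow> real) set" where
  "Kset h cm cM = {c \<in> borel_measurable (lebesgue_on {0<..<h}).
     essinf (lebesgue_on {0<..<h}) (\<lambda>y. ereal (c y)) = ereal cm \<and>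
     esssup (lebesgue_on {0<..<h}) (\<lambda>y. ereal (c y)) = ereal cM}"

definition pointwise_variation :: "real set \<Rightarrow> (real \<Rightarrow> real) \<Rightarrow> ereal" where
  "pointwise_variation S f =
     (SUP xs \<in> {xs. sorted xs \<and> set xs \<subseteq> S}.
        ereal (\<Sum>i<length xs - 1. \<bar>f (xs ! Suc i) - f (xs ! i)\<bar>))"

text \<open>The total variation of a class in \<open>L\<^sup>\<infinity>(0,h)\<close>: the infimum of the pointwise variations
  of its representatives. It equals the total mass of the distributional derivative.\<close>

definition TV :: "real \<Rightarrow> (real \<Rightarrow> real) \<Rightarrow> ereal" where
  "TV h c = (INF g \<in> {g. AE y in lebesgue_on {0<..<h}. g y = c y}.
     pointwise_variation {0<..<h} g)"

definition KVset :: "real \<Rightarrow> real \<Rightarrow> real \<Rightarrow> real \<Rightarrow> (real \<Rightarrow> real) set" where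
  "KVset h cm cM V = {c \<in> Kset h cm cM. TV h c \<le> ereal V}"

section \<open>The reduced operators\<close>

text \<open>\<open>A\<^sub>k\<close> is \<open>A_op h c \<mu>\<^sub>k\<close>. Since \<open>c\<close> is bounded above and away from \<open>0\<close>, the space
  \<open>L\<^sup>2((0,h), c\<^sup>-\<^sup>1 dy)\<close> and \<open>L\<^sup>2(0,h)\<close> have the same elements.\<close>

definition A_op :: "real \<Rightarrow> (real \<Rightarrow> real) \<Rightarrow> real \<Rightarrow> (real \<Rightarrow> real) \<Rightarrow> real \<Rightarrow> real" where
  "A_op h c m u =
     (\<lambda>y. c y * (m\<^sup>2 * u y - wderiv {0<..<h} 1 (wderiv {0<..<h} 1 u) y))"

definition A_eigenfunction ::
  "real \<Rightarrow> (real \<Rightarrow> real) \<Rightarrow> real \<Rightarrow> real \<Rightarrow> (real \<Rightarrow> real) \<Rightarrow> bool" where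
  "A_eigenfunction h c m lam u \<longleftrightarrow>
     u \<in> H2 {0<..<h} \<inter> H10 {0<..<h} \<and> \<not> (AE y in lebesgue_on {0<..<h}. u y = 0) \<and>
     (AE y in lebesgue_on {0<..<h}. A_op h c m u y = lam * u y)"

definition A_eigenvalue :: "real \<Rightarrow> (real \<Rightarrow> real) \<Rightarrow> real \<Rightarrow> real \<Rightarrow> bool" where
  "A_eigenvalue h c m lam \<longleftrightarrow> (\<exists>u. A_eigenfunction h c m lam u)"

text \<open>The classical derivative on the closed interval, one-sided at the endpoints.\<close>

definition D :: "real \<Rightarrow> (real \<Rightarrow> real) \<Rightarrow> real \<Rightarrow> real" where
  "D h u y = vector_derivative u (at y within {0..h})"

text \<open>Pointwise values of \<open>u\<close> and \<open>u'\<close> on \<open>[0,h]\<close> refer to the representative given by the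
  embedding of \<open>H\<^sup>2(0,h)\<close> into \<open>C\<^sup>1([0,h])\<close>. The eigenvalue being simple, the normalized real
  eigenfunction is unique up to sign.\<close>

definition normalized_eigenfunction ::
  "real \<Rightarrow> (real \<Rightarrow> real) \<Rightarrow> real \<Rightarrow> real \<Rightarrow> (real \<Rightarrow> real) \<Rightarrow> bool" where
  "normalized_eigenfunction h c m lam u \<longleftrightarrow>
     A_eigenfunction h c m lam u \<and>
     u differentiable_on {0..h} \<and> continuous_on {0..h} (D h u) \<and>
     integral\<^sup>L (lebesgue_on {0<..<h}) (\<lambda>y. (u y)\<^sup>2 * inverse (c y)) = 1"

definition Aset ::
  "real \<Rightarrow> real \<Rightarrow> real \<Rightarrow> (nat \<Rightarrow> real) \<Rightarrow> (real \<Rightarrow> real) \<Rightarrow> (real \<times> real) set" where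
  "Aset h cM \<epsilon> \<mu> c = {(\<mu> k, lam) | k lam. k \<ge> 1 \<and> A_eigenvalue h c (\<mu> k) lam \<and>
     lam \<ge> (cM + \<epsilon>) * (\<mu> k)\<^sup>2}"

text \<open>The square of the minimal amplitude. The infimum is taken in the extended reals.\<close>

definition rsq ::
  "real \<Rightarrow> real \<Rightarrow> real \<Rightarrow> (nat \<Rightarrow> real) \<Rightarrow> (real \<Rightarrow> real) \<Rightarrow> ereal" where
  "rsq h cM \<epsilon> \<mu> c = Inf {ereal ((u y)\<^sup>2 + (D h u y)\<^sup>2) | y m lam u.
     y \<in> {0..h} \<and> (m, lam) \<in> Aset h cM \<epsilon> \<mu> c \<and> normalized_eigenfunction h c m lam u}"

end

theory Submission
  imports Defs
begin

text \<open>After division by \<open>c\<close> the reduced eigenvalue equation reads \<open>u'' = - \<lambda> Q u\<close> with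
  \<open>Q = 1 / c - \<mu>\<^sub>k\<^sup>2 / \<lambda>\<close>, and \<open>\<lambda> \<ge> (c\<^sub>M + \<epsilon>) \<mu>\<^sub>k\<^sup>2\<close> makes \<open>Q\<close> uniformly positive. Freezing \<open>Q\<close>
  on intervals of length about \<open>\<lambda>\<^bsup>-1/2\<^esup>\<close>, one sees that the energy \<open>u'\<^sup>2 + \<lambda> Q u\<^sup>2\<close> at two points
  differs at most by a factor that depends on the total variation of \<open>Q\<close> but not on \<open>\<lambda>\<close>. The
  normalization then bounds the energy from below by a multiple of \<open>\<lambda>\<close>, which is (i), and testing the
  equation with a cut-off multiple of \<open>u\<close> transfers this bound to \<open>\<integral> u\<^sup>2\<close> over subintervals, which is (ii).

  For (iii) it remains to bound \<open>\<parallel>\<phi>\<^sub>k\<parallel>\<close> on \<open>\<omega>'\<close> from below. The hypothesis controls all but finitely many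
  \<open>k\<close>; for the remaining ones the eigenfunction must not vanish on \<open>\<omega>'\<close>. This unique continuation property
  follows from analyticity: mollifications of \<open>\<phi>\<^sub>k\<close> solve the Helmholtz equation classically, and
  Bernstein's gradient estimate, applied \<open>n\<close> times on balls of radius \<open>\<rho> / n\<close>, bounds
  the \<open>n\<close>-th directional derivatives by \<open>(C n / \<rho>)\<^sup>n\<close>.\<close>

section \<open>Smooth functions\<close>

text \<open>With \<open>c\<close> of bounded variation only, \<open>Q\<close> may jump, so the
  energy \<open>u'\<^sup>2 + \<lambda> Q u\<^sup>2\<close> cannot be differentiated. A step of
  length \<open>1 / S\<close> cancels the factor \<open>S\<close>, and unfreezing \<open>Q\<close>
  at the right end costs a factor governed by the same oscillation. Oscillations are measured by
  increments of a variation function \<open>N\<close>, which telescope; hence the number of steps,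
  which grows with \<lambda>, leaves no trace in the final factor. For unique continuation every
  test function \<psi> serves as a mollifier. The function sending x to the integral of \<psi>(y +
  x) f(y) is smooth, solves the equation as long as the shifted support stays in the domain, and its
  value at 0 is the pairing of f with \<psi>. Letting \<psi> vary over all test functions near a
  point recovers f there.\<close>

abbreviation pd :: "'a::real_normed_vector \<Rightarrow> ('a \<Rightarrow> 'b::real_normed_vector) \<Rightarrow> 'a \<Rightarrow> 'b" where
  "pd v f \<equiv> (\<lambda>x. frechet_derivative f (at x) v)"

lemma Ck_on_Suc_I:
  assumes "\<And>x. (f has_derivative f' x) (at x)" "\<And>v. Ck_on n UNIV (\<lambda>x. f' x v)"
  shows "Ck_on (Suc n) UNIV f"
proof -
  have "frechet_derivative f (at x) = f' x" for x
    using frechet_derivative_at[OF assms(1)] by metis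
  then show ?thesis using assms by (auto simp: differentiable_def)
qed

lemma Ck_on_Suc_D:
  assumes "Ck_on (Suc n) UNIV f"
  shows "(f has_derivative frechet_derivative f (at x)) (at x)" "Ck_on n UNIV (pd v f)"
  using assms frechet_derivative_works by auto

lemma Ck_on_SucD: "Ck_on (Suc n) UNIV f \<Longrightarrow> Ck_on n UNIV f"
proof (induction n arbitrary: f)
  case 0
  then show ?case
    by (auto intro!: continuous_at_imp_continuous_on differentiable_imp_continuous_within)
next
  case (Suc n)
  show ?case using Suc.prems Suc.IH by (metis Ck_on.simps(2))
qed

lemma Ck_on_const: "Ck_on n UNIV (\<lambda>x. c)"
proof (induction n arbitrary: c)
  case (Suc n)
  show ?case by (rule Ck_on_Suc_I[OF has_derivative_const]) (use Suc in auto)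
qed auto

lemma Ck_on_linear:
  assumes "bounded_linear f" shows "Ck_on n UNIV f"
proof (cases n)
  case 0
  then show ?thesis using assms linear_continuous_on by auto
next
  case (Suc m)
  show ?thesis unfolding Suc
    by (rule Ck_on_Suc_I[OF bounded_linear_imp_has_derivative[OF assms]]) (rule Ck_on_const)
qed

lemma Ck_on_add:
  assumes "Ck_on n UNIV f" "Ck_on n UNIV g"
  shows "Ck_on n UNIV (\<lambda>x. f x + g x)"
  using assms
proof (induction n arbitrary: f g)
  case 0
  then show ?case by (auto intro: continuous_intros)
next
  case (Suc n)
  show ?case
    by (rule Ck_on_Suc_I[OF has_derivative_add[OF Ck_on_Suc_D(1)[OF Suc.prems(1)] Ck_on_Suc_D(1)[OF Suc.prems(2)]]])
       (intro Suc.IH Ck_on_Suc_D(2) Suc.prems)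
qed

lemma Ck_on_mult:
  fixes f g :: "'a::real_normed_vector \<Rightarrow> real"
  assumes "Ck_on n UNIV f" "Ck_on n UNIV g"
  shows "Ck_on n UNIV (\<lambda>x. f x * g x)"
  using assms
proof (induction n arbitrary: f g)
  case 0
  then show ?case by (auto intro: continuous_intros)
next
  case (Suc n)
  show ?case
    by (rule Ck_on_Suc_I[OF has_derivative_mult[OF Ck_on_Suc_D(1)[OF Suc.prems(1)] Ck_on_Suc_D(1)[OF Suc.prems(2)]]])
       (intro Ck_on_add Suc.IH Ck_on_Suc_D(2) Ck_on_SucD[OF Suc.prems(1)] Ck_on_SucD[OF Suc.prems(2)] Suc.prems)
qed

lemma Ck_on_compose:
  fixes g :: "real \<Rightarrow> real" and f :: "'a::real_normed_vector \<Rightarrow> real"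
  assumes "Ck_on n UNIV g" "Ck_on n UNIV f"
  shows "Ck_on n UNIV (\<lambda>x. g (f x))"
  using assms
proof (induction n arbitrary: f g)
  case 0
  then show ?case by (auto intro: continuous_on_compose2)
next
  case (Suc n)
  have g: "(g has_derivative (\<lambda>v. v * pd 1 g t)) (at t)" for t
  proof -
    have d: "(g has_derivative frechet_derivative g (at t)) (at t)"
      by (rule Ck_on_Suc_D(1)[OF Suc.prems(1)])
    have "frechet_derivative g (at t) v = v * pd 1 g t" for v
      using linear_scale[OF has_derivative_linear[OF d], of v 1] by simp
    then show ?thesis using d by (metis (no_types, lifting) ext)
  qed
  have "((\<lambda>x. g (f x)) has_derivative (\<lambda>v. pd v f x * pd 1 g (f x))) (at x)" for x
    using has_derivative_compose[OF Ck_on_Suc_D(1)[OF Suc.prems(2)] g] by simp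
  moreover have "Ck_on n UNIV (\<lambda>x. pd v f x * pd 1 g (f x))" for v
    by (rule Ck_on_mult[OF Ck_on_Suc_D(2)[OF Suc.prems(2)]
          Suc.IH[OF Ck_on_Suc_D(2)[OF Suc.prems(1)] Ck_on_SucD[OF Suc.prems(2)]]])
  ultimately show ?case by (rule Ck_on_Suc_I)
qed

lemma Ck_on_translate:
  assumes "Ck_on n UNIV f"
  shows "Ck_on n UNIV (\<lambda>y. f (y + x))"
  using assms
proof (induction n arbitrary: f)
  case 0
  then show ?case by (auto intro!: continuous_on_compose2[of UNIV f] continuous_intros)
next
  case (Suc n)
  have "((\<lambda>y. f (y + x)) has_derivative (\<lambda>v. pd v f (y + x))) (at y)" for y
    by (rule has_derivative_compose[OF _ Ck_on_Suc_D(1)[OF Suc.prems], of "\<lambda>y. y + x" "\<lambda>v. v", simplified])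
       (auto intro!: derivative_eq_intros)
  then show ?case
    by (rule Ck_on_Suc_I) (rule Suc.IH[OF Ck_on_Suc_D(2)[OF Suc.prems]])
qed

lemma smooth_on_has_derivative:
  assumes "smooth_on UNIV f"
  shows "(f has_derivative frechet_derivative f (at x)) (at x)"
  using Ck_on_Suc_D(1)[of 0 f x] assms unfolding smooth_on_def by metis

lemma smooth_on_pd: "smooth_on UNIV f \<Longrightarrow> smooth_on UNIV (pd v f)"
  unfolding smooth_on_def by (rule allI, rule Ck_on_Suc_D(2), erule spec)

lemma smooth_on_continuous: "smooth_on UNIV f \<Longrightarrow> continuous_on UNIV f"
  unfolding smooth_on_def by (metis Ck_on.simps(1))

lemma pd_translate:
  assumes "smooth_on UNIV f"
  shows "pd v (\<lambda>y. f (y + x)) = (\<lambda>y. pd v f (y + x))"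
proof -
  have "((\<lambda>y. f (y + x)) has_derivative (\<lambda>v. pd v f (y + x))) (at y)" for y
    by (rule has_derivative_compose[OF _ smooth_on_has_derivative[OF assms], of "\<lambda>y. y + x" "\<lambda>v. v", simplified])
       (auto intro!: derivative_eq_intros)
  then show ?thesis using frechet_derivative_at[of "\<lambda>y. f (y + x)"] by metis
qed

lemma smooth_on_translate: "smooth_on UNIV f \<Longrightarrow> smooth_on UNIV (\<lambda>y. f (y + x))"
  unfolding smooth_on_def by (rule allI, rule Ck_on_translate[where f=f and x=x]) (erule spec)+

lemma smooth_on_line_derivative:
  fixes f :: "'a::real_normed_vector \<Rightarrow> real"
  assumes "smooth_on UNIV f"
  shows "((\<lambda>s. f (x + s *\<^sub>R b)) has_real_derivative pd b f (x + s *\<^sub>R b)) (at s)"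
proof -
  have "((\<lambda>s. f (x + s *\<^sub>R b)) has_derivative (\<lambda>t. frechet_derivative f (at (x + s *\<^sub>R b)) (t *\<^sub>R b))) (at s)"
    by (rule has_derivative_compose[OF _ smooth_on_has_derivative[OF assms], of "\<lambda>s. x + s *\<^sub>R b" "\<lambda>t. t *\<^sub>R b", simplified])
       (auto intro!: derivative_eq_intros)
  moreover have "frechet_derivative f (at (x + s *\<^sub>R b)) (t *\<^sub>R b) = pd b f (x + s *\<^sub>R b) * t" for t
    using linear_scale[OF has_derivative_linear[OF smooth_on_has_derivative[OF assms]]]
    by (simp add: mult.commute)
  ultimately have "((\<lambda>s. f (x + s *\<^sub>R b)) has_derivative (\<lambda>t. pd b f (x + s *\<^sub>R b) * t)) (at s)"
    by (simp only:)
  then show ?thesis unfolding has_field_derivative_def .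
qed

lemma pd_eq_sum_Basis:
  fixes f :: "'a::euclidean_space \<Rightarrow> real"
  assumes "smooth_on UNIV f"
  shows "pd e f x = (\<Sum>b\<in>Basis. (e \<bullet> b) * pd b f x)"
proof -
  have l: "linear (frechet_derivative f (at x))"
    by (rule has_derivative_linear[OF smooth_on_has_derivative[OF assms]])
  have "pd e f x = frechet_derivative f (at x) (\<Sum>b\<in>Basis. (e \<bullet> b) *\<^sub>R b)"
    by (simp add: euclidean_representation)
  also have "\<dots> = (\<Sum>b\<in>Basis. (e \<bullet> b) * pd b f x)"
    by (simp add: linear_sum[OF l] linear_scale[OF l])
  finally show ?thesis .
qed

text \<open>The classical function exp(-1/t), extended by 0 and divided by powers of t. The powers
  make the span of the family closed under differentiation, so smoothness of all members follows
  from one induction.\<close>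

definition flat :: "nat \<Rightarrow> real \<Rightarrow> real" where
  "flat k t = (if t > 0 then exp (- 1 / t) / t ^ k else 0)"

lemma exp_ge_power_div_fact:
  assumes "(x::real) \<ge> 0" shows "x ^ n / fact n \<le> exp x"
proof -
  obtain t where "exp x = (\<Sum>m<Suc n. x ^ m / fact m) + exp t / fact (Suc n) * x ^ Suc n"
    using Maclaurin_exp_le by blast
  moreover have "(\<Sum>m<n. x ^ m / fact m) \<ge> 0" "exp t / fact (Suc n) * x ^ Suc n \<ge> 0"
    using assms by (auto intro!: sum_nonneg mult_nonneg_nonneg simp del: fact_Suc)
  ultimately show ?thesis by (simp del: fact_Suc)
qed

lemma flat_le: "\<bar>flat k t\<bar> \<le> fact (k + 2) * t\<^sup>2"
proof (cases "t > 0")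
  case True
  have "(1 / t) ^ (k + 2) / fact (k + 2) \<le> exp (1 / t)"
    using True by (intro exp_ge_power_div_fact) auto
  then have "exp (- 1 / t) \<le> fact (k + 2) * t ^ (k + 2)"
    using True by (simp add: exp_minus field_simps del: fact_Suc power_Suc)
  then have "exp (- 1 / t) / t ^ k \<le> fact (k + 2) * t\<^sup>2"
    using True by (simp add: divide_le_eq power_add power2_eq_square mult_ac del: fact_Suc)
  then show ?thesis using True by (simp add: flat_def del: fact_Suc)
qed (simp add: flat_def del: fact_Suc)

lemma flat_has_derivative:
  "(flat k has_real_derivative (flat (k + 2) t - real k * flat (k + 1) t)) (at t)"
proof -
  consider "t > 0" | "t < 0" | "t = 0" by linarith
  then show ?thesis
  proof cases
    case 1
    have "((\<lambda>t. exp (- 1 / t) * inverse t ^ k) has_real_derivative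
       exp (- 1 / t) / t\<^sup>2 * inverse t ^ k + exp (- 1 / t) * (real k * inverse t ^ (k - 1) * (- (inverse t)\<^sup>2))) (at t)"
      using 1 by (auto intro!: derivative_eq_intros simp: power2_eq_square inverse_eq_divide)
    moreover have "exp (- 1 / t) / t\<^sup>2 * inverse t ^ k + exp (- 1 / t) * (real k * inverse t ^ (k - 1) * (- (inverse t)\<^sup>2))
      = flat (k + 2) t - real k * flat (k + 1) t"
      using 1 by (cases k) (simp_all add: flat_def field_simps power2_eq_square)
    ultimately have "((\<lambda>t. exp (- 1 / t) * inverse t ^ k) has_real_derivative flat (k + 2) t - real k * flat (k + 1) t) (at t)"
      by simp
    then show ?thesis
      by (rule has_field_derivative_transform_within_open[where S="{0<..}"])
         (use 1 in \<open>auto simp: flat_def field_simps\<close>)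
  next
    case 2
    have "((\<lambda>t. 0) has_real_derivative flat (k + 2) t - real k * flat (k + 1) t) (at t)"
      using 2 by (simp add: flat_def)
    then show ?thesis
      by (rule has_field_derivative_transform_within_open[where S="{..<0}"])
         (use 2 in \<open>auto simp: flat_def\<close>)
  next
    case 3
    have "((\<lambda>s. flat k s / s) \<longlongrightarrow> 0) (at 0)"
    proof (rule Lim_null_comparison)
      have "norm (flat k s / s) \<le> fact (k + 2) * \<bar>s\<bar>" for s
        using flat_le[of k s] 
        by (cases "s = 0") (simp_all add: divide_le_eq power2_eq_square abs_mult[symmetric] mult.assoc del: fact_Suc)
      then show "\<forall>\<^sub>F s in at 0. norm (flat k s / s) \<le> fact (k + 2) * \<bar>s\<bar>" by simp
      show "((\<lambda>s::real. fact (k + 2) * \<bar>s\<bar>) \<longlongrightarrow> 0) (at 0)"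
        by (auto intro!: tendsto_eq_intros)
    qed
    then show ?thesis unfolding 3 has_field_derivative_iff by (simp add: flat_def)
  qed
qed

lemma smooth_on_flat: "smooth_on UNIV (flat k)"
proof -
  have "Ck_on n UNIV (flat k)" for n
  proof (induction n arbitrary: k)
    case 0
    show ?case unfolding Ck_on.simps
      by (rule DERIV_continuous_on[OF flat_has_derivative])
  next
    case (Suc n)
    have "(flat k has_derivative (\<lambda>v. v * (flat (k + 2) t + (- real k) * flat (k + 1) t))) (at t)" for t
      using flat_has_derivative[of k t] unfolding has_field_derivative_def
      by (rule has_derivative_eq_rhs) (auto simp: algebra_simps)
    then show ?case
      by (rule Ck_on_Suc_I) (intro Ck_on_mult Ck_on_add Ck_on_const Suc.IH)
  qed
  then show ?thesis by (simp add: smooth_on_def)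
qed

lemma smooth_on_mult:
  fixes f g :: "'a::real_normed_vector \<Rightarrow> real"
  shows "smooth_on UNIV f \<Longrightarrow> smooth_on UNIV g \<Longrightarrow> smooth_on UNIV (\<lambda>x. f x * g x)"
  unfolding smooth_on_def by (rule allI, rule Ck_on_mult[where f=f and g=g]) (erule spec)+

lemma smooth_on_add:
  "smooth_on UNIV f \<Longrightarrow> smooth_on UNIV g \<Longrightarrow> smooth_on UNIV (\<lambda>x. f x + g x)"
  unfolding smooth_on_def by (rule allI, rule Ck_on_add[where f=f and g=g]) (erule spec)+

lemma smooth_on_const: "smooth_on UNIV (\<lambda>x. c)"
  unfolding smooth_on_def by (intro allI Ck_on_const)

lemma smooth_on_linear: "bounded_linear f \<Longrightarrow> smooth_on UNIV f"
  unfolding smooth_on_def by (intro allI Ck_on_linear)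

lemma smooth_on_compose:
  fixes g :: "real \<Rightarrow> real" and f :: "'a::real_normed_vector \<Rightarrow> real"
  shows "smooth_on UNIV g \<Longrightarrow> smooth_on UNIV f \<Longrightarrow> smooth_on UNIV (\<lambda>x. g (f x))"
  unfolding smooth_on_def by (rule allI, rule Ck_on_compose[where f=f and g=g]) (erule spec)+

lemma smooth_on_prod:
  fixes f :: "'i \<Rightarrow> 'a::real_normed_vector \<Rightarrow> real"
  assumes "\<And>i. i \<in> I \<Longrightarrow> smooth_on UNIV (f i)"
  shows "smooth_on UNIV (\<lambda>x. \<Prod>i\<in>I. f i x)"
proof (cases "finite I")
  case True
  then show ?thesis using assms
  proof (induction I)
    case (insert i I)
    have "smooth_on UNIV (\<lambda>x. f i x * (\<Prod>i\<in>I. f i x))"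
      by (rule smooth_on_mult) (use insert in auto)
    then show ?case using insert by simp
  qed (simp add: smooth_on_const)
qed (simp add: smooth_on_const)

section \<open>Test functions\<close>

lemma test_functionI:
  assumes "smooth_on UNIV \<psi>" "compact K" "K \<subseteq> S" "\<And>x. x \<notin> K \<Longrightarrow> \<psi> x = 0"
  shows "test_function S \<psi>"
  unfolding test_function_def
  by (rule conjI[OF assms(1)], rule exI[of _ K]) (simp add: assms)

lemma test_function_subset: 
  assumes "test_function S \<psi>" "S \<subseteq> T" shows "test_function T \<psi>"
proof -
  obtain K where K: "smooth_on UNIV \<psi>" "compact K" "K \<subseteq> S" "\<And>x. x \<notin> K \<Longrightarrow> \<psi> x = 0"
    using assms(1) unfolding test_function_def by auto
  show ?thesis by (rule test_functionI[OF K(1,2) subset_trans[OF K(3) assms(2)] K(4)])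
qed

lemma pd_eq_0_outside:
  assumes "compact K" "\<And>x. x \<notin> K \<Longrightarrow> \<psi> x = 0" "x \<notin> K"
  shows "pd v \<psi> x = 0"
proof -
  have "(\<psi> has_derivative (\<lambda>v. 0)) (at x)"
    by (rule has_derivative_transform_within_open[OF has_derivative_const[of 0], where s="- K"])
       (use assms(1,3) in \<open>simp_all add: compact_imp_closed open_Compl assms(2)\<close>)
  from frechet_derivative_at[OF this] show ?thesis by (rule fun_cong[symmetric])
qed

lemma test_function_pd: 
  assumes "test_function S \<psi>" shows "test_function S (pd v \<psi>)"
proof -
  obtain K where K: "smooth_on UNIV \<psi>" "compact K" "K \<subseteq> S" "\<And>x. x \<notin> K \<Longrightarrow> \<psi> x = 0"
    using assms unfolding test_function_def by auto
  show ?thesis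
    by (rule test_functionI[OF smooth_on_pd[OF K(1)] K(2,3)]) (rule pd_eq_0_outside[OF K(2,4)])
qed

lemma test_function_bounded:
  assumes "test_function S (\<psi> :: 'a::euclidean_space \<Rightarrow> real)"
  obtains B where "B > 0" "\<And>x. \<bar>\<psi> x\<bar> \<le> B"
proof -
  obtain K where K: "smooth_on UNIV \<psi>" "compact K" "\<And>x. x \<notin> K \<Longrightarrow> \<psi> x = 0"
    using assms unfolding test_function_def by auto
  have "bounded (\<psi> ` K)"
    using K(2) continuous_on_subset[OF smooth_on_continuous[OF K(1)]]
    by (intro compact_imp_bounded compact_continuous_image) auto
  then obtain B where B: "B > 0" "\<forall>x\<in>K. \<bar>\<psi> x\<bar> \<le> B"
    unfolding bounded_pos by auto
  have "\<bar>\<psi> x\<bar> \<le> B" for x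
    using B K(3)[of x] by (cases "x \<in> K") auto
  then show ?thesis using that B(1) by blast
qed

section \<open>Gradient estimate for the Helmholtz equation\<close>

text \<open>If \<open>c\<close> were positive, \<open>p'\<close> would be positive just to the right
  of its zero at 0, and the mean value theorem would produce larger values of \<open>p\<close>
  there.\<close>

lemma second_derivative_local_max:
  fixes p p' :: "real \<Rightarrow> real"
  assumes "\<delta> > 0" and d: "\<And>s. (p has_real_derivative p' s) (at s)"
    and dd: "(p' has_real_derivative c) (at 0)" and mx: "\<And>s. \<bar>s\<bar> < \<delta> \<Longrightarrow> p s \<le> p 0"
  shows "c \<le> 0"
proof (rule ccontr)
  assume "\<not> c \<le> 0"
  have p0: "p' 0 = 0"
    by (rule DERIV_local_max[OF d \<open>\<delta> > 0\<close>]) (use mx in auto)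
  obtain e where e: "e > 0" "\<And>h. 0 < h \<Longrightarrow> h < e \<Longrightarrow> p' 0 < p' (0 + h)"
    using DERIV_pos_inc_right[OF dd] \<open>\<not> c \<le> 0\<close> by (metis not_le)
  define s where "s = min e \<delta> / 2"
  have s: "0 < s" "s < e" "s < \<delta>" using e(1) \<open>\<delta> > 0\<close> by (auto simp: s_def)
  obtain z where z: "0 < z" "z < s" "p s - p 0 = (s - 0) * p' z"
    using MVT2[OF s(1), of p p'] d by blast
  have "p' z > 0" using e(2)[of z] z s p0 by simp
  then have "p s > p 0" using z s by (metis diff_gt_0_iff_gt diff_zero mult_pos_pos)
  then show False using mx[of s] s by simp
qed

text \<open>Bernstein's method: for \<open>A\<close> and \<open>B\<close> large enough the function
  \<open>\<eta>\<^sup>2 g\<^sup>2 + A v\<^sup>2 + B \<bar>x - x\<^sub>0\<bar>\<^sup>2\<close> with \<open>\<eta> = r\<^sup>2 - \<bar>x - x\<^sub>0\<bar>\<^sup>2\<close> is strictly subharmonic, so that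
  its maximum is attained on the sphere, where \<open>\<eta> = 0\<close>.\<close>

lemma gradient_estimate:
  fixes v g :: "'a::euclidean_space \<Rightarrow> real" and dv ddv dg ddg :: "'a \<Rightarrow> 'a \<Rightarrow> real"
    and r \<nu> M :: real
  assumes r: "0 < r" "r \<le> 1" and nu: "\<nu> > 0" and M: "M > 0"
    and dv: "\<And>b x s. b \<in> Basis \<Longrightarrow> ((\<lambda>s. v (x + s *\<^sub>R b)) has_real_derivative dv b (x + s *\<^sub>R b)) (at s)"
    and ddv: "\<And>b x s. b \<in> Basis \<Longrightarrow> ((\<lambda>s. dv b (x + s *\<^sub>R b)) has_real_derivative ddv b (x + s *\<^sub>R b)) (at s)"
    and dg: "\<And>b x s. b \<in> Basis \<Longrightarrow> ((\<lambda>s. g (x + s *\<^sub>R b)) has_real_derivative dg b (x + s *\<^sub>R b)) (at s)"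
    and ddg: "\<And>b x s. b \<in> Basis \<Longrightarrow> ((\<lambda>s. dg b (x + s *\<^sub>R b)) has_real_derivative ddg b (x + s *\<^sub>R b)) (at s)"
    and cont: "continuous_on UNIV v" "continuous_on UNIV g"
    and lapv: "\<And>x. x \<in> ball x0 r \<Longrightarrow> (\<Sum>b\<in>Basis. ddv b x) = - \<nu> * v x"
    and lapg: "\<And>x. x \<in> ball x0 r \<Longrightarrow> (\<Sum>b\<in>Basis. ddg b x) = - \<nu> * g x"
    and gv: "\<And>x. x \<in> ball x0 r \<Longrightarrow> (g x)\<^sup>2 \<le> (\<Sum>b\<in>Basis. (dv b x)\<^sup>2)"
    and bd: "\<And>x. x \<in> cball x0 r \<Longrightarrow> \<bar>v x\<bar> \<le> M"
  shows "(g x0)\<^sup>2 \<le> (12 + 2 * real DIM('a) + \<nu>) * (1 + 2 * \<nu>) * M\<^sup>2 / r\<^sup>2"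
proof -
  define d where "d = real DIM('a)"
  have d: "d \<ge> 1" unfolding d_def using DIM_positive[where 'a='a] by linarith
  define A where "A = (12 + 2 * d + \<nu>) * r\<^sup>2"
  have A: "A > 0" using r nu d by (simp add: A_def)
  define Bc where "Bc = 2 * A * \<nu> * M\<^sup>2"
  define E where "E x = (norm (x - x0))\<^sup>2" for x
  define \<eta> where "\<eta> x = r\<^sup>2 - E x" for x
  define P where "P x = (\<eta> x)\<^sup>2 * (g x)\<^sup>2 + A * (v x)\<^sup>2 + Bc * E x" for x
  have "continuous_on (cball x0 r) P"
    unfolding P_def \<eta>_def E_def
    by (intro continuous_intros continuous_on_subset[OF cont(1)] continuous_on_subset[OF cont(2)]) auto
  then obtain y where y: "y \<in> cball x0 r" "\<And>x. x \<in> cball x0 r \<Longrightarrow> P x \<le> P y"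
    using continuous_attains_sup[of "cball x0 r" P] r by (auto simp: less_imp_le)
  have notin: "y \<notin> ball x0 r"
  proof
    assume yb: "y \<in> ball x0 r"
    define L where "L b x = (x - x0) \<bullet> b" for b x
    \<comment> \<open>The second derivative of \<open>P\<close> at \<open>y\<close> in direction
      \<open>b\<close>; summed over the basis it is the Laplacian of \<open>P\<close>, which is at
      most 0 at an interior maximum.\<close>
    define T where "T b = 8 * (L b y)\<^sup>2 * (g y)\<^sup>2 - 4 * \<eta> y * (g y)\<^sup>2 - 16 * \<eta> y * L b y * g y * dg b y
      + 2 * (\<eta> y)\<^sup>2 * (dg b y)\<^sup>2 + 2 * (\<eta> y)\<^sup>2 * g y * ddg b y + 2 * A * (dv b y)\<^sup>2 + 2 * A * v y * ddv b y + 2 * Bc" for b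
    have Tle: "T b \<le> 0" if b: "b \<in> Basis" for b
    proof -
      obtain \<delta> where \<delta>: "\<delta> > 0" "ball y \<delta> \<subseteq> cball x0 r"
        using yb by (meson ball_subset_cball openE open_ball order_trans)
      have dL: "((\<lambda>s. L b (x + s *\<^sub>R b)) has_real_derivative 1) (at s)" for x s
        unfolding L_def using b by (auto intro!: derivative_eq_intros simp: inner_add_left inner_diff_left)
      have Eq: "E (x + s *\<^sub>R b) = E x + 2 * s * L b x + s\<^sup>2" for x s
      proof -
        have "E (x + s *\<^sub>R b) = ((x - x0) + s *\<^sub>R b) \<bullet> ((x - x0) + s *\<^sub>R b)"
          unfolding E_def power2_norm_eq_inner by (simp add: algebra_simps)
        also have "\<dots> = E x + 2 * s * L b x + s\<^sup>2"
          unfolding E_def power2_norm_eq_inner L_def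
          using b by (simp add: inner_add_left inner_add_right inner_commute power2_eq_square algebra_simps)
        finally show ?thesis .
      qed
      have Leq: "L b (x + s *\<^sub>R b) = L b x + s" for x s
        using b by (simp add: L_def inner_add_left inner_diff_left)
      have dE: "((\<lambda>s. E (x + s *\<^sub>R b)) has_real_derivative 2 * L b (x + s *\<^sub>R b)) (at s)" for x s
        unfolding Eq Leq by (auto intro!: derivative_eq_intros simp: algebra_simps)
      have d\<eta>: "((\<lambda>s. \<eta> (x + s *\<^sub>R b)) has_real_derivative - 2 * L b (x + s *\<^sub>R b)) (at s)" for x s
        unfolding \<eta>_def using DERIV_diff[OF DERIV_const dE, of "r\<^sup>2" x s] by simp
      define p' where "p' s = - 4 * \<eta> (y + s *\<^sub>R b) * L b (y + s *\<^sub>R b) * (g (y + s *\<^sub>R b))\<^sup>2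
         + 2 * (\<eta> (y + s *\<^sub>R b))\<^sup>2 * g (y + s *\<^sub>R b) * dg b (y + s *\<^sub>R b)
         + 2 * A * v (y + s *\<^sub>R b) * dv b (y + s *\<^sub>R b) + 2 * Bc * L b (y + s *\<^sub>R b)" for s
      have 1: "((\<lambda>s. P (y + s *\<^sub>R b)) has_real_derivative p' s) (at s)" for s
        unfolding P_def p'_def
        by (rule dE d\<eta> dv[OF b] dg[OF b] derivative_eq_intros refl)+
           (simp add: algebra_simps power2_eq_square)
      have 2: "(p' has_real_derivative T b) (at 0)"
        unfolding p'_def
        by (rule dE d\<eta> dL dv[OF b] dg[OF b] ddv[OF b] ddg[OF b] derivative_eq_intros refl)+
           (simp add: algebra_simps power2_eq_square T_def)
      have 3: "P (y + s *\<^sub>R b) \<le> P (y + 0 *\<^sub>R b)" if "\<bar>s\<bar> < \<delta>" for s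
      proof -
        have "y + s *\<^sub>R b \<in> ball y \<delta>" using that b by (simp add: dist_norm)
        then show ?thesis using y(2) \<delta>(2) by auto
      qed
      show ?thesis by (rule second_derivative_local_max[OF \<delta>(1) 1 2 3])
    qed
    \<comment> \<open>Twice the square of \<open>\<eta> dg - 4 L g\<close> removes both the mixed
      term and the squared derivative of \<open>g\<close>; the coefficient 8 of
      \<open>L\<^sup>2 g\<^sup>2\<close> drops to 8 - 32 = -24.\<close>
    have Tge: "T b \<ge> - 24 * (L b y)\<^sup>2 * (g y)\<^sup>2 - 4 * \<eta> y * (g y)\<^sup>2 + 2 * (\<eta> y)\<^sup>2 * g y * ddg b y
        + 2 * A * (dv b y)\<^sup>2 + 2 * A * v y * ddv b y + 2 * Bc" for b
      using zero_le_power2[of "\<eta> y * dg b y - 4 * L b y * g y"]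
      unfolding T_def by (simp add: power2_eq_square algebra_simps)
    have SL: "(\<Sum>b\<in>Basis. (L b y)\<^sup>2) = E y"
      unfolding L_def E_def power2_norm_eq_inner
      using euclidean_inner[of "y - x0" "y - x0"] by (simp add: power2_eq_square)
    have "(\<Sum>b\<in>(Basis::'a set). - 24 * (L b y)\<^sup>2 * (g y)\<^sup>2 - 4 * \<eta> y * (g y)\<^sup>2 + 2 * (\<eta> y)\<^sup>2 * g y * ddg b y
        + 2 * A * (dv b y)\<^sup>2 + 2 * A * v y * ddv b y + 2 * Bc) \<le> (\<Sum>b\<in>Basis. T b)"
      by (rule sum_mono) (rule Tge)
    also have "\<dots> \<le> 0" by (rule sum_nonpos) (rule Tle)
    finally have "- 24 * (\<Sum>b\<in>Basis. (L b y)\<^sup>2) * (g y)\<^sup>2 - d * (4 * \<eta> y * (g y)\<^sup>2) + 2 * (\<eta> y)\<^sup>2 * g y * (\<Sum>b\<in>Basis. ddg b y)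
        + 2 * A * (\<Sum>b\<in>Basis. (dv b y)\<^sup>2) + 2 * A * v y * (\<Sum>b\<in>Basis. ddv b y) + d * (2 * Bc) \<le> 0"
      by (simp add: sum.distrib sum_subtractf sum_distrib_left sum_distrib_right d_def sum_negf mult.assoc)
    then have main: "- 24 * E y * (g y)\<^sup>2 - d * (4 * \<eta> y * (g y)\<^sup>2) - 2 * \<nu> * (\<eta> y)\<^sup>2 * (g y)\<^sup>2
        + 2 * A * (\<Sum>b\<in>Basis. (dv b y)\<^sup>2) - 2 * A * \<nu> * (v y)\<^sup>2 + d * (2 * Bc) \<le> 0"
      unfolding SL lapv[OF yb] lapg[OF yb] by (simp add: power2_eq_square algebra_simps)
    have E: "0 \<le> E y" "E y \<le> r\<^sup>2" 
      using yb by (auto simp: E_def dist_norm norm_minus_commute intro!: power_mono)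
    have \<eta>: "0 \<le> \<eta> y" "\<eta> y \<le> r\<^sup>2" using E by (auto simp: \<eta>_def)
    have r1: "r\<^sup>2 \<le> 1" using r by (simp add: power_le_one)
    have "(\<eta> y)\<^sup>2 \<le> r\<^sup>2 * r\<^sup>2" unfolding power2_eq_square[of "\<eta> y"] using \<eta> by (intro mult_mono) auto
    also have "\<dots> \<le> r\<^sup>2 * 1" using r1 by (intro mult_left_mono) auto
    finally have \<eta>2: "(\<eta> y)\<^sup>2 \<le> r\<^sup>2" by simp
    have i1: "E y * (g y)\<^sup>2 \<le> r\<^sup>2 * (g y)\<^sup>2" using E by (intro mult_right_mono) auto
    have "\<eta> y * (g y)\<^sup>2 \<le> r\<^sup>2 * (g y)\<^sup>2" using \<eta> by (intro mult_right_mono) auto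
    then have i2: "d * (\<eta> y * (g y)\<^sup>2) \<le> d * (r\<^sup>2 * (g y)\<^sup>2)" using d by (intro mult_left_mono) auto
    have "(\<eta> y)\<^sup>2 * (g y)\<^sup>2 \<le> r\<^sup>2 * (g y)\<^sup>2" using \<eta>2 by (intro mult_right_mono) auto
    then have i3: "\<nu> * ((\<eta> y)\<^sup>2 * (g y)\<^sup>2) \<le> \<nu> * (r\<^sup>2 * (g y)\<^sup>2)" using nu by (intro mult_left_mono) auto
    \<comment> \<open>The gain: the squared gradient of \<open>v\<close>, with its large factor
      \<open>A\<close>, dominates \<open>A * (g y)\<^sup>2\<close>, and this pays for
      \<open>i1\<close> to \<open>i3\<close>.\<close>
    have i4: "A * (g y)\<^sup>2 \<le> A * (\<Sum>b\<in>Basis. (dv b y)\<^sup>2)" using gv[OF yb] A by (intro mult_left_mono) auto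
    have "(v y)\<^sup>2 \<le> M\<^sup>2" using bd[OF y(1)] M by (metis abs_le_square_iff abs_of_pos)
    then have i5: "A * \<nu> * (v y)\<^sup>2 \<le> A * \<nu> * M\<^sup>2" using A nu by (intro mult_left_mono) auto
    have AB: "0 < A * \<nu> * M\<^sup>2" using A nu M by simp
    have "1 * Bc \<le> d * Bc" using d AB unfolding Bc_def by (intro mult_right_mono) auto
    then have i6: "d * Bc \<ge> 2 * (A * \<nu> * M\<^sup>2)" by (simp add: Bc_def)
    have Ag: "A * (g y)\<^sup>2 = 12 * (r\<^sup>2 * (g y)\<^sup>2) + 2 * (d * (r\<^sup>2 * (g y)\<^sup>2)) + \<nu> * (r\<^sup>2 * (g y)\<^sup>2)"
      unfolding A_def by (simp add: algebra_simps)
    have main': "- 24 * (E y * (g y)\<^sup>2) - 4 * (d * (\<eta> y * (g y)\<^sup>2)) - 2 * (\<nu> * ((\<eta> y)\<^sup>2 * (g y)\<^sup>2))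
        + 2 * (A * (\<Sum>b\<in>Basis. (dv b y)\<^sup>2)) - 2 * (A * \<nu> * (v y)\<^sup>2) + 2 * (d * Bc) \<le> 0"
      using main by (simp add: algebra_simps)
    show False using main' i1 i2 i3 i4 i5 i6 AB Ag by linarith
  qed
  then have Ey: "E y = r\<^sup>2" using y(1) by (auto simp: E_def dist_norm norm_minus_commute)
  have "(v y)\<^sup>2 \<le> M\<^sup>2" using bd[OF y(1)] M by (metis abs_le_square_iff abs_of_pos)
  then have "P y \<le> A * M\<^sup>2 + Bc * r\<^sup>2"
    unfolding P_def \<eta>_def Ey using A by simp
  moreover have "P x0 \<le> P y" using y(2)[of x0] r by simp
  moreover have "P x0 \<ge> (r\<^sup>2)\<^sup>2 * (g x0)\<^sup>2"
    using A by (simp add: P_def \<eta>_def E_def)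
  moreover have "A * M\<^sup>2 + Bc * r\<^sup>2 \<le> A * M\<^sup>2 * (1 + 2 * \<nu>)"
  proof -
    have "r\<^sup>2 \<le> 1" using r by (simp add: power_le_one)
    then have "Bc * r\<^sup>2 \<le> Bc * 1" using A nu by (intro mult_left_mono) (auto simp: Bc_def)
    then show ?thesis by (simp add: Bc_def algebra_simps)
  qed
  \<comment> \<open>At the centre \<eta> equals r^2, which gives r^4 on the left; \<open>A\<close>
    contributes r^2 on the right, so that r^(-2) remains after division.\<close>
  ultimately have "(r\<^sup>2)\<^sup>2 * (g x0)\<^sup>2 \<le> (12 + 2 * d + \<nu>) * r\<^sup>2 * M\<^sup>2 * (1 + 2 * \<nu>)"
    unfolding A_def by linarith
  then have "r\<^sup>2 * (r\<^sup>2 * (g x0)\<^sup>2) \<le> r\<^sup>2 * ((12 + 2 * d + \<nu>) * (1 + 2 * \<nu>) * M\<^sup>2)"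
    by (simp add: power2_eq_square algebra_simps)
  then have "r\<^sup>2 * (g x0)\<^sup>2 \<le> (12 + 2 * d + \<nu>) * (1 + 2 * \<nu>) * M\<^sup>2"
    by (rule mult_left_le_imp_le) (use r in simp)
  then show ?thesis using r unfolding d_def by (simp add: pos_le_divide_eq mult.commute)
qed

section \<open>Mollified solutions\<close>

lemma test_function_translate:
  fixes \<psi> :: "'a::euclidean_space \<Rightarrow> real"
  assumes "test_function S \<psi>" "\<And>w. w \<in> S \<Longrightarrow> w - x \<in> T"
  shows "test_function T (\<lambda>y. \<psi> (y + x))"
proof -
  obtain K where K: "smooth_on UNIV \<psi>" "compact K" "K \<subseteq> S" "\<And>x. x \<notin> K \<Longrightarrow> \<psi> x = 0"
    using assms(1) unfolding test_function_def by auto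
  show ?thesis
  proof (rule test_functionI[OF smooth_on_translate[OF K(1)]])
    show "compact ((\<lambda>w. w - x) ` K)" by (intro compact_continuous_image continuous_intros K)
    show "(\<lambda>w. w - x) ` K \<subseteq> T" using K(3) assms(2) by auto
    fix y assume "y \<notin> (\<lambda>w. w - x) ` K"
    then have "y + x \<notin> K" by (metis add_diff_cancel_right' image_eqI)
    then show "\<psi> (y + x) = 0" by (rule K(4))
  qed
qed

lemma test_function_smooth: "test_function S \<psi> \<Longrightarrow> smooth_on UNIV \<psi>"
  unfolding test_function_def by simp

text \<open>The mean value inequality is used for \<open>\<phi>1\<close> and then for \<phi> minus
  its linear part at \<open>s\<close>. The bound is uniform in the base point, so it can be
  integrated against \<open>f\<close> below.\<close>

lemma second_order_taylor_bound:
  fixes \<phi> \<phi>1 \<phi>2 :: "real \<Rightarrow> real"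
  assumes 1: "\<And>s. (\<phi> has_real_derivative \<phi>1 s) (at s)" and 2: "\<And>s. (\<phi>1 has_real_derivative \<phi>2 s) (at s)"
    and C: "\<And>s. \<bar>\<phi>2 s\<bar> \<le> C"
  shows "\<bar>\<phi> t - \<phi> s - (t - s) * \<phi>1 s\<bar> \<le> C * (t - s)\<^sup>2"
proof -
  have a: "\<bar>\<phi>1 z - \<phi>1 s\<bar> \<le> C * \<bar>t - s\<bar>" if z: "z \<in> closed_segment s t" for z
  proof -
    have "norm (\<phi>1 z - \<phi>1 s) \<le> C * norm (z - s)"
      by (rule field_differentiable_bound[of UNIV \<phi>1 \<phi>2]) (use 2 C in auto)
    also have "\<dots> \<le> C * norm (t - s)"
      using C[of 0] z by (intro mult_left_mono) (auto simp: closed_segment_eq_real_ivl split: if_splits)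
    finally show ?thesis by simp
  qed
  have "norm ((\<phi> t - t * \<phi>1 s) - (\<phi> s - s * \<phi>1 s)) \<le> (C * \<bar>t - s\<bar>) * norm (t - s)"
  proof (rule field_differentiable_bound[of "closed_segment s t" "\<lambda>z. \<phi> z - z * \<phi>1 s" "\<lambda>z. \<phi>1 z - \<phi>1 s"])
    fix z show "((\<lambda>z. \<phi> z - z * \<phi>1 s) has_field_derivative \<phi>1 z - \<phi>1 s) (at z within closed_segment s t)"
      by (rule has_field_derivative_at_within) (auto intro!: derivative_eq_intros 1)
  qed (use a in auto)
  then show ?thesis by (simp add: algebra_simps power2_eq_square)
qed

text \<open>Up to a reflection this is the convolution of \<open>f\<close>, restricted to
  \<open>S\<close>, with the kernel \<psi>. Its value at 0 is the pairing of \<open>f\<close> with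
  \<psi>.\<close>

definition shift_integral :: "'a::euclidean_space set \<Rightarrow> ('a \<Rightarrow> real) \<Rightarrow> ('a \<Rightarrow> real) \<Rightarrow> 'a \<Rightarrow> real" where
  "shift_integral S f \<psi> x = integral\<^sup>L (lebesgue_on S) (\<lambda>y. \<psi> (y + x) * f y)"

context
  fixes S :: "'a::euclidean_space set" and f :: "'a \<Rightarrow> real"
  assumes S: "S \<in> sets lebesgue" and f: "integrable (lebesgue_on S) f"
begin

lemma integrable_test_function_mult:
  assumes "test_function T \<psi>"
  shows "integrable (lebesgue_on S) (\<lambda>y. \<psi> (y + x) * f y)"
proof -
  obtain B where B: "B > 0" "\<And>x. \<bar>\<psi> x\<bar> \<le> B" using test_function_bounded[OF assms] by metis
  have c: "continuous_on UNIV (\<lambda>y. \<psi> (y + x))"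
    by (intro smooth_on_continuous smooth_on_translate test_function_smooth[OF assms])
  have m: "(\<lambda>y. \<psi> (y + x)) \<in> borel_measurable (lebesgue_on S)"
    by (rule continuous_imp_measurable_on_sets_lebesgue[OF continuous_on_subset[OF c] S]) auto
  show ?thesis
  proof (rule Bochner_Integration.integrable_bound[of _ "\<lambda>y. B * \<bar>f y\<bar>"])
    show "(\<lambda>y. \<psi> (y + x) * f y) \<in> borel_measurable (lebesgue_on S)"
      using m f by (intro borel_measurable_times) auto
    show "AE y in lebesgue_on S. norm (\<psi> (y + x) * f y) \<le> norm (B * \<bar>f y\<bar>)"
      using B by (intro AE_I2) (auto simp: abs_mult intro!: mult_right_mono)
  qed (use f in auto)
qed

lemma shift_integral_bounded:
  assumes "test_function T \<psi>"
  obtains M where "M > 0" "\<And>x. \<bar>shift_integral S f \<psi> x\<bar> \<le> M"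
proof -
  obtain B where B: "B > 0" "\<And>x. \<bar>\<psi> x\<bar> \<le> B" using test_function_bounded[OF assms] by metis
  define I where "I = integral\<^sup>L (lebesgue_on S) (\<lambda>y. B * \<bar>f y\<bar>)"
  have "\<bar>shift_integral S f \<psi> x\<bar> \<le> I" for x
    unfolding shift_integral_def I_def real_norm_def[symmetric]
  proof (rule Bochner_Integration.integral_norm_bound_integral)
    show "integrable (lebesgue_on S) (\<lambda>y. \<psi> (y + x) * f y)" by (rule integrable_test_function_mult[OF assms])
    show "integrable (lebesgue_on S) (\<lambda>y. B * norm (f y))" using f by auto
    show "norm (\<psi> (y + x) * f y) \<le> B * norm (f y)" for y
      using B by (auto simp: abs_mult intro!: mult_right_mono)
  qed
  then show ?thesis by (intro that[of "max I 1"]) (auto simp: le_max_iff_disj)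
qed

text \<open>The derivative falls on the kernel. Since the second derivative of \<psi> is bounded,
  the Taylor error is uniform in the integration variable, and its integral against |f| is of order
  (t - s)^2.\<close>

lemma shift_integral_derivative:
  assumes \<psi>: "test_function T \<psi>"
  shows "((\<lambda>s. shift_integral S f \<psi> (x + s *\<^sub>R b)) has_real_derivative
     shift_integral S f (pd b \<psi>) (x + s *\<^sub>R b)) (at s)"
proof -
  note \<psi>1 = test_function_pd[OF \<psi>, of b]
  note \<psi>2 = test_function_pd[OF \<psi>1, of b]
  obtain C where C: "C > 0" "\<And>x. \<bar>pd b (pd b \<psi>) x\<bar> \<le> C" using test_function_bounded[OF \<psi>2] by metis
  define I where "I = integral\<^sup>L (lebesgue_on S) (\<lambda>y. \<bar>f y\<bar>)"
  define F where "F s = shift_integral S f \<psi> (x + s *\<^sub>R b)" for s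
  define F' where "F' s = shift_integral S f (pd b \<psi>) (x + s *\<^sub>R b)" for s
  have est: "\<bar>F t - F s - (t - s) * F' s\<bar> \<le> C * (t - s)\<^sup>2 * I" for t
  proof -
    have "F t - F s - (t - s) * F' s = integral\<^sup>L (lebesgue_on S) (\<lambda>y. \<psi> (y + (x + t *\<^sub>R b)) * f y
        - \<psi> (y + (x + s *\<^sub>R b)) * f y - (t - s) * (pd b \<psi> (y + (x + s *\<^sub>R b)) * f y))"
      unfolding F_def F'_def shift_integral_def
      using integrable_test_function_mult[OF \<psi>] integrable_test_function_mult[OF \<psi>1] by simp
    also have "norm \<dots> \<le> integral\<^sup>L (lebesgue_on S) (\<lambda>y. (C * (t - s)\<^sup>2) * \<bar>f y\<bar>)"
    proof (rule Bochner_Integration.integral_norm_bound_integral)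
      show "integrable (lebesgue_on S) (\<lambda>y. \<psi> (y + (x + t *\<^sub>R b)) * f y
        - \<psi> (y + (x + s *\<^sub>R b)) * f y - (t - s) * (pd b \<psi> (y + (x + s *\<^sub>R b)) * f y))"
        using integrable_test_function_mult[OF \<psi>] integrable_test_function_mult[OF \<psi>1] by auto
      show "integrable (lebesgue_on S) (\<lambda>y. (C * (t - s)\<^sup>2) * \<bar>f y\<bar>)" using f by auto
      fix y
      define w where "w = y + x"
      have "\<bar>\<psi> (w + t *\<^sub>R b) - \<psi> (w + s *\<^sub>R b) - (t - s) * pd b \<psi> (w + s *\<^sub>R b)\<bar> \<le> C * (t - s)\<^sup>2"
        by (rule second_order_taylor_bound[OF smooth_on_line_derivative[OF test_function_smooth[OF \<psi>]]
              smooth_on_line_derivative[OF test_function_smooth[OF \<psi>1]] C(2)])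
      then have "\<bar>\<psi> (w + t *\<^sub>R b) - \<psi> (w + s *\<^sub>R b) - (t - s) * pd b \<psi> (w + s *\<^sub>R b)\<bar> * \<bar>f y\<bar> \<le> C * (t - s)\<^sup>2 * \<bar>f y\<bar>"
        by (intro mult_right_mono) auto
      then show "norm (\<psi> (y + (x + t *\<^sub>R b)) * f y
        - \<psi> (y + (x + s *\<^sub>R b)) * f y - (t - s) * (pd b \<psi> (y + (x + s *\<^sub>R b)) * f y)) \<le> (C * (t - s)\<^sup>2) * \<bar>f y\<bar>"
        unfolding w_def abs_mult[symmetric] real_norm_def by (simp add: algebra_simps)
    qed
    finally show ?thesis unfolding I_def by simp
  qed
  have "((\<lambda>t. (F t - F s) / (t - s) - F' s) \<longlongrightarrow> 0) (at s)"
  proof (rule Lim_null_comparison)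
    have "norm ((F t - F s) / (t - s) - F' s) \<le> C * I * \<bar>t - s\<bar>" if "t \<noteq> s" for t
    proof -
      have "(F t - F s) / (t - s) - F' s = (F t - F s - (t - s) * F' s) / (t - s)"
        using that by (simp add: field_simps)
      then have "norm ((F t - F s) / (t - s) - F' s) = \<bar>F t - F s - (t - s) * F' s\<bar> / \<bar>t - s\<bar>" by simp
      also have "\<dots> \<le> C * (t - s)\<^sup>2 * I / \<bar>t - s\<bar>" by (intro divide_right_mono est) auto
      also have "\<dots> = C * I * \<bar>t - s\<bar>"
      proof -
        have "(t - s)\<^sup>2 = \<bar>t - s\<bar> * \<bar>t - s\<bar>" by (metis power2_abs power2_eq_square)
        then show ?thesis using that by (simp del: abs_mult_self_eq)
      qed
      finally show ?thesis .
    qed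
    then show "\<forall>\<^sub>F t in at s. norm ((F t - F s) / (t - s) - F' s) \<le> C * I * \<bar>t - s\<bar>"
      by (auto simp: eventually_at_filter)
    show "((\<lambda>t. C * I * \<bar>t - s\<bar>) \<longlongrightarrow> 0) (at s)" by (auto intro!: tendsto_eq_intros)
  qed
  then have "(F has_real_derivative F' s) (at s)"
    unfolding has_field_derivative_iff by (rule LIM_zero_cancel)
  then show ?thesis unfolding F_def F'_def .
qed

lemma shift_integral_continuous:
  assumes \<psi>: "test_function T \<psi>"
  shows "continuous_on UNIV (shift_integral S f \<psi>)"
proof (rule continuous_on_sequentiallyI)
  fix u :: "nat \<Rightarrow> 'a" and a assume u: "u \<longlonglongrightarrow> a"
  obtain B where B: "B > 0" "\<And>x. \<bar>\<psi> x\<bar> \<le> B" using test_function_bounded[OF \<psi>] by metis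
  have c: "isCont \<psi> w" for w
    using smooth_on_continuous[OF test_function_smooth[OF \<psi>]] continuous_on_eq_continuous_at open_UNIV by blast
  show "(\<lambda>n. shift_integral S f \<psi> (u n)) \<longlonglongrightarrow> shift_integral S f \<psi> a"
    unfolding shift_integral_def
  proof (rule integral_dominated_convergence[where w = "\<lambda>y. B * \<bar>f y\<bar>"])
    show "(\<lambda>y. \<psi> (y + a) * f y) \<in> borel_measurable (lebesgue_on S)"
      "\<And>n. (\<lambda>y. \<psi> (y + u n) * f y) \<in> borel_measurable (lebesgue_on S)"
      using integrable_test_function_mult[OF \<psi>] by (meson borel_measurable_integrable)+
    show "AE y in lebesgue_on S. (\<lambda>n. \<psi> (y + u n) * f y) \<longlonglongrightarrow> \<psi> (y + a) * f y"
      by (intro AE_I2 tendsto_mult tendsto_const isCont_tendsto_compose[OF c] tendsto_add u)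
    show "AE y in lebesgue_on S. norm (\<psi> (y + u n) * f y) \<le> B * \<bar>f y\<bar>" for n
      using B by (intro AE_I2) (auto simp: abs_mult intro!: mult_right_mono)
  qed (use f in auto)
qed

lemma shift_integral_pd_sum:
  assumes \<psi>: "test_function T \<psi>"
  shows "shift_integral S f (pd e \<psi>) x = (\<Sum>b\<in>Basis. (e \<bullet> b) * shift_integral S f (pd b \<psi>) x)"
proof -
  have "pd e \<psi> (y + x) * f y = (\<Sum>b\<in>Basis. (e \<bullet> b) * (pd b \<psi> (y + x) * f y))" for y
    unfolding pd_eq_sum_Basis[OF test_function_smooth[OF \<psi>], where e=e and x="y + x"]
    by (simp add: sum_distrib_right mult.assoc)
  then show ?thesis
    unfolding shift_integral_def
    using integrable_test_function_mult[OF test_function_pd[OF \<psi>]] by simp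
qed

context
  fixes \<nu> :: real
  assumes nu: "\<nu> > 0"
    and helmholtz: "\<And>\<psi>. test_function S \<psi> \<Longrightarrow>
      integral\<^sup>L (lebesgue_on S) (\<lambda>y. (\<Sum>b\<in>Basis. pd b (pd b \<psi>) y) * f y) = - \<nu> * integral\<^sup>L (lebesgue_on S) (\<lambda>y. \<psi> y * f y)"
begin

text \<open>The weak equation is tested with the translate of \<psi> by \<open>x\<close>, which is
  admissible because the assumption on \<open>T\<close> moves its support into
  \<open>S\<close>.\<close>

lemma shift_integral_helmholtz:
  assumes \<psi>: "test_function T \<psi>" and T: "\<And>w. w \<in> T \<Longrightarrow> w - x \<in> S"
  shows "(\<Sum>b\<in>Basis. shift_integral S f (pd b (pd b \<psi>)) x) = - \<nu> * shift_integral S f \<psi> x"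
proof -
  note s = test_function_smooth[OF \<psi>]
  have eq: "pd b (pd b (\<lambda>y. \<psi> (y + x))) y = pd b (pd b \<psi>) (y + x)" for b y
    unfolding pd_translate[OF s] by (rule fun_cong[OF pd_translate[OF smooth_on_pd[OF s]]])
  have "(\<Sum>b\<in>Basis. shift_integral S f (pd b (pd b \<psi>)) x)
      = integral\<^sup>L (lebesgue_on S) (\<lambda>y. (\<Sum>b\<in>Basis. pd b (pd b \<psi>) (y + x)) * f y)"
    unfolding shift_integral_def
    using integrable_test_function_mult[OF test_function_pd[OF test_function_pd[OF \<psi>]]]
    by (simp add: sum_distrib_right)
  also have "\<dots> = - \<nu> * shift_integral S f \<psi> x"
    using helmholtz[OF test_function_translate[OF \<psi> T]] unfolding eq shift_integral_def by simp
  finally show ?thesis .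
qed

text \<open>The square root of the constant in \<open>gradient_estimate\<close>.\<close>

definition grad_const :: real where
  "grad_const = sqrt ((12 + 2 * real DIM('a) + \<nu>) * (1 + 2 * \<nu>))"

lemma grad_const_ge_1: "grad_const \<ge> 1"
proof -
  have "1 * 1 \<le> (12 + 2 * real DIM('a) + \<nu>) * (1 + 2 * \<nu>)"
    using nu by (intro mult_mono) auto
  then show ?thesis unfolding grad_const_def by simp
qed

text \<open>A directional derivative is again a shift integral and so solves the same equation; by
  Cauchy-Schwarz with |e| = 1 its square is at most that of the full gradient. These are the
  requirements of \<open>gradient_estimate\<close> on \<open>v\<close> and \<open>g\<close>.\<close>

lemma shift_integral_gradient_bound:
  assumes \<psi>: "test_function T \<psi>" and e: "norm e = 1" and r: "0 < r" "r \<le> 1" and M: "M > 0"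
    and T: "\<And>y w. y \<in> ball x r \<Longrightarrow> w \<in> T \<Longrightarrow> w - y \<in> S"
    and bd: "\<And>y. y \<in> cball x r \<Longrightarrow> \<bar>shift_integral S f \<psi> y\<bar> \<le> M"
  shows "\<bar>shift_integral S f (pd e \<psi>) x\<bar> \<le> grad_const * M / r"
proof -
  note \<psi>1 = test_function_pd[OF \<psi>]
  note \<psi>2 = test_function_pd[OF \<psi>1]
  note \<psi>3 = test_function_pd[OF \<psi>2]
  have ee: "(\<Sum>b\<in>Basis. (e \<bullet> b)\<^sup>2) = 1"
    using e euclidean_inner[of e e] by (simp add: power2_eq_square norm_eq_1)
  have gv: "(shift_integral S f (pd e \<psi>) y)\<^sup>2 \<le> (\<Sum>b\<in>Basis. (shift_integral S f (pd b \<psi>) y)\<^sup>2)" for y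
    using Cauchy_Schwarz_ineq_sum[of "\<lambda>b. e \<bullet> b" "\<lambda>b. shift_integral S f (pd b \<psi>) y" Basis]
    unfolding shift_integral_pd_sum[OF \<psi>, of e] ee by simp
  have lap: "(\<Sum>b\<in>Basis. shift_integral S f (pd b (pd b \<psi>)) y) = - \<nu> * shift_integral S f \<psi> y"
    "(\<Sum>b\<in>Basis. shift_integral S f (pd b (pd b (pd e \<psi>))) y) = - \<nu> * shift_integral S f (pd e \<psi>) y"
    if "y \<in> ball x r" for y
    by (rule shift_integral_helmholtz[OF \<psi> T[OF that]], assumption,
        rule shift_integral_helmholtz[OF \<psi>1 T[OF that]], assumption)
  have "(shift_integral S f (pd e \<psi>) x)\<^sup>2
     \<le> (12 + 2 * real DIM('a) + \<nu>) * (1 + 2 * \<nu>) * M\<^sup>2 / r\<^sup>2"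
    by (rule gradient_estimate[OF r nu M, where v = "shift_integral S f \<psi>"
        and dv = "\<lambda>b. shift_integral S f (pd b \<psi>)" and ddv = "\<lambda>b. shift_integral S f (pd b (pd b \<psi>))"
        and dg = "\<lambda>b. shift_integral S f (pd b (pd e \<psi>))" and ddg = "\<lambda>b. shift_integral S f (pd b (pd b (pd e \<psi>)))",
        OF shift_integral_derivative[OF \<psi>] shift_integral_derivative[OF \<psi>1] shift_integral_derivative[OF \<psi>1]
        shift_integral_derivative[OF \<psi>2] shift_integral_continuous[OF \<psi>] shift_integral_continuous[OF \<psi>1]
        lap gv bd])
  then have "\<bar>shift_integral S f (pd e \<psi>) x\<bar> \<le> sqrt ((12 + 2 * real DIM('a) + \<nu>) * (1 + 2 * \<nu>) * M\<^sup>2 / r\<^sup>2)"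
    by (intro real_le_rsqrt) simp
  also have "\<dots> = grad_const * M / r"
    unfolding grad_const_def using r M by (simp add: real_sqrt_mult real_sqrt_divide)
  finally show ?thesis .
qed

text \<open>Each derivative costs a factor \<open>grad_const / r\<close> and a margin
  \<open>r\<close>. The condition on \<open>x\<close> reserves the margins for all \<open>j\<close>
  derivatives, so the induction hypothesis holds on the closed ball of radius \<open>r\<close>
  around \<open>x\<close>.\<close>

lemma shift_integral_iterated_bound:
  assumes \<psi>: "test_function T \<psi>" and e: "norm e = 1" and r: "0 < r" "r \<le> 1" and M: "M > 0"
    and T: "\<And>y w. y \<in> ball z R \<Longrightarrow> w \<in> T \<Longrightarrow> w - y \<in> S"
    and bd: "\<And>y. \<bar>shift_integral S f \<psi> y\<bar> \<le> M"
    and x: "dist z x + real j * r < R"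
  shows "\<bar>shift_integral S f ((pd e ^^ j) \<psi>) x\<bar> \<le> (grad_const / r) ^ j * M"
  using x
proof (induction j arbitrary: x)
  case 0
  then show ?case using bd by simp
next
  case (Suc j)
  have tj: "test_function T ((pd e ^^ j) \<psi>)"
    by (induction j) (use \<psi> in \<open>auto intro: test_function_pd\<close>)
  have g: "grad_const > 0" using grad_const_ge_1 by linarith
  have "\<bar>shift_integral S f (pd e ((pd e ^^ j) \<psi>)) x\<bar> \<le> grad_const * ((grad_const / r) ^ j * M) / r"
  proof (rule shift_integral_gradient_bound[OF tj e r])
    show "0 < (grad_const / r) ^ j * M" using g r M by simp
    have tri: "dist z y \<le> dist z x + dist x y" for y by (rule dist_triangle)
    show "w - y \<in> S" if "y \<in> ball x r" "w \<in> T" for y w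
    proof (rule T[OF _ that(2)])
      have "0 \<le> real j * r" using r by simp
      then show "y \<in> ball z R" using tri[of y] that(1) Suc.prems by (simp add: algebra_simps)
    qed
    show "\<bar>shift_integral S f ((pd e ^^ j) \<psi>) y\<bar> \<le> (grad_const / r) ^ j * M" if "y \<in> cball x r" for y
      by (rule Suc.IH) (use tri[of y] that Suc.prems in \<open>simp add: algebra_simps\<close>)
  qed
  then show ?case by (simp add: mult_ac)
qed

text \<open>By the iterated gradient estimate the Taylor series along each line converges to the function.\<close>

lemma shift_integral_vanishes:
  assumes \<psi>: "test_function T \<psi>" and \<rho>: "0 < \<rho>" "\<rho> \<le> 1"
    and T: "\<And>y w. y \<in> ball z (2 * \<rho>) \<Longrightarrow> w \<in> T \<Longrightarrow> w - y \<in> S"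
    and zero: "\<eta> > 0" "\<And>y. y \<in> ball z \<eta> \<Longrightarrow> shift_integral S f \<psi> y = 0"
    and x: "dist z x \<le> \<rho> / (4 * grad_const)"
  shows "shift_integral S f \<psi> x = 0"
proof (cases "x = z")
  case True
  then show ?thesis using zero by simp
next
  case False
  define e where "e = (x - z) /\<^sub>R norm (x - z)"
  define s where "s = norm (x - z)"
  have e: "norm e = 1" using False by (simp add: e_def)
  have xs: "x = z + s *\<^sub>R e" using False by (simp add: e_def s_def)
  have g: "grad_const \<ge> 1" by (rule grad_const_ge_1)
  have s: "0 < s" "s \<le> \<rho> / (4 * grad_const)"
    using x False by (auto simp: s_def dist_norm norm_minus_commute)
  have "\<rho> / (4 * grad_const) < \<rho> / 1" using \<rho> g by (intro divide_strict_left_mono) auto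
  then have s\<rho>: "s < \<rho>" using s by simp
  obtain M where M: "M > 0" "\<And>y. \<bar>shift_integral S f \<psi> y\<bar> \<le> M" using shift_integral_bounded[OF \<psi>] by metis
  have tj: "test_function T ((pd e ^^ j) \<psi>)" for j
    by (induction j) (use \<psi> in \<open>auto intro: test_function_pd\<close>)
  define F where "F m t = shift_integral S f ((pd e ^^ m) \<psi>) (z + t *\<^sub>R e)" for m t
  have dF: "(F m has_real_derivative F (Suc m) t) (at t)" for m t
    unfolding F_def using shift_integral_derivative[OF tj[of m], of z e t] by simp
  \<comment> \<open>Vanishing near \<open>z\<close> kills all Taylor coefficients at
    \<open>z\<close>, so only the remainder is left to estimate.\<close>
  have F0: "F m t = 0" if "\<bar>t\<bar> < \<eta>" for m t
    using that
  proof (induction m arbitrary: t)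
    case 0
    then show ?case using zero(2)[of "z + t *\<^sub>R e"] e by (simp add: F_def dist_norm)
  next
    case (Suc m)
    have "(F m has_real_derivative 0) (at t)"
      by (rule has_field_derivative_transform_within_open[of "\<lambda>_. 0" 0 t "{-\<eta><..<\<eta>}"])
         (use Suc in \<open>auto simp: Suc.IH abs_less_iff\<close>)
    then show ?case using dF DERIV_unique by blast
  qed
  have bound: "\<bar>F 0 s\<bar> \<le> (3 / 4) ^ n * M" if n: "n > 0" for n
  proof -
    obtain t where t: "\<bar>t\<bar> \<le> \<bar>s\<bar>" "F 0 s = (\<Sum>m<n. F m 0 / fact m * s ^ m) + F n t / fact n * s ^ n"
      using Maclaurin_all_le[of F "F 0" s n] dF by blast
    have eq: "F 0 s = F n t / fact n * s ^ n" unfolding t(2) using F0[of 0] zero(1) by simp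
    \<comment> \<open>The \<open>n\<close> margins of length \<rho> / n add up to \<rho>, and the
      point itself is at distance |t| < \<rho> from \<open>z\<close>; together they stay below 2
      \<rho>.\<close>
    define r where "r = \<rho> / n"
    have r: "0 < r" "r \<le> 1" using \<rho> n by (auto simp: r_def divide_le_eq)
    have "\<bar>F n t\<bar> \<le> (grad_const / r) ^ n * M"
      unfolding F_def
    proof (rule shift_integral_iterated_bound[OF \<psi> e r M(1) T M(2)])
      show "dist z (z + t *\<^sub>R e) + real n * r < 2 * \<rho>"
        using t(1) s(1) s\<rho> e n by (simp add: dist_norm r_def)
    qed
    then have "\<bar>F 0 s\<bar> \<le> (grad_const / r) ^ n * M / fact n * s ^ n"
      unfolding eq abs_mult abs_divide using s(1)
      by (auto simp: power_abs intro!: mult_right_mono divide_right_mono)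
    also have "\<dots> = (grad_const * s / \<rho>) ^ n * (real n ^ n / fact n) * M"
      unfolding r_def using \<rho> n by (simp add: power_mult_distrib power_divide field_simps)
    \<comment> \<open>Here the 4 in the hypothesis on \<open>x\<close> pays off: n^n / n! is at most
      e^n, and e / 4 \<le> 3 / 4, so the remainder decays geometrically.\<close>
    also have "\<dots> \<le> (1 / 4) ^ n * exp (real n) * M"
    proof -
      have "grad_const * s / \<rho> \<le> 1 / 4" using s(2) g \<rho> by (simp add: field_simps)
      then have "(grad_const * s / \<rho>) ^ n \<le> (1 / 4) ^ n" using g s \<rho> by (intro power_mono) auto
      then show ?thesis
        using exp_ge_power_div_fact[of "real n" n] M by (intro mult_right_mono mult_mono) auto
    qed
    also have "exp (real n) = exp 1 ^ n" by (simp add: exp_of_nat_mult[symmetric])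
    also have "(1 / 4) ^ n * exp 1 ^ n * M \<le> (3 / 4) ^ n * M"
    proof -
      have "(1 / 4 * exp 1) ^ n \<le> (3 / 4 :: real) ^ n" using exp_le by (intro power_mono) auto
      then show ?thesis using M by (intro mult_right_mono) (auto simp: power_mult_distrib[symmetric])
    qed
    finally show ?thesis .
  qed
  have "(\<lambda>n. (3 / 4 :: real) ^ n * M) \<longlonglongrightarrow> 0 * M"
    by (intro tendsto_mult tendsto_const LIMSEQ_power_zero) auto
  moreover have "\<forall>\<^sub>F n in sequentially. \<bar>F 0 s\<bar> \<le> (3 / 4) ^ n * M"
    using bound eventually_gt_at_top[of 0] by (rule eventually_mono[rotated])
  ultimately have "\<bar>F 0 s\<bar> \<le> 0 * M" using tendsto_lowerbound trivial_limit_sequentially by blast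
  then show ?thesis by (simp add: F_def xs)
qed

end
end

section \<open>Unique continuation\<close>

lemma test_function_eq_0_outside:
  assumes "test_function S \<psi>" "x \<notin> S" shows "\<psi> x = 0"
  using assms unfolding test_function_def by (metis subsetD)

text \<open>Local null sets can be glued because Lindelof's theorem reduces the open cover to a
  countable one.\<close>

lemma AE_local:
  fixes M :: "'a::second_countable_topology measure"
  assumes "\<And>x. x \<in> S \<Longrightarrow> \<exists>T. open T \<and> x \<in> T \<and> (AE y in M. y \<in> T \<longrightarrow> P y)"
  shows "AE y in M. y \<in> S \<longrightarrow> P y"
proof -
  define F where "F = {T. open T \<and> (AE y in M. y \<in> T \<longrightarrow> P y)}"
  obtain F' where F': "F' \<subseteq> F" "countable F'" "\<Union>F' = \<Union>F"
    by (rule Lindelof[of F]) (auto simp: F_def)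
  have "AE y in M. \<forall>T\<in>F'. y \<in> T \<longrightarrow> P y"
    unfolding AE_ball_countable[OF F'(2)] using F'(1) by (auto simp: F_def)
  moreover have "S \<subseteq> \<Union>F'" unfolding F'(3) F_def using assms by blast
  ultimately show ?thesis by (auto elim!: eventually_mono)
qed

text \<open>Dynkin's argument: open boxes are stable under intersection and generate the Borel sets.
  Intersecting with a fixed box keeps complements inside \<open>S\<close>.\<close>

lemma borel_integral_zero_of_box_integrals:
  fixes g :: "'a::euclidean_space \<Rightarrow> real"
  assumes g: "integrable lborel g"
    and box0: "\<And>a b. cbox a b \<subseteq> S \<Longrightarrow> (LINT x:box a b|lborel. g x) = 0"
    and cd: "cbox c d \<subseteq> S" and A: "A \<in> sets borel"
  shows "(LINT x:A \<inter> box c d|lborel. g x) = 0"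
proof -
  define E where "E = range (\<lambda>(a, b). box a b :: 'a set)"
  have st: "Int_stable E" by (auto simp: Int_stable_def box_Int_box E_def)
  have sig: "sets (borel :: 'a measure) = sigma_sets UNIV E" unfolding borel_eq_box E_def by (simp add: sets_measure_of)
  have si: "set_integrable lborel X g" if "X \<in> sets borel" for X
    using g that unfolding set_integrable_def by (intro integrable_mult_indicator) auto
  have "A \<in> sigma_sets UNIV E" using A sig by simp
  have pw: "E \<subseteq> Pow UNIV" by simp
  from st pw \<open>A \<in> sigma_sets UNIV E\<close> show ?thesis
  proof (induction rule: sigma_sets_induct_disjoint)
    case (basic A)
    then obtain a b where "A = box a b" by (auto simp: E_def)
    then obtain a' b' where ab: "A \<inter> box c d = box a' b'" by (auto simp: box_Int_box)
    show ?case
    proof (cases "box a' b' = {}")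
      case True
      then show ?thesis unfolding ab by (simp add: set_lebesgue_integral_def)
    next
      case False
      \<comment> \<open>\<open>box0\<close> asks for the closed box inside \<open>S\<close>. A
        nonempty open box contained in \<open>cbox c d\<close> brings its closure along; the empty
        one is treated separately since its \<open>cbox\<close> need not be the closure.\<close>
      have "box a' b' \<subseteq> cbox c d" using ab box_subset_cbox by blast
      then have "cbox a' b' \<subseteq> cbox c d" using closure_minimal[OF _ closed_cbox] closure_box[OF False] by metis
      then show ?thesis unfolding ab using box0 cd by blast
    qed
  next
    case empty
    then show ?case by (simp add: set_lebesgue_integral_def)
  next
    case (compl A)
    then have Am: "A \<in> sets borel" using sig by simp
    have eq: "(\<lambda>x. indicator ((UNIV - A) \<inter> box c d) x *\<^sub>R g x)
        = (\<lambda>x. indicator (box c d) x *\<^sub>R g x - indicator (A \<inter> box c d) x *\<^sub>R g x)"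
      by (auto simp: indicator_def fun_eq_iff)
    have "(LINT x:(UNIV - A) \<inter> box c d|lborel. g x) = (LINT x:box c d|lborel. g x) - (LINT x:A \<inter> box c d|lborel. g x)"
      unfolding set_lebesgue_integral_def eq
      using si[of "box c d"] si[of "A \<inter> box c d"] Am unfolding set_integrable_def
      by (intro Bochner_Integration.integral_diff) auto
    then show ?case using compl box0[OF cd] by simp
  next
    case (union A)
    then have Am: "A i \<in> sets borel" for i using sig by auto
    have "(LINT x:(\<Union>i. A i \<inter> box c d)|lborel. g x) = (\<Sum>i. (LINT x:(A i \<inter> box c d)|lborel. g x))"
      by (rule lebesgue_integral_countable_add)
         (use union(1) Am si in \<open>auto simp: disjoint_family_on_def\<close>)
    then show ?case using union by simp
  qed
qed

text \<open>The previous lemma is applied to the sets where g > 0 and where g < 0; there the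
  integrand has one sign, so a vanishing integral forces it to vanish.\<close>

lemma AE_zero_of_box_integrals:
  fixes g :: "'a::euclidean_space \<Rightarrow> real"
  assumes g: "integrable lborel g" and S: "open S"
    and box0: "\<And>a b. cbox a b \<subseteq> S \<Longrightarrow> (LINT x:box a b|lborel. g x) = 0"
  shows "AE x in lborel. x \<in> S \<longrightarrow> g x = 0"
proof (rule AE_local)
  fix x assume "x \<in> S"
  then obtain c d where cd: "cbox c d \<subseteq> S" "x \<in> box c d" using open_contains_cbox[OF S] by metis
  have gm[measurable]: "g \<in> borel_measurable borel" using g by auto
  have *: "AE x in lborel. x \<in> box c d \<longrightarrow> \<not> k * g x > 0" for k :: real
  proof -
    define A where "A = {x. k * g x > 0}"
    have A: "A \<in> sets borel" unfolding A_def by measurable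
    have 0: "integral\<^sup>L lborel (\<lambda>x. k * (indicator (A \<inter> box c d) x *\<^sub>R g x)) = 0"
      using borel_integral_zero_of_box_integrals[OF g box0 cd(1) A]
      by (simp add: set_lebesgue_integral_def)
    have i: "integrable lborel (\<lambda>x. k * (indicator (A \<inter> box c d) x *\<^sub>R g x))"
      by (intro integrable_mult_right integrable_mult_indicator g) (use A in auto)
    have "AE x in lborel. k * (indicator (A \<inter> box c d) x *\<^sub>R g x) = 0"
      using 0 by (subst (asm) integral_nonneg_eq_0_iff_AE[OF i]) (auto simp: indicator_def A_def)
    then show ?thesis by eventually_elim (auto simp: A_def indicator_def split: if_splits)
  qed
  have "AE x in lborel. x \<in> box c d \<longrightarrow> g x = 0"
    using *[of 1] *[of "-1"] by eventually_elim auto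
  then show "\<exists>T. open T \<and> x \<in> T \<and> (AE y in lborel. y \<in> T \<longrightarrow> g y = 0)"
    using cd(2) open_box by blast
qed

section \<open>Smooth approximation of box indicators, and the fundamental lemma\<close>

lemma flat_0: "0 \<le> flat 0 t" "flat 0 t \<le> 1" "t \<le> 0 \<Longrightarrow> flat 0 t = 0"
  by (auto simp: flat_def)

lemma flat_0_tendsto:
  assumes "t > 0" shows "(\<lambda>n. flat 0 (real (Suc n) * t)) \<longlonglongrightarrow> 1"
proof -
  have "(\<lambda>n. exp (- (inverse t * inverse (real (Suc n))))) \<longlonglongrightarrow> exp (- (inverse t * 0))"
    by (intro tendsto_exp tendsto_minus tendsto_mult tendsto_const LIMSEQ_inverse_real_of_nat)
  then show ?thesis using assms by (simp add: flat_def divide_inverse mult.commute)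
qed

text \<open>A smooth function with values in [0, 1] that vanishes off the box; the scaling by
  \<open>n\<close> steepens it, so that it tends pointwise to the indicator of the open box.\<close>

definition box_bump :: "'a::euclidean_space \<Rightarrow> 'a \<Rightarrow> nat \<Rightarrow> 'a \<Rightarrow> real" where
  "box_bump a b n y = (\<Prod>i\<in>Basis. flat 0 (real (Suc n) * (y \<bullet> i - a \<bullet> i)) * flat 0 (real (Suc n) * (b \<bullet> i - y \<bullet> i)))"

lemma box_bump_bounds: "0 \<le> box_bump a b n y" "box_bump a b n y \<le> 1"
  unfolding box_bump_def by (auto intro!: prod_nonneg prod_le_1 mult_le_one flat_0 mult_nonneg_nonneg)

lemma smooth_on_affine_inner: "smooth_on UNIV (\<lambda>y. k * (y \<bullet> i - c))" "smooth_on UNIV (\<lambda>y. k * (c - y \<bullet> i))"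
  for k c :: real
proof -
  have 1: "smooth_on UNIV (\<lambda>y. (k' * (y \<bullet> i)) + c')" for k' c' :: real
    by (intro smooth_on_add smooth_on_const smooth_on_linear bounded_linear_intros)
  from 1[of k "- k * c"] show "smooth_on UNIV (\<lambda>y. k * (y \<bullet> i - c))" by (simp add: algebra_simps)
  from 1[of "- k" "k * c"] show "smooth_on UNIV (\<lambda>y. k * (c - y \<bullet> i))" by (simp add: algebra_simps)
qed

lemma test_function_box_bump: "test_function (cbox a b) (box_bump a b n)"
proof (rule test_functionI)
  show "smooth_on UNIV (box_bump a b n)"
    unfolding box_bump_def
    by (rule smooth_on_prod, rule smooth_on_mult; rule smooth_on_compose[OF smooth_on_flat], rule smooth_on_affine_inner)
  fix y assume "y \<notin> cbox a b"
  then obtain i where i: "i \<in> Basis" "y \<bullet> i \<le> a \<bullet> i \<or> b \<bullet> i \<le> y \<bullet> i" by (force simp: mem_box)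
  then have "flat 0 (real (Suc n) * (y \<bullet> i - a \<bullet> i)) = 0 \<or> flat 0 (real (Suc n) * (b \<bullet> i - y \<bullet> i)) = 0"
    by (auto intro!: flat_0(3) mult_nonneg_nonpos)
  then show "box_bump a b n y = 0" unfolding box_bump_def using i(1) by (auto intro!: prod_zero)
qed auto

lemma box_bump_tendsto: "(\<lambda>n. box_bump a b n y) \<longlonglongrightarrow> indicator (box a b) y"
proof (cases "y \<in> box a b")
  case True
  have "(\<lambda>n. box_bump a b n y) \<longlonglongrightarrow> (\<Prod>i\<in>(Basis::'a set). 1 * 1)"
    unfolding box_bump_def using True
    by (intro tendsto_prod tendsto_mult flat_0_tendsto) (auto simp: mem_box)
  then show ?thesis using True by simp
next
  case False
  then obtain i where i: "i \<in> Basis" "y \<bullet> i \<le> a \<bullet> i \<or> b \<bullet> i \<le> y \<bullet> i" by (force simp: mem_box)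
  have "box_bump a b n y = 0" for n
  proof -
    have "flat 0 (real (Suc n) * (y \<bullet> i - a \<bullet> i)) = 0 \<or> flat 0 (real (Suc n) * (b \<bullet> i - y \<bullet> i)) = 0"
      using i(2) by (auto intro!: flat_0(3) mult_nonneg_nonpos)
    then show ?thesis unfolding box_bump_def using i(1) by (auto intro!: prod_zero)
  qed
  then show ?thesis using False by simp
qed

text \<open>Testing with \<open>box_bump\<close> and passing to the limit yields vanishing integrals
  over boxes. The Borel representative \<open>g\<close> of \<open>f\<close> is introduced because
  the Dynkin argument takes place in \<open>lborel\<close>.\<close>

lemma fundamental_lemma:
  fixes f :: "'a::euclidean_space \<Rightarrow> real"
  assumes S: "open S" and f: "integrable (lebesgue_on S) f"
    and zero: "\<And>\<psi>. test_function S \<psi> \<Longrightarrow> integral\<^sup>L (lebesgue_on S) (\<lambda>y. \<psi> y * f y) = 0"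
  shows "AE x in lebesgue_on S. f x = 0"
proof -
  have Sm: "S \<inter> space lebesgue \<in> sets lebesgue" using S by auto
  have fS: "integrable lebesgue (\<lambda>x. indicator S x *\<^sub>R f x)"
    using f unfolding integrable_restrict_space[OF Sm] .
  then obtain g where g: "g \<in> borel_measurable lborel" "AE x in lborel. indicator S x *\<^sub>R f x = g x"
    using completion_ex_borel_measurable_real[of "\<lambda>x. indicator S x *\<^sub>R f x" lborel] by auto
  have AEg: "AE x in lebesgue. indicator S x *\<^sub>R f x = g x" by (rule AE_completion[OF g(2)])
  have gm: "g \<in> borel_measurable lebesgue" using g(1) by (rule measurable_completion)
  have "integrable lebesgue g"
    using integrable_cong_AE[of "\<lambda>x. indicator S x *\<^sub>R f x" lebesgue g] fS gm AEg by auto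
  then have gi: "integrable lborel g" using integrable_completion[OF g(1)] by simp
  have tr: "integral\<^sup>L (lebesgue_on S) (\<lambda>y. \<psi> y * f y) = integral\<^sup>L lborel (\<lambda>y. \<psi> y * g y)"
    if "\<psi> \<in> borel_measurable borel" for \<psi>
  proof -
    have p: "\<psi> \<in> borel_measurable lborel" using that by simp
    have pc: "\<psi> \<in> borel_measurable lebesgue" using p by (rule measurable_completion)
    have "integral\<^sup>L (lebesgue_on S) (\<lambda>y. \<psi> y * f y) = integral\<^sup>L lebesgue (\<lambda>y. indicator S y *\<^sub>R (\<psi> y * f y))"
      by (rule integral_restrict_space[OF Sm])
    also have "\<dots> = integral\<^sup>L lebesgue (\<lambda>y. \<psi> y * (indicator S y *\<^sub>R f y))"
      by (intro Bochner_Integration.integral_cong) auto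
    also have "\<dots> = integral\<^sup>L lebesgue (\<lambda>y. \<psi> y * g y)"
    proof (rule integral_cong_AE)
      show "(\<lambda>y. \<psi> y * (indicator S y *\<^sub>R f y)) \<in> borel_measurable lebesgue"
        by (intro borel_measurable_times pc borel_measurable_integrable[OF fS])
      show "(\<lambda>y. \<psi> y * g y) \<in> borel_measurable lebesgue" by (intro borel_measurable_times pc gm)
      show "AE y in lebesgue. \<psi> y * (indicator S y *\<^sub>R f y) = \<psi> y * g y"
        using AEg by eventually_elim simp
    qed
    also have "\<dots> = integral\<^sup>L lborel (\<lambda>y. \<psi> y * g y)"
      by (rule integral_completion) (intro borel_measurable_times p g)
    finally show ?thesis .
  qed
  have "AE x in lborel. x \<in> S \<longrightarrow> g x = 0"
  proof (rule AE_zero_of_box_integrals[OF gi S])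
    fix a b assume ab: "cbox a b \<subseteq> S"
    have bm: "box_bump a b n \<in> borel_measurable borel" for n
      using smooth_on_continuous[OF test_function_smooth[OF test_function_box_bump]]
      by (rule borel_measurable_continuous_onI)
    have 0: "integral\<^sup>L lborel (\<lambda>y. box_bump a b n y * g y) = 0" for n
      using zero[OF test_function_subset[OF test_function_box_bump ab]] tr[OF bm] by simp
    have "(\<lambda>n. integral\<^sup>L lborel (\<lambda>y. box_bump a b n y * g y)) \<longlonglongrightarrow> integral\<^sup>L lborel (\<lambda>y. indicator (box a b) y * g y)"
    proof (rule integral_dominated_convergence[where w = "\<lambda>y. \<bar>g y\<bar>"])
      show "AE y in lborel. (\<lambda>n. box_bump a b n y * g y) \<longlonglongrightarrow> indicator (box a b) y * g y"
        by (intro AE_I2 tendsto_mult tendsto_const box_bump_tendsto)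
      show "AE y in lborel. norm (box_bump a b n y * g y) \<le> \<bar>g y\<bar>" for n
        by (intro AE_I2) (auto simp: abs_mult box_bump_bounds intro!: mult_left_le_one_le)
      show "(\<lambda>y. indicator (box a b) y * g y) \<in> borel_measurable lborel"
        "\<And>n. (\<lambda>y. box_bump a b n y * g y) \<in> borel_measurable lborel"
        using bm g(1) by auto
    qed (use gi in auto)
    then have "integral\<^sup>L lborel (\<lambda>y. indicator (box a b) y * g y) = 0"
      unfolding 0 by (simp add: LIMSEQ_const_iff)
    then show "(LINT x:box a b|lborel. g x) = 0" by (simp add: set_lebesgue_integral_def)
  qed
  then have "AE x in lebesgue. x \<in> S \<longrightarrow> g x = 0" by (rule AE_completion)
  with AEg have "AE x in lebesgue. x \<in> S \<longrightarrow> f x = 0" by eventually_elim auto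
  then show ?thesis unfolding AE_restrict_space_iff[OF Sm] .
qed

lemma integrable_lebesgue_on_subset:
  fixes f :: "'a::euclidean_space \<Rightarrow> real"
  assumes f: "integrable (lebesgue_on S) f" and S: "S \<in> sets lebesgue" and T: "T \<in> sets lebesgue" "T \<subseteq> S"
  shows "integrable (lebesgue_on T) f"
proof -
  have "integrable lebesgue (\<lambda>x. indicator S x *\<^sub>R f x)"
    using f S by (subst (asm) integrable_restrict_space) auto
  then have "integrable lebesgue (\<lambda>x. indicator T x *\<^sub>R (indicator S x *\<^sub>R f x))"
    by (rule integrable_mult_indicator[OF T(1)])
  also have "(\<lambda>x. indicator T x *\<^sub>R (indicator S x *\<^sub>R f x)) = (\<lambda>x. indicator T x *\<^sub>R f x)"
    using T(2) by (auto simp: indicator_def fun_eq_iff)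
  finally show ?thesis using T(1) by (subst integrable_restrict_space) auto
qed

text \<open>The set \<open>Z\<close> of points of \<open>S\<close> near which \<open>f\<close>
  vanishes is open and nonempty; \<open>cl\<close> shows that it is relatively closed in
  \<open>S\<close>, and connectedness concludes.\<close>

lemma unique_continuation:
  fixes f :: "'a::euclidean_space \<Rightarrow> real"
  assumes S: "open S" "connected S" and f: "integrable (lebesgue_on S) f" and nu: "\<nu> > 0"
    and helmholtz: "\<And>\<psi>. test_function S \<psi> \<Longrightarrow>
      integral\<^sup>L (lebesgue_on S) (\<lambda>y. (\<Sum>b\<in>Basis. pd b (pd b \<psi>) y) * f y) = - \<nu> * integral\<^sup>L (lebesgue_on S) (\<lambda>y. \<psi> y * f y)"
    and U: "open U" "U \<noteq> {}" "U \<subseteq> S" and zero: "AE x in lebesgue. x \<in> U \<longrightarrow> f x = 0"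
  shows "AE x in lebesgue. x \<in> S \<longrightarrow> f x = 0"
proof -
  have Sm: "S \<in> sets lebesgue" using S(1) by auto
  define Z where "Z = {x. \<exists>r>0. ball x r \<subseteq> S \<and> (AE y in lebesgue. y \<in> ball x r \<longrightarrow> f y = 0)}"
  have ZI: "x \<in> Z" if B: "open B" "x \<in> B" "B \<subseteq> S" "AE y in lebesgue. y \<in> B \<longrightarrow> f y = 0" for x B
  proof -
    obtain r where r: "r > 0" "ball x r \<subseteq> B" using B(1,2) open_contains_ball by blast
    have "AE y in lebesgue. y \<in> ball x r \<longrightarrow> f y = 0" using B(4) by eventually_elim (use r(2) in auto)
    then show ?thesis unfolding Z_def using r B(3) by blast
  qed
  have "open Z"
  proof (rule openI)
    fix x assume "x \<in> Z"
    then obtain r where r: "r > 0" "ball x r \<subseteq> S" "AE y in lebesgue. y \<in> ball x r \<longrightarrow> f y = 0" unfolding Z_def by blast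
    then have "ball x r \<subseteq> Z" using ZI[OF open_ball] by blast
    then show "\<exists>\<epsilon>>0. ball x \<epsilon> \<subseteq> Z" using r(1) by blast
  qed
  have "Z \<noteq> {}" using ZI[OF U(1) _ U(3) zero] U(2) by blast
  have ZS: "Z \<subseteq> S" unfolding Z_def by (auto simp: subset_iff)
  have cl: "p \<in> Z" if p: "p \<in> S" "p \<in> closure Z" for p
  proof -
    define C where "C = grad_const TYPE('a) \<nu>"
    have C: "C \<ge> 1" unfolding C_def by (rule grad_const_ge_1[OF Sm f nu helmholtz])
    obtain R where R: "R > 0" "ball p R \<subseteq> S" using p(1) S(1) open_contains_ball by blast
    define \<rho> where "\<rho> = min 1 (R / 4)"
    have \<rho>: "0 < \<rho>" "\<rho> \<le> 1" "4 * \<rho> \<le> R" using R(1) by (auto simp: \<rho>_def)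
    have "\<rho> / (4 * C) > 0" using \<rho> C by simp
    then obtain z where z: "z \<in> Z" "dist z p < \<rho> / (4 * C)" using p(2) closure_approachable by blast
    have "\<rho> / (4 * C) \<le> \<rho> / 1" using \<rho> C by (intro divide_left_mono) auto
    then have zp: "dist z p < \<rho>" using z(2) by simp
    obtain \<eta> where \<eta>: "\<eta> > 0" "AE y in lebesgue. y \<in> ball z \<eta> \<longrightarrow> f y = 0" using z(1) unfolding Z_def by blast
    \<comment> \<open>Half of \<eta> is spent on the support of \<psi> and half on the shift. The
      bound \<delta> \<le> \<rho> keeps shifted supports in \<open>S\<close>, since \<delta> + 2
      \<rho> + |p - z| < 4 \<rho> \<le> R.\<close>
    define \<delta> where "\<delta> = min \<rho> (\<eta> / 2)"
    have \<delta>: "\<delta> > 0" "\<delta> \<le> \<rho>" "\<delta> \<le> \<eta> / 2" using \<rho> \<eta> by (auto simp: \<delta>_def)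
    have sub: "ball p \<delta> \<subseteq> S" using \<delta> \<rho> R(2) by (auto simp: subset_iff)
    have van: "integral\<^sup>L (lebesgue_on S) (\<lambda>y. \<psi> y * f y) = 0" if \<psi>: "test_function (ball p \<delta>) \<psi>" for \<psi>
    proof -
      \<comment> \<open>The base point is \<open>p - z\<close>: this shift carries the support of
        \<psi> from \<open>p\<close> to \<open>z\<close>, where \<open>f\<close> vanishes. The shift
        0 lies at distance |p - z| from it, within the radius of propagation.\<close>
      have "shift_integral S f \<psi> 0 = 0"
      proof (rule shift_integral_vanishes[OF Sm f nu helmholtz \<psi> \<rho>(1,2)])
        fix y w assume y: "y \<in> ball (p - z) (2 * \<rho>)" and w: "w \<in> ball p \<delta>"
        have "norm y \<le> norm (y - (p - z)) + norm (p - z)"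
          using norm_triangle_ineq[of "y - (p - z)" "p - z"] by simp
        moreover have "norm (p - (w - y)) \<le> norm (p - w) + norm y" using norm_triangle_ineq[of "p - w" y] by (simp add: algebra_simps)
        ultimately have "norm (p - (w - y)) < R"
          using y w zp \<delta> \<rho> by (simp add: dist_norm norm_minus_commute)
        then show "w - y \<in> S" using R(2) by (auto simp: dist_norm)
      next
        show "\<eta> / 2 > 0" using \<eta> by simp
        fix x assume x: "x \<in> ball (p - z) (\<eta> / 2)"
        have "AE y in lebesgue. \<psi> (y + x) * f y = 0"
          using \<eta>(2)
        proof eventually_elim
          fix y assume a: "y \<in> ball z \<eta> \<longrightarrow> f y = 0"
          show "\<psi> (y + x) * f y = 0"
          proof (cases "y + x \<in> ball p \<delta>")
            case False
            then have "\<psi> (y + x) = 0" by (rule test_function_eq_0_outside[OF \<psi>])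
            then show ?thesis by simp
          next
            case True
            have "norm (z - y) \<le> norm (p - (y + x)) + norm (p - z - x)"
              using norm_triangle_ineq4[of "p - (y + x)" "p - z - x"] by (simp add: algebra_simps)
            then have "y \<in> ball z \<eta>" using True x \<delta> by (simp add: dist_norm)
            then show ?thesis using a by simp
          qed
        qed
        then have "AE y in lebesgue_on S. \<psi> (y + x) * f y = 0"
          using Sm by (subst AE_restrict_space_iff) (auto elim: eventually_mono)
        then show "shift_integral S f \<psi> x = 0"
          unfolding shift_integral_def by (rule integral_eq_zero_AE)
      next
        show "dist (p - z) 0 \<le> \<rho> / (4 * grad_const TYPE('a) \<nu>)"
          using z(2) unfolding C_def by (simp add: dist_norm norm_minus_commute)
      qed
      then show ?thesis by (simp add: shift_integral_def)
    qed
    have "integrable (lebesgue_on (ball p \<delta>)) f"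
      by (rule integrable_lebesgue_on_subset[OF f Sm _ sub]) auto
    then have "AE y in lebesgue_on (ball p \<delta>). f y = 0"
    proof (rule fundamental_lemma[OF open_ball])
      fix \<psi> :: "'a \<Rightarrow> real" assume \<psi>: "test_function (ball p \<delta>) \<psi>"
      have "integral\<^sup>L (lebesgue_on (ball p \<delta>)) (\<lambda>y. \<psi> y * f y) = integral\<^sup>L (lebesgue_on S) (\<lambda>y. \<psi> y * f y)"
      proof -
        have "(\<lambda>y. indicator (ball p \<delta>) y *\<^sub>R (\<psi> y * f y)) = (\<lambda>y. indicator S y *\<^sub>R (\<psi> y * f y))"
          using test_function_eq_0_outside[OF \<psi>] sub by (fastforce simp: indicator_def)
        then show ?thesis using Sm by (simp add: integral_restrict_space del: scaleR_conv_of_real)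
      qed
      then show "integral\<^sup>L (lebesgue_on (ball p \<delta>)) (\<lambda>y. \<psi> y * f y) = 0" using van[OF \<psi>] by simp
    qed
    then have "AE y in lebesgue. y \<in> ball p \<delta> \<longrightarrow> f y = 0" by (subst (asm) AE_restrict_space_iff) auto
    then show ?thesis unfolding Z_def using \<delta>(1) sub by blast
  qed
  have "S \<subseteq> Z"
  proof -
    have "Z \<inter> S = {} \<or> - closure Z \<inter> S = {}"
      using connectedD[OF S(2) \<open>open Z\<close>, of "- closure Z"] cl closure_subset[of Z] by blast
    then show ?thesis using ZS \<open>Z \<noteq> {}\<close> cl by blast
  qed
  show ?thesis
  proof (rule AE_local)
    fix x assume "x \<in> S"
    then obtain r where "r > 0" "AE y in lebesgue. y \<in> ball x r \<longrightarrow> f y = 0"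
      using \<open>S \<subseteq> Z\<close> unfolding Z_def by blast
    then show "\<exists>T. open T \<and> x \<in> T \<and> (AE y in lebesgue. y \<in> T \<longrightarrow> f y = 0)"
      by (intro exI[of _ "ball x r"]) auto
  qed
qed

section \<open>Lipschitz primitives\<close>

text \<open>\<open>F\<close> is Lipschitz with almost everywhere derivative \<open>f\<close>,
  expressed through integrals: the second derivative of an eigenfunction is merely a bounded
  measurable function.\<close>

definition primitive_on :: "real \<Rightarrow> real \<Rightarrow> (real \<Rightarrow> real) \<Rightarrow> (real \<Rightarrow> real) \<Rightarrow> bool" where
  "primitive_on l r F f \<longleftrightarrow> (\<exists>K. \<forall>t\<in>{l..r}. \<bar>f t\<bar> \<le> K) \<and> f absolutely_integrable_on {l..r} \<and>
     (\<forall>x y. l \<le> x \<longrightarrow> x \<le> y \<longrightarrow> y \<le> r \<longrightarrow> (f has_integral F y - F x) {x..y})"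

lemma primitive_onD:
  assumes "primitive_on l r F f" "l \<le> x" "x \<le> y" "y \<le> r"
  shows "(f has_integral F y - F x) {x..y}"
  using assms unfolding primitive_on_def by blast

lemma primitive_on_subset:
  assumes "primitive_on l r F f" "l \<le> l'" "r' \<le> r"
  shows "primitive_on l' r' F f"
proof -
  have s: "{l'..r'} \<subseteq> {l..r}" using assms by auto
  have ai: "f absolutely_integrable_on {l'..r'}"
    using assms(1) s set_integrable_subset[of lebesgue "{l..r}" f "{l'..r'}"] unfolding primitive_on_def by auto
  obtain K where "\<forall>t\<in>{l..r}. \<bar>f t\<bar> \<le> K" using assms(1) unfolding primitive_on_def by blast
  then have "\<forall>t\<in>{l'..r'}. \<bar>f t\<bar> \<le> K" using s by blast
  moreover have "(f has_integral F y - F x) {x..y}" if "l' \<le> x" "x \<le> y" "y \<le> r'" for x y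
    using that assms by (intro primitive_onD[OF assms(1)]) auto
  ultimately show ?thesis unfolding primitive_on_def using ai by blast
qed

lemma primitive_on_lipschitz:
  assumes "primitive_on l r F f"
  obtains K where "K \<ge> 0" "\<And>t. t \<in> {l..r} \<Longrightarrow> \<bar>f t\<bar> \<le> K"
    "\<And>x y. x \<in> {l..r} \<Longrightarrow> y \<in> {l..r} \<Longrightarrow> \<bar>F y - F x\<bar> \<le> K * \<bar>y - x\<bar>"
proof -
  obtain K0 where K0: "\<forall>t\<in>{l..r}. \<bar>f t\<bar> \<le> K0" using assms unfolding primitive_on_def by blast
  define K where "K = max K0 0"
  have K: "K \<ge> 0" "\<And>t. t \<in> {l..r} \<Longrightarrow> \<bar>f t\<bar> \<le> K" using K0 by (auto simp: K_def max.coboundedI1)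
  have 1: "\<bar>F y - F x\<bar> \<le> K * (y - x)" if "l \<le> x" "x \<le> y" "y \<le> r" for x y
    using has_integral_bound_real[OF K(1), of "{}" f "F y - F x" x y] primitive_onD[OF assms that] K(2) that
    by auto
  have "\<bar>F y - F x\<bar> \<le> K * \<bar>y - x\<bar>" if "x \<in> {l..r}" "y \<in> {l..r}" for x y
  proof (cases "x \<le> y")
    case True
    then show ?thesis using 1[of x y] that by simp
  next
    case False
    then show ?thesis using 1[of y x] that by (simp add: abs_minus_commute)
  qed
  then show ?thesis using that K by blast
qed

lemma primitive_on_continuous:
  assumes "primitive_on l r F f" shows "continuous_on {l..r} F"
proof -
  obtain K where K: "K \<ge> 0" "\<And>x y. x \<in> {l..r} \<Longrightarrow> y \<in> {l..r} \<Longrightarrow> \<bar>F y - F x\<bar> \<le> K * \<bar>y - x\<bar>"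
    using primitive_on_lipschitz[OF assms] by metis
  have "K-lipschitz_on {l..r} F"
    by (rule lipschitz_onI) (use K in \<open>auto simp: dist_real_def abs_minus_commute\<close>)
  then show ?thesis by (rule lipschitz_on_continuous_on)
qed

lemma primitive_on_C1:
  assumes "\<And>t. t \<in> {l..r} \<Longrightarrow> (F has_real_derivative f t) (at t within {l..r})" "continuous_on {l..r} f"
  shows "primitive_on l r F f"
proof -
  have "bounded (f ` {l..r})" by (intro compact_imp_bounded compact_continuous_image assms) auto
  then obtain K where "\<forall>t\<in>{l..r}. \<bar>f t\<bar> \<le> K" unfolding bounded_iff by auto
  moreover have "f absolutely_integrable_on {l..r}"
    by (rule absolutely_integrable_continuous_real[OF assms(2)])
  moreover have "(f has_integral F y - F x) {x..y}" if "l \<le> x" "x \<le> y" "y \<le> r" for x y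
    using that
    by (intro fundamental_theorem_of_calculus)
       (auto simp: has_real_derivative_iff_has_vector_derivative[symmetric] intro!: DERIV_subset[OF assms(1)])
  ultimately show ?thesis unfolding primitive_on_def by blast
qed

lemma primitive_on_integral:
  assumes "f absolutely_integrable_on {l..r}" "\<And>t. t \<in> {l..r} \<Longrightarrow> \<bar>f t\<bar> \<le> K"
  shows "primitive_on l r (\<lambda>x. integral {l..x} f) f"
proof -
  have "(f has_integral integral {l..y} f - integral {l..x} f) {x..y}" if "l \<le> x" "x \<le> y" "y \<le> r" for x y
  proof -
    have i: "f integrable_on {l..r}" using assms(1) set_lebesgue_integral_eq_integral(1) by blast
    have "f integrable_on {l..y}" "f integrable_on {x..y}"
      by (rule integrable_on_subinterval[OF i], use that in auto)+
    then show ?thesis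
      using Henstock_Kurzweil_Integration.integral_combine[of l x y f] that
      by (metis add_diff_cancel_left' integrable_integral)
  qed
  then show ?thesis unfolding primitive_on_def using assms by blast
qed

lemma primitive_on_add:
  assumes "primitive_on l r F f" "primitive_on l r G g"
  shows "primitive_on l r (\<lambda>x. F x + G x) (\<lambda>x. f x + g x)"
proof -
  obtain K where K: "\<And>t. t \<in> {l..r} \<Longrightarrow> \<bar>f t\<bar> \<le> K" using primitive_on_lipschitz[OF assms(1)] by metis
  obtain K' where K': "\<And>t. t \<in> {l..r} \<Longrightarrow> \<bar>g t\<bar> \<le> K'" using primitive_on_lipschitz[OF assms(2)] by metis
  have b: "\<bar>f t + g t\<bar> \<le> K + K'" if "t \<in> {l..r}" for t
    using K[OF that] K'[OF that] by linarith
  have "((\<lambda>x. f x + g x) has_integral (F y + G y) - (F x + G x)) {x..y}" if "l \<le> x" "x \<le> y" "y \<le> r" for x y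
    using has_integral_add[OF primitive_onD[OF assms(1) that] primitive_onD[OF assms(2) that]]
    by (simp add: algebra_simps)
  moreover have "(\<lambda>x. f x + g x) absolutely_integrable_on {l..r}"
    using assms by (intro set_integral_add) (auto simp: primitive_on_def)
  ultimately show ?thesis unfolding primitive_on_def using b by blast
qed

text \<open>All difference quotients tend to 0. In the product rule below this takes the place of
  differentiation almost everywhere.\<close>

lemma constant_if_quadratic_increments:
  fixes f :: "real \<Rightarrow> real"
  assumes "\<And>x y. l \<le> x \<Longrightarrow> x \<le> y \<Longrightarrow> y \<le> r \<Longrightarrow> \<bar>f y - f x\<bar> \<le> C * (y - x)\<^sup>2" "x \<in> {l..r}"
  shows "f x = f l"
proof -
  have b: "\<bar>f y - f x\<bar> \<le> C * \<bar>y - x\<bar>\<^sup>2" if "x \<in> {l..r}" "y \<in> {l..r}" for x y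
    using assms(1)[of x y] assms(1)[of y x] that
    by (cases "x \<le> y") (auto simp: abs_minus_commute power2_commute)
  have "(f has_real_derivative 0) (at x within {l..r})" if x: "x \<in> {l..r}" for x
  proof -
    have "((\<lambda>y. (f y - f x) / (y - x)) \<longlongrightarrow> 0) (at x within {l..r})"
    proof (rule Lim_null_comparison)
      have "norm ((f y - f x) / (y - x)) \<le> C * \<bar>y - x\<bar>" if "y \<in> {l..r}" "y \<noteq> x" for y
        using b[OF x that(1)] that(2) by (simp add: divide_le_eq power2_eq_square mult.assoc)
      then show "\<forall>\<^sub>F y in at x within {l..r}. norm ((f y - f x) / (y - x)) \<le> C * \<bar>y - x\<bar>"
        by (auto simp: eventually_at_filter)
      show "((\<lambda>y. C * \<bar>y - x\<bar>) \<longlongrightarrow> 0) (at x within {l..r})"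
        by (auto intro!: tendsto_eq_intros)
    qed
    then show ?thesis by (simp add: has_field_derivative_iff)
  qed
  then obtain c where "\<forall>x\<in>{l..r}. f x = c"
    using has_field_derivative_zero_constant[of "{l..r}" f] by auto
  then show ?thesis using assms(2) by auto
qed

text \<open>The difference of both sides has increments of quadratic order, hence it is constant.\<close>

lemma primitive_on_mult:
  assumes F: "primitive_on l r F f" and G: "primitive_on l r G g"
  shows "primitive_on l r (\<lambda>x. F x * G x) (\<lambda>x. f x * G x + F x * g x)"
proof -
  obtain K1 where K1: "K1 \<ge> 0" "\<And>t. t \<in> {l..r} \<Longrightarrow> \<bar>f t\<bar> \<le> K1" 
    "\<And>x y. x \<in> {l..r} \<Longrightarrow> y \<in> {l..r} \<Longrightarrow> \<bar>F y - F x\<bar> \<le> K1 * \<bar>y - x\<bar>" using primitive_on_lipschitz[OF F] by metis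
  obtain K2 where K2: "K2 \<ge> 0" "\<And>t. t \<in> {l..r} \<Longrightarrow> \<bar>g t\<bar> \<le> K2" 
    "\<And>x y. x \<in> {l..r} \<Longrightarrow> y \<in> {l..r} \<Longrightarrow> \<bar>G y - G x\<bar> \<le> K2 * \<bar>y - x\<bar>" using primitive_on_lipschitz[OF G] by metis
  note cF = primitive_on_continuous[OF F] and cG = primitive_on_continuous[OF G]
  have bF: "bounded (F ` {l..r})" and bG: "bounded (G ` {l..r})"
    by (intro compact_imp_bounded compact_continuous_image cF cG compact_Icc)+
  then obtain M1 M2 where M1: "\<And>t. t \<in> {l..r} \<Longrightarrow> \<bar>F t\<bar> \<le> M1" and M2: "\<And>t. t \<in> {l..r} \<Longrightarrow> \<bar>G t\<bar> \<le> M2"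
    unfolding bounded_iff by (metis imageI real_norm_def)
  define k where "k = (\<lambda>x. f x * G x + F x * g x)"
  have mF: "F \<in> borel_measurable (lebesgue_on {l..r})" and mG: "G \<in> borel_measurable (lebesgue_on {l..r})"
    by (intro continuous_imp_measurable_on_sets_lebesgue cF cG lmeasurable_interval fmeasurableD)+
  have "(\<lambda>x. G x * f x) absolutely_integrable_on {l..r}" "(\<lambda>x. F x * g x) absolutely_integrable_on {l..r}"
    using F G unfolding primitive_on_def
    by (auto intro!: absolutely_integrable_bounded_measurable_product_real mF mG bF bG)
  then have ai: "k absolutely_integrable_on {l..r}"
    unfolding k_def by (intro set_integral_add) (auto simp: mult.commute)
  have kb: "\<bar>k t\<bar> \<le> K1 * M2 + M1 * K2" if "t \<in> {l..r}" for t
  proof -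
    have "\<bar>f t * G t\<bar> \<le> K1 * M2" "\<bar>F t * g t\<bar> \<le> M1 * K2"
      unfolding abs_mult using K1(1) K2(2)[OF that] K1(2)[OF that] M1[OF that] M2[OF that]
      by (intro mult_mono; linarith)+
    then show ?thesis unfolding k_def by linarith
  qed
  have prim: "primitive_on l r (\<lambda>x. integral {l..x} k) k" by (rule primitive_on_integral[OF ai kb])
  define D where "D x = F x * G x - integral {l..x} k" for x
  have "\<bar>D y - D x\<bar> \<le> (3 * K1 * K2) * (y - x)\<^sup>2" if xy: "l \<le> x" "x \<le> y" "y \<le> r" for x y
  proof -
    have 1: "(k has_integral integral {l..y} k - integral {l..x} k) {x..y}" by (rule primitive_onD[OF prim xy])
    \<comment> \<open>Both factors are frozen at \<open>x\<close>. The freezing error and the term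
      \<open>(F y - F x) * (G y - G x)\<close> are quadratic in \<open>y - x\<close>, with constants
      \<open>2 * K1 * K2\<close> and \<open>K1 * K2\<close>.\<close>
    have 2: "((\<lambda>t. f t * G x + F x * g t) has_integral (F y - F x) * G x + F x * (G y - G x)) {x..y}"
      using primitive_onD[OF F xy] primitive_onD[OF G xy]
      by (intro has_integral_add has_integral_mult_left has_integral_mult_right)
    have 3: "((\<lambda>t. k t - (f t * G x + F x * g t)) has_integral
        (integral {l..y} k - integral {l..x} k) - ((F y - F x) * G x + F x * (G y - G x))) {x..y}"
      by (rule has_integral_diff[OF 1 2])
    have b: "\<bar>k t - (f t * G x + F x * g t)\<bar> \<le> 2 * K1 * K2 * (y - x)" if t: "t \<in> {x..y}" for t
    proof -
      have tt: "t \<in> {l..r}" "x \<in> {l..r}" using t xy by auto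
      have "\<bar>f t * (G t - G x)\<bar> \<le> K1 * (K2 * (y - x))"
        unfolding abs_mult using K1(1) K1(2)[OF tt(1)] K2(3)[OF tt(2,1)] K2(1) t
        by (intro mult_mono order_trans[OF K2(3)[OF tt(2,1)]] mult_left_mono) auto
      moreover have "\<bar>(F t - F x) * g t\<bar> \<le> (K1 * (y - x)) * K2"
        unfolding abs_mult using K2(1) K2(2)[OF tt(1)] K1(3)[OF tt(2,1)] K1(1) t
        by (intro mult_mono order_trans[OF K1(3)[OF tt(2,1)]] mult_left_mono) auto
      moreover have "k t - (f t * G x + F x * g t) = f t * (G t - G x) + (F t - F x) * g t"
        by (simp add: k_def algebra_simps)
      ultimately show ?thesis by (simp add: algebra_simps)
    qed
    have K0: "0 \<le> 2 * K1 * K2 * (y - x)" using K1(1) K2(1) xy by auto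
    have "norm ((integral {l..y} k - integral {l..x} k) - ((F y - F x) * G x + F x * (G y - G x)))
        \<le> 2 * K1 * K2 * (y - x) * measure lborel {x..y}"
      by (rule has_integral_bound_real[OF K0 finite.emptyI 3]) (use b in auto)
    then have 4: "\<bar>(integral {l..y} k - integral {l..x} k) - ((F y - F x) * G x + F x * (G y - G x))\<bar>
       \<le> 2 * K1 * K2 * (y - x) * (y - x)" using xy by auto
    have "\<bar>(F y - F x) * (G y - G x)\<bar> \<le> (K1 * (y - x)) * (K2 * (y - x))"
      unfolding abs_mult using K1(3)[of x y] K2(3)[of x y] K1(1) xy by (intro mult_mono) auto
    moreover have "D y - D x = (F y - F x) * (G y - G x) -
      ((integral {l..y} k - integral {l..x} k) - ((F y - F x) * G x + F x * (G y - G x)))"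
      by (simp add: D_def algebra_simps)
    ultimately have "\<bar>D y - D x\<bar> \<le> (K1 * (y - x)) * (K2 * (y - x)) + 2 * K1 * K2 * (y - x) * (y - x)"
      using 4 by linarith
    then show ?thesis by (simp add: power2_eq_square algebra_simps)
  qed
  then have Dc: "D x = D l" if "x \<in> {l..r}" for x
    using constant_if_quadratic_increments[OF _ that] by blast
  have "(k has_integral F y * G y - F x * G x) {x..y}" if xy: "l \<le> x" "x \<le> y" "y \<le> r" for x y
  proof -
    have "F y * G y - F x * G x = integral {l..y} k - integral {l..x} k"
      using Dc[of x] Dc[of y] xy unfolding D_def by auto
    then show ?thesis using primitive_onD[OF prim xy] by simp
  qed
  then show ?thesis unfolding primitive_on_def k_def[symmetric] using ai kb by blast
qed

text \<open>The product of \<open>F\<close> with exp(-K t) is nonincreasing and that with exp(K t)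
  nondecreasing; the two-sided bound on \<open>f\<close> thus propagates estimates in both
  directions.\<close>

lemma primitive_on_gronwall:
  assumes F: "primitive_on l r F f" and b: "\<And>t. t \<in> {l..r} \<Longrightarrow> \<bar>f t\<bar> \<le> K * F t"
    and "l \<le> r"
  shows "F r \<le> F l * exp (K * (r - l))" "F l \<le> F r * exp (K * (r - l))"
proof -
  have e: "primitive_on l r (\<lambda>t. exp (k * t)) (\<lambda>t. k * exp (k * t))" for k
    by (rule primitive_on_C1) (auto intro!: derivative_eq_intros continuous_intros)
  have 1: "((\<lambda>t. f t * exp (k * t) + F t * (k * exp (k * t))) has_integral F r * exp (k * r) - F l * exp (k * l)) {l..r}" for k
    by (rule primitive_onD[OF primitive_on_mult[OF F e]]) (use assms in auto)
  have "F r * exp (- K * r) - F l * exp (- K * l) \<le> 0"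
  proof (rule has_integral_le[OF 1 has_integral_0])
    fix t assume "t \<in> {l..r}"
    from b[OF this] have "(f t - K * F t) * exp (- K * t) \<le> 0"
      by (intro mult_nonpos_nonneg) auto
    then show "f t * exp (- K * t) + F t * (- K * exp (- K * t)) \<le> 0" by (simp add: algebra_simps)
  qed
  then have "F r * exp (- K * r) * exp (K * r) \<le> F l * exp (- K * l) * exp (K * r)"
    by (intro mult_right_mono) auto
  then show "F r \<le> F l * exp (K * (r - l))"
    by (simp add: mult.assoc exp_add[symmetric] algebra_simps)
  have "F r * exp (K * r) - F l * exp (K * l) \<ge> 0"
  proof (rule has_integral_nonneg[OF 1])
    fix t assume "t \<in> {l..r}"
    from b[OF this] have "(f t + K * F t) * exp (K * t) \<ge> 0"
      by (intro mult_nonneg_nonneg) auto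
    then show "f t * exp (K * t) + F t * (K * exp (K * t)) \<ge> 0" by (simp add: algebra_simps)
  qed
  then have "F l * exp (K * l) * exp (- K * l) \<le> F r * exp (K * r) * exp (- K * l)"
    by (intro mult_right_mono) auto
  then show "F l \<le> F r * exp (K * (r - l))"
    by (simp add: mult.assoc exp_add[symmetric] algebra_simps)
qed

section \<open>Energy of solutions\<close>

text \<open>Gronwall's inequality for the energy \<open>F\<close> with \<open>Q\<close> frozen at
  \<open>x\<close> gives the factor exp \<nu> over a step of length at most
  \<open>sqrt (q0 / lam)\<close>; replacing \<open>Q x\<close> by \<open>Q y\<close> at the right
  end costs a further exp (\<nu> / q0).\<close>

lemma energy_step:
  fixes u p Q :: "real \<Rightarrow> real"
  assumes u: "primitive_on x y u p" and p: "primitive_on x y p (\<lambda>t. - lam * Q t * u t)"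
    and xy: "x \<le> y" and lam: "lam > 0" and q0: "q0 > 0"
    and Q: "\<And>t. t \<in> {x..y} \<Longrightarrow> q0 \<le> Q t" and osc: "\<And>t. t \<in> {x..y} \<Longrightarrow> \<bar>Q t - Q x\<bar> \<le> \<nu>"
    and small: "(y - x) * sqrt (lam / q0) \<le> 1"
  shows "(p y)\<^sup>2 + lam * Q y * (u y)\<^sup>2 \<le> ((p x)\<^sup>2 + lam * Q x * (u x)\<^sup>2) * exp ((1 + 1 / q0) * \<nu>)"
    and "(p x)\<^sup>2 + lam * Q x * (u x)\<^sup>2 \<le> ((p y)\<^sup>2 + lam * Q y * (u y)\<^sup>2) * exp ((1 + 1 / q0) * \<nu>)"
proof -
  define S where "S = sqrt (lam / q0)"
  have S: "S > 0" "lam = S * S * q0" using lam q0 by (auto simp: S_def)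
  have \<nu>: "\<nu> \<ge> 0" using osc[of x] xy by auto
  define F where "F t = p t * p t + lam * Q x * (u t * u t)" for t
  define f where "f t = - lam * Q t * u t * p t + p t * (- lam * Q t * u t)
      + (0 * (u t * u t) + lam * Q x * (p t * u t + u t * p t))" for t
  have "primitive_on x y (\<lambda>_. lam * Q x) (\<lambda>_. 0)" by (rule primitive_on_C1) auto
  then have F: "primitive_on x y F f"
    unfolding F_def f_def by (intro primitive_on_add primitive_on_mult u p)
  have Fge: "p t * p t + lam * q0 * (u t * u t) \<le> F t" if "t \<in> {x..y}" for t
    unfolding F_def using Q[of x] xy lam
    by (intro add_left_mono mult_right_mono mult_left_mono) auto
  have fb: "\<bar>f t\<bar> \<le> S * \<nu> * F t" if t: "t \<in> {x..y}" for t
  proof -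
    have "f t = 2 * lam * ((Q x - Q t) * (u t * p t))" unfolding f_def by (simp add: algebra_simps)
    then have "\<bar>f t\<bar> = 2 * lam * (\<bar>Q t - Q x\<bar> * \<bar>u t * p t\<bar>)"
      using lam by (simp add: abs_mult abs_minus_commute)
    also have "\<dots> \<le> 2 * lam * (\<nu> * \<bar>u t * p t\<bar>)"
      using lam osc[OF t] by (intro mult_left_mono mult_right_mono) auto
    \<comment> \<open>Writing \<open>lam\<close> as \<open>S * S * q0\<close> leaves
      \<open>S * q0 * |u|\<close> next to \<open>|p|\<close>; the squares of these two add up to
      \<open>lam * q0 * u\<^sup>2 + p\<^sup>2\<close>, which is at most \<open>F\<close>.\<close>
    also have "\<dots> = S * \<nu> * (2 * (S * q0 * \<bar>u t\<bar>) * \<bar>p t\<bar>)"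
      unfolding S(2) by (simp add: abs_mult)
    also have "\<dots> \<le> S * \<nu> * F t"
    proof -
      have "0 \<le> (\<bar>p t\<bar> - S * q0 * \<bar>u t\<bar>)\<^sup>2" by simp
      then have "2 * (S * q0 * \<bar>u t\<bar>) * \<bar>p t\<bar> \<le> p t * p t + S * S * q0 * q0 * (u t * u t)"
        by (simp add: power2_diff power_mult_distrib power2_eq_square algebra_simps)
      also have "\<dots> \<le> F t" using Fge[OF t] S(2) by (simp add: mult.assoc)
      finally show ?thesis using S(1) \<nu> by (intro mult_left_mono) auto
    qed
    finally show ?thesis .
  qed
  have ex: "exp (S * \<nu> * (y - x)) \<le> exp \<nu>"
    using mult_left_mono[OF small \<nu>] by (simp add: S_def mult_ac)
  have Fpos: "F t \<ge> 0" if "t \<in> {x..y}" for t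
    using Fge[OF that] lam q0 by (smt (verit) mult_nonneg_nonneg zero_le_square)
  have xx: "x \<in> {x..y}" "y \<in> {x..y}" using xy by auto
  define G where "G t = (p t)\<^sup>2 + lam * Q t * (u t)\<^sup>2" for t
  have jmp: "\<nu> * (lam * (u y * u y)) \<le> \<nu> / q0 * F y"
  proof -
    have "q0 * (lam * (u y * u y)) \<le> F y" using Fge[OF xx(2)] by (smt (verit) mult.assoc mult.commute zero_le_square)
    then have "\<nu> * (lam * (u y * u y)) * q0 \<le> \<nu> * F y" using \<nu> by (simp add: mult_ac mult_left_mono)
    then show ?thesis using q0 by (simp add: pos_le_divide_eq)
  qed
  have GF: "G y - F y = (Q y - Q x) * (lam * (u y * u y))"
    by (simp add: G_def F_def power2_eq_square algebra_simps)
  have "\<bar>G y - F y\<bar> \<le> \<nu> * (lam * (u y * u y))"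
    unfolding GF abs_mult[of "Q y - Q x"] using osc[OF xx(2)] lam \<nu> by (intro mult_mono) simp_all
  then have dif: "\<bar>G y - F y\<bar> \<le> \<nu> / q0 * F y" using jmp by linarith
  have e1: "1 + \<nu> / q0 \<le> exp (\<nu> / q0)" by simp
  have "G y \<le> (1 + \<nu> / q0) * F y" using dif by (simp add: algebra_simps)
  also have "\<dots> \<le> exp (\<nu> / q0) * F y" using Fpos[OF xx(2)] by (intro mult_right_mono e1)
  also have "\<dots> \<le> exp (\<nu> / q0) * (F x * exp \<nu>)"
    using primitive_on_gronwall(1)[OF F fb xy] ex Fpos[OF xx(1)]
    by (intro mult_left_mono order_trans[OF primitive_on_gronwall(1)[OF F fb xy]]) auto
  also have "\<dots> = G x * exp ((1 + 1 / q0) * \<nu>)"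
    by (simp add: F_def G_def power2_eq_square exp_add algebra_simps)
  finally show "(p y)\<^sup>2 + lam * Q y * (u y)\<^sup>2 \<le> ((p x)\<^sup>2 + lam * Q x * (u x)\<^sup>2) * exp ((1 + 1 / q0) * \<nu>)"
    unfolding G_def .
  have Gy: "F y \<le> exp (\<nu> / q0) * G y"
  proof -
    have "F y - G y = (Q x - Q y) * (lam * (u y * u y))"
      by (simp add: G_def F_def power2_eq_square algebra_simps)
    also have "\<dots> \<le> \<nu> * (lam * (u y * u y))"
      using osc[OF xx(2)] lam by (intro mult_right_mono) auto
    also have "\<dots> \<le> \<nu> / q0 * G y"
    proof -
      have "q0 * (lam * (u y * u y)) \<le> Q y * (lam * (u y * u y))" using Q[OF xx(2)] lam by (intro mult_right_mono) auto
      also have "\<dots> \<le> G y" by (simp add: G_def power2_eq_square)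
      finally have "\<nu> * (lam * (u y * u y)) * q0 \<le> \<nu> * G y" using \<nu> by (simp add: mult_ac mult_left_mono)
      then show ?thesis using q0 by (simp add: pos_le_divide_eq)
    qed
    finally have "F y \<le> (1 + \<nu> / q0) * G y" by (simp add: algebra_simps)
    also have "\<dots> \<le> exp (\<nu> / q0) * G y"
      using Q[OF xx(2)] lam q0 by (intro mult_right_mono e1) (auto simp: G_def)
    finally show ?thesis .
  qed
  have "G x = F x" by (simp add: F_def G_def power2_eq_square)
  also have "\<dots> \<le> F y * exp \<nu>"
    using ex Fpos[OF xx(2)]
    by (intro order_trans[OF primitive_on_gronwall(2)[OF F fb xy]] mult_left_mono) auto
  also have "\<dots> \<le> (exp (\<nu> / q0) * G y) * exp \<nu>" using Gy by (intro mult_right_mono) auto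
  also have "\<dots> = G y * exp ((1 + 1 / q0) * \<nu>)" by (simp add: exp_add algebra_simps)
  finally show "(p x)\<^sup>2 + lam * Q x * (u x)\<^sup>2 \<le> ((p y)\<^sup>2 + lam * Q y * (u y)\<^sup>2) * exp ((1 + 1 / q0) * \<nu>)"
    unfolding G_def .
qed

section \<open>Comparison of the energy across the whole interval\<close>

context
  fixes u p Q N :: "real \<Rightarrow> real" and h lam q0 W :: real
  assumes u: "primitive_on 0 h u p" and p: "primitive_on 0 h p (\<lambda>t. - lam * Q t * u t)"
    and lam: "lam > 0" and q0: "q0 > 0"
    and Q: "\<And>t. t \<in> {0<..<h} \<Longrightarrow> q0 \<le> Q t"
    and N: "\<And>s t. 0 < s \<Longrightarrow> s \<le> t \<Longrightarrow> t < h \<Longrightarrow> \<bar>Q t - Q s\<bar> \<le> N t - N s"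
    and W: "\<And>s t. 0 < s \<Longrightarrow> s \<le> t \<Longrightarrow> t < h \<Longrightarrow> N t - N s \<le> W"
begin

text \<open>Steps of length at most 1 / S are chained. The exponents telescope along
  \<open>N\<close>, so the factor depends neither on the number of steps nor on
  \<open>lam\<close>.\<close>

lemma energy_chain:
  assumes "0 < x" "x \<le> y" "y < h"
  shows "(p y)\<^sup>2 + lam * Q y * (u y)\<^sup>2 \<le> ((p x)\<^sup>2 + lam * Q x * (u x)\<^sup>2) * exp ((1 + 1 / q0) * (N y - N x))"
    and "(p x)\<^sup>2 + lam * Q x * (u x)\<^sup>2 \<le> ((p y)\<^sup>2 + lam * Q y * (u y)\<^sup>2) * exp ((1 + 1 / q0) * (N y - N x))"
proof -
  define S where "S = sqrt (lam / q0)"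
  have S: "S > 0" using lam q0 by (simp add: S_def)
  define G where "G t = (p t)\<^sup>2 + lam * Q t * (u t)\<^sup>2" for t
  define L where "L = 1 + 1 / q0"
  have step: "G y \<le> G x * exp (L * (N y - N x)) \<and> G x \<le> G y * exp (L * (N y - N x))"
    if xy: "0 < x" "x \<le> y" "y < h" "(y - x) * S \<le> 1" for x y
  proof -
    have osc: "\<bar>Q t - Q x\<bar> \<le> N y - N x" if "t \<in> {x..y}" for t
      using N[of x t] N[of t y] xy that by auto
    have Q': "q0 \<le> Q t" if "t \<in> {x..y}" for t using Q[of t] xy that by auto
    have u': "primitive_on x y u p" and p': "primitive_on x y p (\<lambda>t. - lam * Q t * u t)"
      by (rule primitive_on_subset[OF u] primitive_on_subset[OF p]; use xy in auto)+
    show ?thesis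
      unfolding G_def L_def
      using energy_step[OF u' p' xy(2) lam q0 Q' osc] xy(4) unfolding S_def by blast
  qed
  have "G y \<le> G x * exp (L * (N y - N x)) \<and> G x \<le> G y * exp (L * (N y - N x))"
    if "0 < x" "x \<le> y" "y < h" "(y - x) * S \<le> real n" for n x y
    using that
  proof (induction n arbitrary: y)
    case 0
    then have "y = x" using S by (smt (verit) mult_pos_pos of_nat_0)
    then show ?case by simp
  next
    case (Suc n)
    \<comment> \<open>The last of \<open>n + 1\<close> equal pieces of the interval is split off: it
      is short enough for \<open>step\<close>, and the other \<open>n\<close> pieces satisfy the
      induction hypothesis.\<close>
    define z where "z = x + (y - x) * (n / (n + 1))"
    have zx: "z - x = (y - x) * (n / (n + 1))" by (simp add: z_def)
    have yz: "y - z = (y - x) * (1 / (n + 1))" by (simp add: z_def field_simps)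
    have z: "x \<le> z" "z \<le> y"
    proof -
      have "0 \<le> z - x" "0 \<le> y - z" unfolding zx yz using Suc.prems by auto
      then show "x \<le> z" "z \<le> y" by auto
    qed
    have ys: "(y - x) * S / (n + 1) \<le> 1" using Suc.prems(4) by (simp add: divide_le_eq)
    have zxS: "(z - x) * S = n * ((y - x) * S / (n + 1))" unfolding zx by simp
    have "(z - x) * S \<le> n" unfolding zxS using mult_left_mono[OF ys, of "real n"] by simp
    then have 1: "G z \<le> G x * exp (L * (N z - N x))" "G x \<le> G z * exp (L * (N z - N x))"
      using Suc.IH[of z] z Suc.prems by auto
    have "(y - z) * S \<le> 1" unfolding yz using ys by simp
    then have 2: "G y \<le> G z * exp (L * (N y - N z))" "G z \<le> G y * exp (L * (N y - N z))"
      using step[of z y] z Suc.prems by auto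
    have e: "exp (L * (N z - N x)) * exp (L * (N y - N z)) = exp (L * (N y - N x))"
      by (simp add: exp_add[symmetric] algebra_simps)
    have "G y \<le> (G x * exp (L * (N z - N x))) * exp (L * (N y - N z))"
      using 2(1) 1(1) by (meson exp_ge_zero mult_right_mono order_trans)
    moreover have "G x \<le> (G y * exp (L * (N y - N z))) * exp (L * (N z - N x))"
      using 2(2) 1(2) by (meson exp_ge_zero mult_right_mono order_trans)
    ultimately show ?case using e by (simp add: mult_ac)
  qed
  moreover obtain n where "(y - x) * S \<le> real n" using real_arch_simple by blast
  ultimately have "G y \<le> G x * exp (L * (N y - N x)) \<and> G x \<le> G y * exp (L * (N y - N x))"
    using assms by blast
  then show "(p y)\<^sup>2 + lam * Q y * (u y)\<^sup>2 \<le> ((p x)\<^sup>2 + lam * Q x * (u x)\<^sup>2) * exp ((1 + 1 / q0) * (N y - N x))"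
    and "(p x)\<^sup>2 + lam * Q x * (u x)\<^sup>2 \<le> ((p y)\<^sup>2 + lam * Q y * (u y)\<^sup>2) * exp ((1 + 1 / q0) * (N y - N x))"
    unfolding G_def L_def by auto
qed

lemma energy_comparable:
  assumes "x \<in> {0<..<h}" "y \<in> {0<..<h}"
  shows "(p y)\<^sup>2 + lam * Q y * (u y)\<^sup>2 \<le> ((p x)\<^sup>2 + lam * Q x * (u x)\<^sup>2) * exp ((1 + 1 / q0) * W)"
proof -
  have pos: "0 \<le> (p t)\<^sup>2 + lam * Q t * (u t)\<^sup>2" if "t \<in> {0<..<h}" for t
    using Q[OF that] lam q0 by simp
  have ex: "exp ((1 + 1 / q0) * (N t - N s)) \<le> exp ((1 + 1 / q0) * W)" if "0 < s" "s \<le> t" "t < h" for s t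
    using W[OF that] q0 by (simp add: mult_left_mono)
  show ?thesis
  proof (cases "x \<le> y")
    case True
    then show ?thesis 
      using order_trans[OF energy_chain(1)[of x y] mult_left_mono[OF ex[of x y] pos[of x]]] assms by auto
  next
    case False
    then show ?thesis
      using order_trans[OF energy_chain(2)[of y x] mult_left_mono[OF ex[of y x] pos[of x]]] assms by auto
  qed
qed

text \<open>\<open>H\<close> encodes the normalization: no uniform bound for
  \<open>u\<^sup>2\<close> lies below \<kappa>0. Comparability of the energies turns the energy at
  \<open>y\<close> into such a bound.\<close>

lemma energy_lower_bound:
  assumes H: "\<And>\<kappa>. (\<And>t. t \<in> {0<..<h} \<Longrightarrow> (u t)\<^sup>2 \<le> \<kappa>) \<Longrightarrow> \<kappa>0 \<le> \<kappa>" and y: "y \<in> {0<..<h}"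
  shows "lam * (q0 * \<kappa>0 * exp (- ((1 + 1 / q0) * W))) \<le> (p y)\<^sup>2 + lam * Q y * (u y)\<^sup>2"
proof -
  define e where "e = exp ((1 + 1 / q0) * W)"
  define G where "G = (p y)\<^sup>2 + lam * Q y * (u y)\<^sup>2"
  have "\<kappa>0 \<le> G * e / (lam * q0)"
  proof (rule H)
    fix t assume t: "t \<in> {0<..<h}"
    have "lam * q0 * (u t)\<^sup>2 \<le> lam * Q t * (u t)\<^sup>2"
      using Q[OF t] lam by (intro mult_right_mono mult_left_mono) auto
    also have "\<dots> \<le> (p t)\<^sup>2 + lam * Q t * (u t)\<^sup>2" by simp
    also have "\<dots> \<le> G * e" unfolding G_def e_def by (rule energy_comparable[OF y t])
    finally show "(u t)\<^sup>2 \<le> G * e / (lam * q0)" using lam q0 by (simp add: pos_le_divide_eq mult.commute)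
  qed
  then have "lam * (q0 * \<kappa>0) \<le> G * e" using lam q0 by (simp add: pos_le_divide_eq mult_ac)
  then have "lam * (q0 * \<kappa>0) / e \<le> G" by (simp add: e_def pos_divide_le_eq)
  then show ?thesis unfolding G_def[symmetric] exp_minus e_def[symmetric] by (simp add: field_simps)
qed

end

text \<open>Test the equation with \<open>((t - a) (b - t))\<^sup>2 u\<close>.\<close>

lemma interval_mass_lower_bound:
  fixes u p Q :: "real \<Rightarrow> real"
  assumes u: "primitive_on a b u p" and p: "primitive_on a b p (\<lambda>t. - lam * Q t * u t)"
    and ab: "a < b" and lam: "lam > 0"
    and Q: "\<And>t. t \<in> {a<..<b} \<Longrightarrow> 0 \<le> Q t" "\<And>t. t \<in> {a<..<b} \<Longrightarrow> Q t \<le> q1"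
    and G: "\<And>t. t \<in> {a<..<b} \<Longrightarrow> lam * c0 \<le> (p t)\<^sup>2 + lam * Q t * (u t)\<^sup>2"
  shows "lam * c0 * ((b - a) ^ 5 / 30) \<le> (4 * (b - a)\<^sup>2 + 3 * (b - a) ^ 4 * (lam * q1)) * integral {a..b} (\<lambda>t. (u t)\<^sup>2)"
proof -
  \<comment> \<open>The cut-off vanishes at both ends, so the boundary terms disappear and
    \<open>D\<close> has integral 0.\<close>
  define m where "m t = (t - a) * (b - t)" for t
  define m' where "m' t = a + b - 2 * t" for t
  define C where "C = 4 * (b - a)\<^sup>2 + 3 * (b - a) ^ 4 * (lam * q1)"
  have m: "primitive_on a b (\<lambda>t. (m t)\<^sup>2) (\<lambda>t. 2 * m t * m' t)"
    unfolding m_def m'_def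
    by (rule primitive_on_C1) (auto intro!: derivative_eq_intros continuous_intros simp: algebra_simps)
  define D where "D t = 2 * m t * m' t * (u t * p t) + (m t)\<^sup>2 * (p t * p t + u t * (- lam * Q t * u t))" for t
  have "(D has_integral (m b)\<^sup>2 * (u b * p b) - (m a)\<^sup>2 * (u a * p a)) {a..b}"
    unfolding D_def
    by (rule primitive_onD[OF primitive_on_mult[OF m primitive_on_mult[OF u p]]]) (use ab in auto)
  then have D: "(D has_integral 0) {a..b}" by (simp add: m_def)
  have "(\<lambda>t. (u t)\<^sup>2) integrable_on {a..b}"
    by (intro integrable_continuous_interval continuous_intros primitive_on_continuous[OF u])
  then have U: "((\<lambda>t. (u t)\<^sup>2) has_integral integral {a..b} (\<lambda>t. (u t)\<^sup>2)) {a..b}" by blast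
  have R: "((\<lambda>t. 2 * D t + C * (u t)\<^sup>2) has_integral 2 * 0 + C * integral {a..b} (\<lambda>t. (u t)\<^sup>2)) {a..b}"
    by (intro has_integral_add has_integral_mult_right D U)
  \<comment> \<open>A primitive of the squared cut-off; its increment is the Beta integral (b - a)^5
    / 30.\<close>
  define P where "P t = (b - a)\<^sup>2 * (t - a) ^ 3 / 3 - (b - a) * (t - a) ^ 4 / 2 + (t - a) ^ 5 / 5" for t
  have "((\<lambda>t. (m t)\<^sup>2) has_integral P b - P a) {a..b}"
  proof (rule fundamental_theorem_of_calculus)
    fix t
    have "(P has_real_derivative (m t)\<^sup>2) (at t within {a..b})"
      unfolding P_def m_def
      by (auto intro!: derivative_eq_intros) (simp add: power2_eq_square power3_eq_cube power4_eq_xxxx algebra_simps)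
    then show "(P has_vector_derivative (m t)\<^sup>2) (at t within {a..b})"
      by (simp add: has_real_derivative_iff_has_vector_derivative)
  qed (use ab in auto)
  moreover have "P b - P a = (b - a) ^ 5 / 30"
    by (simp add: P_def power2_eq_square power3_eq_cube power4_eq_xxxx power_numeral_reduce)
  ultimately have "((\<lambda>t. lam * c0 * (m t)\<^sup>2) has_integral lam * c0 * ((b - a) ^ 5 / 30)) {a..b}"
    by (metis has_integral_mult_right)
  then have "lam * c0 * ((b - a) ^ 5 / 30) \<le> 2 * 0 + C * integral {a..b} (\<lambda>t. (u t)\<^sup>2)"
  proof (rule has_integral_le[OF _ R])
    fix t assume t: "t \<in> {a..b}"
    have q1: "q1 \<ge> 0" using Q(1)[of "(a+b)/2"] Q(2)[of "(a+b)/2"] ab by auto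
    then have Cpos: "C \<ge> 0" using lam ab by (simp add: C_def)
    show "lam * c0 * (m t)\<^sup>2 \<le> 2 * D t + C * (u t)\<^sup>2"
    proof (cases "t \<in> {a<..<b}")
      case False
      then have "m t = 0" using t by (auto simp: m_def)
      then show ?thesis using Cpos by (simp add: D_def)
    next
      case True
      have "lam * c0 * (m t)\<^sup>2 \<le> ((p t)\<^sup>2 + lam * Q t * (u t)\<^sup>2) * (m t)\<^sup>2"
        using G[OF True] by (intro mult_right_mono) auto
      \<comment> \<open>The two sides differ by the square of \<open>m p + 2 m' u\<close>. The
        energy is thereby bounded by an exact derivative and multiples of
        \<open>u\<^sup>2\<close>.\<close>
      also have "\<dots> \<le> 2 * D t + 4 * ((m' t)\<^sup>2 * (u t)\<^sup>2) + 3 * ((m t)\<^sup>2 * (lam * Q t) * (u t)\<^sup>2)"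
        using zero_le_power2[of "m t * p t + 2 * m' t * u t"]
        unfolding D_def by (simp add: power2_eq_square algebra_simps)
      also have "\<dots> \<le> 2 * D t + 4 * ((b - a)\<^sup>2 * (u t)\<^sup>2) + 3 * ((b - a) ^ 4 * (lam * q1) * (u t)\<^sup>2)"
      proof -
        have "\<bar>m' t\<bar> \<le> b - a" using t by (auto simp: m'_def)
        then have 1: "(m' t)\<^sup>2 \<le> (b - a)\<^sup>2" using abs_le_square_iff ab by force
        have "0 \<le> m t" "m t \<le> (b - a) * (b - a)" using t by (auto simp: m_def intro!: mult_mono)
        then have "(m t)\<^sup>2 \<le> ((b - a) * (b - a))\<^sup>2" by (intro power_mono) auto
        then have 2: "(m t)\<^sup>2 \<le> (b - a) ^ 4" by (simp add: power2_eq_square power4_eq_xxxx mult_ac)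
        have 3: "(m t)\<^sup>2 * (lam * Q t) \<le> (b - a) ^ 4 * (lam * q1)"
          using 2 lam Q(1)[OF True] Q(2)[OF True] by (intro mult_mono) auto
        show ?thesis
          by (intro add_mono mult_left_mono mult_right_mono 1 3) auto
      qed
      also have "\<dots> = 2 * D t + C * (u t)\<^sup>2" by (simp add: C_def algebra_simps)
      finally show ?thesis .
    qed
  qed
  then show ?thesis by (simp add: C_def)
qed

section \<open>Functions of bounded variation\<close>

definition list_variation :: "(real \<Rightarrow> real) \<Rightarrow> real list \<Rightarrow> real" where
  "list_variation f xs = (\<Sum>i<length xs - 1. \<bar>f (xs ! Suc i) - f (xs ! i)\<bar>)"

lemma list_variation_snoc: "list_variation f xs \<le> list_variation f (xs @ [s])"
proof -
  have "list_variation f xs = (\<Sum>i<length xs - 1. \<bar>f ((xs @ [s]) ! Suc i) - f ((xs @ [s]) ! i)\<bar>)"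
    unfolding list_variation_def by (rule sum.cong) (auto simp: nth_append)
  also have "\<dots> \<le> list_variation f (xs @ [s])"
    unfolding list_variation_def by (rule sum_mono2) auto
  finally show ?thesis .
qed

lemma list_variation_snoc2: "list_variation f (xs @ [s, t]) = list_variation f (xs @ [s]) + \<bar>f t - f s\<bar>"
proof -
  have "list_variation f (xs @ [s, t]) = (\<Sum>i<Suc (length xs). \<bar>f ((xs @ [s, t]) ! Suc i) - f ((xs @ [s, t]) ! i)\<bar>)"
    by (simp add: list_variation_def)
  also have "\<dots> = (\<Sum>i<length xs. \<bar>f ((xs @ [s, t]) ! Suc i) - f ((xs @ [s, t]) ! i)\<bar>) + \<bar>f t - f s\<bar>"
    by (simp add: nth_append)
  also have "(\<Sum>i<length xs. \<bar>f ((xs @ [s, t]) ! Suc i) - f ((xs @ [s, t]) ! i)\<bar>) = list_variation f (xs @ [s])"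
    unfolding list_variation_def
  proof (rule sum.cong)
    fix i assume "i \<in> {..<length (xs @ [s]) - 1}"
    then have "i < length xs" by simp
    then show "\<bar>f ((xs @ [s, t]) ! Suc i) - f ((xs @ [s, t]) ! i)\<bar> = \<bar>f ((xs @ [s]) ! Suc i) - f ((xs @ [s]) ! i)\<bar>"
      by (cases "Suc i = length xs") (auto simp: nth_append)
  qed simp
  finally show ?thesis .
qed

text \<open>\<open>N t\<close> is the supremum of the variations along lists in (0, t]. Appending
  \<open>s\<close> and \<open>t\<close> to a list in (0, s] gains at least |g t - g s|.\<close>

lemma variation_function:
  assumes "pointwise_variation {0<..<h} g \<le> ereal W"
  obtains N where "\<And>s t. 0 < s \<Longrightarrow> s \<le> t \<Longrightarrow> t < h \<Longrightarrow> \<bar>g t - g s\<bar> \<le> N t - N s \<and> N t - N s \<le> W"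
proof -
  define A where "A t = list_variation g ` {xs. sorted xs \<and> set xs \<subseteq> {0<..t}}" for t
  define N where "N t = Sup (A t)" for t
  have le: "x \<le> W" if mem: "x \<in> A t" and th: "t < h" for x t
  proof -
    obtain xs where x: "x = list_variation g xs" "xs \<in> {xs. sorted xs \<and> set xs \<subseteq> {0<..t}}"
      using mem unfolding A_def by (rule imageE)
    then have xs: "sorted xs" "set xs \<subseteq> {0<..t}" "x = list_variation g xs" by simp_all
    have "set xs \<subseteq> {0<..<h}" using xs(2) th by fastforce
    then have "ereal x \<le> pointwise_variation {0<..<h} g"
      unfolding pointwise_variation_def xs(3) list_variation_def using xs(1) by (intro SUP_upper) auto
    then show ?thesis using assms ereal_less_eq(3) order_trans by blast
  qed
  have bdd: "bdd_above (A t)" if "t < h" for t using le[OF _ that] by (rule bdd_aboveI)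
  \<comment> \<open>The empty list has \<open>0 - 1 = 0\<close> increments in the natural numbers.
    It makes \<open>A t\<close> nonempty and \<open>N\<close> nonnegative.\<close>
  have z: "0 \<in> A t" for t unfolding A_def list_variation_def
    by (rule image_eqI[of _ _ "[]"]) auto
  have "\<bar>g t - g s\<bar> \<le> N t - N s \<and> N t - N s \<le> W" if st: "0 < s" "s \<le> t" "t < h" for s t
  proof
    have "N s \<le> N t - \<bar>g t - g s\<bar>"
      unfolding N_def[of s]
    proof (rule cSup_least)
      fix x assume "x \<in> A s"
      then obtain xs where x: "x = list_variation g xs" "xs \<in> {xs. sorted xs \<and> set xs \<subseteq> {0<..s}}"
        unfolding A_def by (rule imageE)
      then have xs: "sorted xs" "set xs \<subseteq> {0<..s}" "x = list_variation g xs" by simp_all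
      have "sorted (xs @ [s, t])" "set (xs @ [s, t]) \<subseteq> {0<..t}"
        using xs st by (auto simp: sorted_append intro: order_trans)
      then have "list_variation g (xs @ [s, t]) \<in> A t" unfolding A_def by blast
      then have "list_variation g (xs @ [s, t]) \<le> N t"
        unfolding N_def by (rule cSup_upper[OF _ bdd[OF st(3)]])
      then show "x \<le> N t - \<bar>g t - g s\<bar>"
        using list_variation_snoc[of g xs s] xs(3) by (simp add: list_variation_snoc2)
    qed (use z in auto)
    then show "\<bar>g t - g s\<bar> \<le> N t - N s" by simp
    have "N t \<le> W" unfolding N_def by (rule cSup_least) (use z le st in auto)
    moreover have "0 \<le> N s" unfolding N_def by (rule cSup_upper[OF z bdd]) (use st in auto)
    ultimately show "N t - N s \<le> W" by simp
  qed
  then show ?thesis using that by blast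
qed

lemma Kset_AE_bounds:
  assumes "c \<in> Kset h cm cM"
  shows "AE y in lebesgue_on {0<..<h}. cm \<le> c y \<and> c y \<le> cM"
proof -
  have 1: "AE y in lebesgue_on {0<..<h}. ereal (c y) \<le> ereal cM"
    using esssup_AE[of "\<lambda>y. ereal (c y)" "lebesgue_on {0<..<h}"] assms unfolding Kset_def by simp
  have "esssup (lebesgue_on {0<..<h}) (\<lambda>y. - ereal (c y)) = - ereal cm"
    using assms unfolding Kset_def essinf_def by (simp add: ereal_uminus_eq_reorder)
  then have 2: "AE y in lebesgue_on {0<..<h}. - ereal (c y) \<le> - ereal cm"
    using esssup_AE[of "\<lambda>y. - ereal (c y)" "lebesgue_on {0<..<h}"] by simp
  show ?thesis using 1 2 by eventually_elim auto
qed

text \<open>Clamping the representative to \<open>[cm, cM]\<close> does not increase its variation.\<close>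

lemma KVset_representative:
  assumes "c \<in> KVset h cm cM V" "cm \<le> cM"
  obtains g N where "\<And>y. cm \<le> g y" "\<And>y. g y \<le> cM" "AE y in lebesgue_on {0<..<h}. g y = c y"
    "\<And>s t. 0 < s \<Longrightarrow> s \<le> t \<Longrightarrow> t < h \<Longrightarrow> \<bar>g t - g s\<bar> \<le> N t - N s"
    "\<And>s t. 0 < s \<Longrightarrow> s \<le> t \<Longrightarrow> t < h \<Longrightarrow> N t - N s \<le> V + 1"
proof -
  have K: "c \<in> Kset h cm cM" and "TV h c \<le> ereal V" using assms unfolding KVset_def by auto
  \<comment> \<open>The infimum in \<open>TV\<close> need not be attained; the margin 1 yields a
    representative and is the source of \<open>V + 1\<close> in the later constants.\<close>
  then have "TV h c < ereal (V + 1)" by (metis ereal_less(2) ereal_less_eq(3) le_less_trans less_add_one ereal_less_ereal_Ex)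
  then obtain f where f: "AE y in lebesgue_on {0<..<h}. f y = c y" "pointwise_variation {0<..<h} f < ereal (V + 1)"
    unfolding TV_def INF_less_iff by auto
  obtain N where N: "\<And>s t. 0 < s \<Longrightarrow> s \<le> t \<Longrightarrow> t < h \<Longrightarrow> \<bar>f t - f s\<bar> \<le> N t - N s \<and> N t - N s \<le> V + 1"
    using variation_function[OF less_imp_le[OF f(2)]] by metis
  define g where "g y = max cm (min cM (f y))" for y
  have "AE y in lebesgue_on {0<..<h}. g y = c y"
    using f(1) Kset_AE_bounds[OF K] by eventually_elim (auto simp: g_def)
  moreover have "cm \<le> g y" "g y \<le> cM" for y using assms(2) by (auto simp: g_def)
  moreover have "\<bar>g t - g s\<bar> \<le> \<bar>f t - f s\<bar>" for s t by (auto simp: g_def max_def min_def)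
  ultimately show ?thesis using that[of g N] N by (meson order_trans)
qed

section \<open>Regularity of the reduced eigenfunctions\<close>

lemma integral_lebesgue_on_Ioo:
  fixes f :: "real \<Rightarrow> real"
  assumes "f absolutely_integrable_on {a..b}"
  shows "integrable (lebesgue_on {a<..<b}) f" "integral\<^sup>L (lebesgue_on {a<..<b}) f = integral {a..b} f"
proof -
  have "f absolutely_integrable_on {a<..<b}"
    by (rule set_integrable_subset[OF assms]) auto
  then show i: "integrable (lebesgue_on {a<..<b}) f"
    by (simp add: absolutely_integrable_imp_integrable)
  show "integral\<^sup>L (lebesgue_on {a<..<b}) f = integral {a..b} f"
    unfolding integral_open_interval_real by (rule lebesgue_integral_eq_integral[OF i]) simp
qed

section \<open>From weak to classical derivatives on an interval\<close>

lemma compact_subset_Ioo: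
  assumes "compact K" "K \<subseteq> {0<..<h}" "h > (0::real)"
  obtains \<alpha> \<beta> where "0 < \<alpha>" "\<alpha> \<le> \<beta>" "\<beta> < h" "K \<subseteq> {\<alpha>..\<beta>}"
proof (cases "K = {}")
  case True
  then show ?thesis using that[of "h/2" "h/2"] assms(3) by auto
next
  case False
  obtain s where s: "s \<in> K" "\<forall>x\<in>K. s \<le> x" using compact_attains_inf[OF assms(1) False] by blast
  obtain t where t: "t \<in> K" "\<forall>x\<in>K. x \<le> t" using compact_attains_sup[OF assms(1) False] by blast
  show ?thesis using that[of s t] s t assms(2) by (auto simp: subset_iff)
qed

text \<open>The primitive from 0 vanishes to the left of the support of \<omega>, and the zero mean
  makes it vanish to the right as well.\<close>

lemma test_function_antiderivative:
  fixes \<omega> :: "real \<Rightarrow> real" and h :: real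
  assumes \<omega>: "test_function {0<..<h} \<omega>" and h: "h > 0" and zero: "integral {0..h} \<omega> = (0::real)"
  obtains \<psi> where "test_function {0<..<h} \<psi>" "pd 1 \<psi> = \<omega>"
proof -
  obtain K where K: "smooth_on UNIV \<omega>" "compact K" "K \<subseteq> {0<..<h}" "\<And>x. x \<notin> K \<Longrightarrow> \<omega> x = 0"
    using \<omega> unfolding test_function_def by auto
  obtain \<alpha> \<beta> where ab: "0 < \<alpha>" "\<alpha> \<le> \<beta>" "\<beta> < h" "K \<subseteq> {\<alpha>..\<beta>}" using compact_subset_Ioo[OF K(2,3) h] .
  have out: "\<omega> x = 0" if "x < \<alpha> \<or> \<beta> < x" for x using that ab(4) by (intro K(4)) auto
  define \<psi> where "\<psi> t = integral {0..t} \<omega>" for t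
  have left: "\<psi> t = 0" if "t < \<alpha>" for t
  proof -
    have "integral {0..t} \<omega> = integral {0..t} (\<lambda>_. 0)"
      by (rule Henstock_Kurzweil_Integration.integral_cong) (use that out in auto)
    then show ?thesis by (simp add: \<psi>_def)
  qed
  have d: "(\<psi> has_real_derivative \<omega> t) (at t)" for t
  proof (cases "t > 0")
    case True
    have "(\<psi> has_real_derivative \<omega> t) (at t within {0..t+1})"
      unfolding \<psi>_def using True
      by (intro integral_has_real_derivative continuous_on_subset[OF smooth_on_continuous[OF K(1)]]) auto
    moreover have "at t within {0..t+1} = at t" using True by (intro at_within_Icc_at) auto
    ultimately show ?thesis by simp
  next
    case False
    then have t: "t < \<alpha>" using ab(1) by simp
    have "((\<lambda>_. 0) has_real_derivative \<omega> t) (at t)" using out t by simp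
    then show ?thesis
      by (rule has_field_derivative_transform_within_open[of _ _ _ "{..<\<alpha>}"]) (use t left in auto)
  qed
  \<comment> \<open>The constant is identified by the value at \<open>h\<close>, the vanishing
    integral over \<open>{0..h}\<close>.\<close>
  have "\<exists>c. \<forall>x\<in>{\<beta><..}. \<psi> x = c"
    by (rule has_field_derivative_zero_constant) (use has_field_derivative_at_within[OF d] out in \<open>auto, metis\<close>)
  then have right: "\<psi> x = 0" if "\<beta> < x" for x
    using zero ab(3) that unfolding \<psi>_def by (metis greaterThan_iff)
  have hd: "(\<psi> has_derivative (\<lambda>v. v * \<omega> t)) (at t)" for t
    using d[of t] unfolding has_field_derivative_def by (rule has_derivative_eq_rhs) (auto simp: mult.commute)
  have "Ck_on n UNIV \<psi>" for n
  proof -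
    have "Ck_on n UNIV (\<lambda>x. v * \<omega> x)" for v
      using K(1) by (intro Ck_on_mult Ck_on_const) (simp add: smooth_on_def)
    then show ?thesis using Ck_on_Suc_I[OF hd] Ck_on_SucD by blast
  qed
  then have sm: "smooth_on UNIV \<psi>" by (simp add: smooth_on_def)
  have "test_function {0<..<h} \<psi>"
    by (rule test_functionI[OF sm, of "{\<alpha>..\<beta>}"]) (use ab left right in \<open>auto simp: not_le\<close>)
  moreover have "pd 1 \<psi> = \<omega>"
  proof
    fix t show "pd 1 \<psi> t = \<omega> t" using frechet_derivative_at[OF hd[of t]] by (metis mult_1)
  qed
  ultimately show ?thesis using that by blast
qed

lemma test_function_real_derivative:
  fixes \<psi> :: "real \<Rightarrow> real"
  assumes "test_function S \<psi>" shows "(\<psi> has_real_derivative pd 1 \<psi> t) (at t)"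
  using smooth_on_line_derivative[OF test_function_smooth[OF assms], of 0 1 t] by simp

lemma test_function_continuous_on: "test_function S \<psi> \<Longrightarrow> continuous_on T \<psi>"
  by (rule continuous_on_subset[OF smooth_on_continuous[OF test_function_smooth]]) auto

lemma test_function_primitive_on:
  fixes \<psi> :: "real \<Rightarrow> real"
  assumes "test_function S \<psi>" shows "primitive_on a b \<psi> (pd 1 \<psi>)"
  by (rule primitive_on_C1[OF has_field_derivative_at_within[OF test_function_real_derivative[OF assms]]
        test_function_continuous_on[OF test_function_pd[OF assms]]])

text \<open>Subtracting from a test function \<zeta> a multiple of a fixed \<theta> with nonzero
  mean gives mean zero, hence the derivative of a test function. The hypothesis then says that
  \<open>G - C\<close> is orthogonal to every \<zeta>.\<close>

lemma du_Bois_Reymond: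
  fixes G :: "real \<Rightarrow> real"
  assumes h: "h > 0" and G: "continuous_on {0..h} G"
    and zero: "\<And>\<psi>. test_function {0<..<h} \<psi> \<Longrightarrow> integral {0..h} (\<lambda>t. pd 1 \<psi> t * G t) = 0"
  obtains C where "\<And>t. t \<in> {0..h} \<Longrightarrow> G t = C"
proof -
  have ai: "f absolutely_integrable_on {0..h}" if "continuous_on {0..h} f" for f :: "real \<Rightarrow> real"
    by (rule absolutely_integrable_continuous_real[OF that])
  have ic: "f integrable_on {0..h}" if "continuous_on {0..h} f" for f :: "real \<Rightarrow> real"
    by (rule integrable_continuous_interval[OF that])
  \<comment> \<open>If every test function had mean zero, the fundamental lemma would apply to the
    constant 1.\<close>
  have "\<exists>\<theta> :: real \<Rightarrow> real. test_function {0<..<h} \<theta> \<and> integral {0..h} \<theta> \<noteq> 0"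
  proof (rule ccontr)
    assume "\<not> ?thesis"
    then have "integral\<^sup>L (lebesgue_on {0<..<h}) (\<lambda>t. \<psi> t * 1) = 0" if "test_function {0<..<h} \<psi>" for \<psi> :: "real \<Rightarrow> real"
      using integral_lebesgue_on_Ioo(2)[OF ai[OF test_function_continuous_on[OF that]]] that by simp
    then have "AE x in lebesgue_on {0<..<h}. 1 = (0::real)"
      by (intro fundamental_lemma integral_lebesgue_on_Ioo ai continuous_intros) auto
    then have "AE x in lebesgue. x \<in> {0<..<h} \<longrightarrow> x \<in> {}" by (subst (asm) AE_restrict_space_iff) auto
    then have "AE x\<in>{0<..<h} in lebesgue. x \<in> ({} :: real set)" by simp
    from mem_closed_if_AE_lebesgue_open[OF _ _ this, of "h/2"] h show False by auto
  qed
  then obtain \<theta> :: "real \<Rightarrow> real" where \<theta>: "test_function {0<..<h} \<theta>" "integral {0..h} \<theta> \<noteq> 0" by blast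
  define C where "C = integral {0..h} (\<lambda>t. \<theta> t * G t) / integral {0..h} \<theta>"
  have cG: "continuous_on {0..h} (\<lambda>t. G t - C)" by (intro continuous_intros G)
  have "AE t in lebesgue_on {0<..<h}. G t - C = 0"
  proof (rule fundamental_lemma[OF _ integral_lebesgue_on_Ioo(1)[OF ai[OF cG]]])
    fix \<zeta> :: "real \<Rightarrow> real" assume \<zeta>: "test_function {0<..<h} \<zeta>"
    note c = test_function_continuous_on[OF \<zeta>, of "{0..h}"] test_function_continuous_on[OF \<theta>(1), of "{0..h}"]
    define k where "k = integral {0..h} \<zeta> / integral {0..h} \<theta>"
    define \<omega> where "\<omega> t = \<zeta> t + (- k) * \<theta> t" for t
    obtain K1 where K1: "smooth_on UNIV \<zeta>" "compact K1" "K1 \<subseteq> {0<..<h}" "\<And>x. x \<notin> K1 \<Longrightarrow> \<zeta> x = 0"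
      using \<zeta> unfolding test_function_def by auto
    obtain K2 where K2: "smooth_on UNIV \<theta>" "compact K2" "K2 \<subseteq> {0<..<h}" "\<And>x. x \<notin> K2 \<Longrightarrow> \<theta> x = 0"
      using \<theta>(1) unfolding test_function_def by auto
    have sm: "smooth_on UNIV \<omega>" unfolding \<omega>_def
      by (rule smooth_on_add[OF K1(1) smooth_on_mult[OF smooth_on_const K2(1)]])
    have \<omega>: "test_function {0<..<h} \<omega>"
      by (rule test_functionI[OF sm compact_Un[OF K1(2) K2(2)]]) (use K1(3,4) K2(3,4) in \<open>auto simp: \<omega>_def\<close>)
    have "integral {0..h} \<omega> = integral {0..h} \<zeta> + integral {0..h} (\<lambda>t. - k * \<theta> t)"
      unfolding \<omega>_def by (intro Henstock_Kurzweil_Integration.integral_add ic continuous_intros c)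
    also have "\<dots> = 0" using \<theta>(2) by (simp add: k_def)
    finally obtain \<psi> where \<psi>: "test_function {0<..<h} \<psi>" "pd 1 \<psi> = \<omega>"
      using test_function_antiderivative[OF \<omega> h] by metis
    have "0 = integral {0..h} (\<lambda>t. \<zeta> t * G t + - k * (\<theta> t * G t))"
      using zero[OF \<psi>(1)] fun_cong[OF \<psi>(2)] by (simp add: \<omega>_def algebra_simps)
    also have "\<dots> = integral {0..h} (\<lambda>t. \<zeta> t * G t) + integral {0..h} (\<lambda>t. - k * (\<theta> t * G t))"
      by (intro Henstock_Kurzweil_Integration.integral_add ic continuous_intros c G)
    also have "\<dots> = integral {0..h} (\<lambda>t. \<zeta> t * G t) - C * integral {0..h} \<zeta>"
      by (simp add: k_def C_def)
    also have "\<dots> = integral {0..h} (\<lambda>t. \<zeta> t * G t) - integral {0..h} (\<lambda>t. C * \<zeta> t)" by simp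
    also have "\<dots> = integral {0..h} (\<lambda>t. \<zeta> t * G t - C * \<zeta> t)"
      by (intro Henstock_Kurzweil_Integration.integral_diff[symmetric] ic continuous_intros c G)
    also have "\<dots> = integral {0..h} (\<lambda>t. \<zeta> t * (G t - C))" by (simp add: algebra_simps)
    also have "\<dots> = integral\<^sup>L (lebesgue_on {0<..<h}) (\<lambda>t. \<zeta> t * (G t - C))"
      by (intro integral_lebesgue_on_Ioo(2)[symmetric] ai continuous_intros c G)
    finally show "integral\<^sup>L (lebesgue_on {0<..<h}) (\<lambda>t. \<zeta> t * (G t - C)) = 0" by simp
  qed simp
  then have ae: "AE t\<in>{0<..<h} in lebesgue. t \<in> {t \<in> {0..h}. G t = C}"
    by (subst (asm) AE_restrict_space_iff) (auto elim: eventually_mono)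
  have cl: "closed {t \<in> {0..h}. G t = C}"
    using continuous_closed_preimage_constant[OF G] by simp
  have "{0<..<h} \<subseteq> {t \<in> {0..h}. G t = C}"
    using mem_closed_if_AE_lebesgue_open[OF open_greaterThanLessThan cl ae] by blast
  then have "closure {0<..<h} \<subseteq> {t \<in> {0..h}. G t = C}" by (rule closure_minimal[OF _ cl])
  then have "G t = C" if "t \<in> {0..h}" for t
    using that h closure_greaterThanLessThan[OF h] by auto
  then show ?thesis using that by blast
qed

text \<open>Membership in \<open>H1\<close> supplies the witnesses among which \<open>wderiv\<close>
  chooses.\<close>

lemma H2_weak_derivatives:
  assumes "u \<in> H2 S" "i \<in> Basis"
  shows "has_weak_deriv S i u (wderiv S i u)" "wderiv S i u \<in> L2 S" "wderiv S i (wderiv S i u) \<in> L2 S"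
    "has_weak_deriv S i (wderiv S i u) (wderiv S i (wderiv S i u))"
proof -
  have w: "wderiv S i f \<in> L2 S \<and> has_weak_deriv S i f (wderiv S i f)" if "f \<in> H1 S" for f
  proof -
    have "\<exists>g. g \<in> L2 S \<and> has_weak_deriv S i f g" using that assms(2) unfolding H1_def by auto
    then show ?thesis unfolding wderiv_def by (rule someI_ex)
  qed
  have "u \<in> H1 S" "wderiv S i u \<in> H1 S" using assms unfolding H2_def by auto
  then show "has_weak_deriv S i u (wderiv S i u)" "wderiv S i u \<in> L2 S" "wderiv S i (wderiv S i u) \<in> L2 S"
    "has_weak_deriv S i (wderiv S i u) (wderiv S i (wderiv S i u))" using w by auto
qed

text \<open>The second weak derivative agrees almost everywhere with the function \<open>a\<close>
  read off from the equation. The classical derivative minus the integral of \<open>a\<close> is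
  orthogonal to the derivatives of all test functions, hence constant. Using \<open>g\<close>
  instead of \<open>c\<close> alters the equation on a null set only and makes \<open>a\<close>
  bounded everywhere.\<close>

lemma eigenfunction_primitives:
  fixes c g u :: "real \<Rightarrow> real"
  assumes h: "h > 0" and ef: "A_eigenfunction h c m lam u"
    and diff: "u differentiable_on {0..h}" and cont: "continuous_on {0..h} (D h u)"
    and lam: "lam > 0" and cm: "0 < cm" and g: "\<And>y. cm \<le> g y" "AE y in lebesgue_on {0<..<h}. g y = c y"
  shows "primitive_on 0 h u (D h u)"
    and "primitive_on 0 h (D h u) (\<lambda>t. - lam * (1 / g t - m\<^sup>2 / lam) * u t)"
proof -
  define p where "p = D h u"
  define a where "a t = - lam * (1 / g t - m\<^sup>2 / lam) * u t" for t
  have du: "(u has_real_derivative p t) (at t within {0..h})" if "t \<in> {0..h}" for t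
    using diff that unfolding p_def D_def differentiable_on_def
    by (simp add: has_real_derivative_iff_has_vector_derivative vector_derivative_works)
  have cp: "continuous_on {0..h} p" using cont unfolding p_def .
  have cu: "continuous_on {0..h} u" using differentiable_imp_continuous_on[OF diff] .
  show up: "primitive_on 0 h u (D h u)" using primitive_on_C1[OF du cp] unfolding p_def .
  define w where "w = wderiv {0<..<h} 1 (wderiv {0<..<h} 1 u)"
  have H2: "u \<in> H2 {0<..<h}" using ef unfolding A_eigenfunction_def by auto
  have "1 \<in> (Basis :: real set)" by simp
  note wd = H2_weak_derivatives[OF H2 this, folded w_def]
  have I: "{0<..<h} \<inter> space lebesgue \<in> sets lebesgue" by simp
  have wa: "AE t in lebesgue_on {0<..<h}. w t = a t"
  proof -
    have "AE t in lebesgue_on {0<..<h}. c t * (m\<^sup>2 * u t - w t) = lam * u t"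
      using ef unfolding A_eigenfunction_def A_op_def w_def by auto
    with g(2) show ?thesis
    proof eventually_elim
      fix t assume e: "g t = c t" "c t * (m\<^sup>2 * u t - w t) = lam * u t"
      have "c t > 0" using g(1)[of t] e(1) cm by simp
      then have "m\<^sup>2 * u t - w t = lam * u t / g t" using e by (simp add: field_simps)
      then show "w t = a t" unfolding a_def using lam by (simp add: field_simps)
    qed
  qed
  have wm: "w \<in> borel_measurable (lebesgue_on {0<..<h})" using wd(3) unfolding L2_def by auto
  have wI: "(\<lambda>t. indicator {0<..<h} t *\<^sub>R w t) \<in> borel_measurable lebesgue"
    using wm by (subst (asm) borel_measurable_restrict_space_iff[OF I])
  have ends: "AE t in lebesgue. t \<noteq> 0 \<and> t \<noteq> h"
    using AE_completion[OF AE_lborel_singleton[of "0::real"]] AE_completion[OF AE_lborel_singleton[of h]]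
    by eventually_elim auto
  have "AE t in lebesgue. indicator {0<..<h} t *\<^sub>R w t = indicator {0..h} t *\<^sub>R a t"
    using wa ends unfolding AE_restrict_space_iff[OF I]
    by eventually_elim (auto simp: indicator_def)
  \<comment> \<open>Measurability of \<open>a\<close> is inherited from the weak derivative
    \<open>w\<close>, because Lebesgue measure is complete.\<close>
  then have aI: "(\<lambda>t. indicator {0..h} t *\<^sub>R a t) \<in> borel_measurable lebesgue"
    by (rule borel_measurable_AE[OF wI])
  have "bounded (u ` {0..h})" by (intro compact_imp_bounded compact_continuous_image cu) auto
  then obtain M where M: "\<And>t. t \<in> {0..h} \<Longrightarrow> \<bar>u t\<bar> \<le> M"
    unfolding bounded_iff by (metis imageI real_norm_def)
  have ab: "\<bar>a t\<bar> \<le> lam * (1 / cm + m\<^sup>2 / lam) * M" if t: "t \<in> {0..h}" for t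
  proof -
    have "0 < g t" using g(1)[of t] cm by linarith
    moreover have "1 / g t \<le> 1 / cm" using g(1)[of t] cm by (intro divide_left_mono) auto
    moreover have "0 \<le> m\<^sup>2 / lam" using lam by simp
    ultimately have "\<bar>1 / g t - m\<^sup>2 / lam\<bar> \<le> 1 / cm + m\<^sup>2 / lam"
      using divide_pos_pos[of 1 "g t"] divide_pos_pos[of 1 cm] cm unfolding abs_le_iff by linarith
    then show ?thesis unfolding a_def abs_mult using lam M[OF t]
      by (intro mult_mono) auto
  qed
  have aai: "a absolutely_integrable_on {0..h}"
  proof -
    have "integrable lebesgue (\<lambda>t. indicator {0..h} t *\<^sub>R (indicator {0..h} t *\<^sub>R a t))"
      by (rule integrableI_bounded_set_indicator[OF _ aI, where B = "lam * (1 / cm + m\<^sup>2 / lam) * M"])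
         (use ab in \<open>auto simp: emeasure_lborel_Icc_eq\<close>)
    moreover have "(\<lambda>t. indicator {0..h} t *\<^sub>R (indicator {0..h} t *\<^sub>R a t)) = (\<lambda>t. indicator {0..h} t *\<^sub>R a t)"
      by (auto simp: indicator_def)
    ultimately show ?thesis unfolding set_integrable_def by simp
  qed
  define P where "P x = integral {0..x} a" for x
  have Pa: "primitive_on 0 h P a" unfolding P_def using primitive_on_integral[OF aai ab] by blast
  note cP = primitive_on_continuous[OF Pa]
  have "integral {0..h} (\<lambda>t. pd 1 \<psi> t * (p t - P t)) = 0" if \<psi>: "test_function {0<..<h} \<psi>" for \<psi>
  proof -
    note \<psi>1 = test_function_pd[OF \<psi>, of 1]
    note \<psi>2 = test_function_pd[OF \<psi>1, of 1]
    note c = test_function_continuous_on[OF \<psi>, of "{0..h}"] test_function_continuous_on[OF \<psi>1, of "{0..h}"]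
      test_function_continuous_on[OF \<psi>2, of "{0..h}"]
    have ai: "f absolutely_integrable_on {0..h}" if "continuous_on {0..h} f" for f :: "real \<Rightarrow> real"
      by (rule absolutely_integrable_continuous_real[OF that])
    have ic: "f integrable_on {0..h}" if "continuous_on {0..h} f" for f :: "real \<Rightarrow> real"
      by (rule integrable_continuous_interval[OF that])
    have 1: "((\<lambda>t. pd 1 (pd 1 \<psi>) t * u t + pd 1 \<psi> t * p t) has_integral 0) {0..h}"
      using primitive_onD[OF primitive_on_mult[OF test_function_primitive_on[OF \<psi>1] up], of 0 h] h
        test_function_eq_0_outside[OF \<psi>1] unfolding p_def by simp
    have 2: "((\<lambda>t. pd 1 \<psi> t * P t + \<psi> t * a t) has_integral 0) {0..h}"
      using primitive_onD[OF primitive_on_mult[OF test_function_primitive_on[OF \<psi>] Pa], of 0 h] h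
        test_function_eq_0_outside[OF \<psi>] by simp
    have \<psi>a: "(\<lambda>t. \<psi> t * a t) absolutely_integrable_on {0..h}"
      by (rule absolutely_integrable_bounded_measurable_product_real[OF _ _ _ aai])
         (use c(1) in \<open>auto intro!: continuous_imp_measurable_on_sets_lebesgue compact_imp_bounded compact_continuous_image\<close>)
    \<comment> \<open>Here the weak derivatives of \<open>u\<close> are used. \<open>1\<close> and
      \<open>2\<close> are the classical integrations by parts for \<open>u\<close> and
      \<open>P\<close>; the three combine to the orthogonality relation.\<close>
    have 3: "integral {0..h} (\<lambda>t. pd 1 (pd 1 \<psi>) t * u t) = integral {0..h} (\<lambda>t. \<psi> t * a t)"
    proof -
      have "integral {0..h} (\<lambda>t. pd 1 (pd 1 \<psi>) t * u t) = integral\<^sup>L (lebesgue_on {0<..<h}) (\<lambda>t. pd 1 (pd 1 \<psi>) t *\<^sub>R u t)"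
        using integral_lebesgue_on_Ioo(2)[OF ai, of "\<lambda>t. pd 1 (pd 1 \<psi>) t * u t"] c cu
        by (simp add: continuous_on_mult)
      also have "\<dots> = - integral\<^sup>L (lebesgue_on {0<..<h}) (\<lambda>t. pd 1 \<psi> t *\<^sub>R wderiv {0<..<h} 1 u t)"
        using wd(1) \<psi>1 unfolding has_weak_deriv_def by blast
      also have "\<dots> = integral\<^sup>L (lebesgue_on {0<..<h}) (\<lambda>t. \<psi> t *\<^sub>R w t)"
        using wd(4) \<psi> unfolding has_weak_deriv_def by auto
      also have "\<dots> = integral\<^sup>L (lebesgue_on {0<..<h}) (\<lambda>t. \<psi> t * a t)"
      proof (rule integral_cong_AE)
        have "\<psi> \<in> borel_measurable (lebesgue_on {0<..<h})"
          by (rule continuous_imp_measurable_on_sets_lebesgue[OF test_function_continuous_on[OF \<psi>]]) auto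
        then show "(\<lambda>t. \<psi> t *\<^sub>R w t) \<in> borel_measurable (lebesgue_on {0<..<h})" using wm by simp
        show "(\<lambda>t. \<psi> t * a t) \<in> borel_measurable (lebesgue_on {0<..<h})"
          using integral_lebesgue_on_Ioo(1)[OF \<psi>a] by auto
        show "AE t in lebesgue_on {0<..<h}. \<psi> t *\<^sub>R w t = \<psi> t * a t" using wa by eventually_elim simp
      qed
      also have "\<dots> = integral {0..h} (\<lambda>t. \<psi> t * a t)" by (rule integral_lebesgue_on_Ioo(2)[OF \<psi>a])
      finally show ?thesis .
    qed
    have i1: "(\<lambda>t. pd 1 (pd 1 \<psi>) t * u t) integrable_on {0..h}" "(\<lambda>t. pd 1 \<psi> t * p t) integrable_on {0..h}"
      "(\<lambda>t. pd 1 \<psi> t * P t) integrable_on {0..h}"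
      by (intro ic continuous_on_mult c cu cp cP)+
    have i2: "(\<lambda>t. \<psi> t * a t) integrable_on {0..h}" using \<psi>a set_lebesgue_integral_eq_integral(1) by blast
    have e1: "integral {0..h} (\<lambda>t. pd 1 (pd 1 \<psi>) t * u t) + integral {0..h} (\<lambda>t. pd 1 \<psi> t * p t) = 0"
      using integral_unique[OF 1] Henstock_Kurzweil_Integration.integral_add[OF i1(1,2)] by simp
    have e2: "integral {0..h} (\<lambda>t. pd 1 \<psi> t * P t) + integral {0..h} (\<lambda>t. \<psi> t * a t) = 0"
      using integral_unique[OF 2] Henstock_Kurzweil_Integration.integral_add[OF i1(3) i2] by simp
    have "integral {0..h} (\<lambda>t. pd 1 \<psi> t * (p t - P t)) = integral {0..h} (\<lambda>t. pd 1 \<psi> t * p t - pd 1 \<psi> t * P t)"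
      by (simp add: algebra_simps)
    also have "\<dots> = integral {0..h} (\<lambda>t. pd 1 \<psi> t * p t) - integral {0..h} (\<lambda>t. pd 1 \<psi> t * P t)"
      by (rule Henstock_Kurzweil_Integration.integral_diff[OF i1(2,3)])
    finally show ?thesis using e1 e2 3 by linarith
  qed
  moreover have "continuous_on {0..h} (\<lambda>t. p t - P t)" by (intro continuous_intros cp cP)
  ultimately obtain C where C: "\<And>t. t \<in> {0..h} \<Longrightarrow> p t - P t = C"
    using du_Bois_Reymond[OF h, of "\<lambda>t. p t - P t"] by metis
  have "(a has_integral p y - p x) {x..y}" if "0 \<le> x" "x \<le> y" "y \<le> h" for x y
  proof -
    have "p y - p x = P y - P x" using C[of x] C[of y] that by auto
    then show ?thesis using primitive_onD[OF Pa that] by simp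
  qed
  then have "primitive_on 0 h p a" unfolding primitive_on_def using aai ab by blast
  then show "primitive_on 0 h (D h u) (\<lambda>t. - lam * (1 / g t - m\<^sup>2 / lam) * u t)"
    unfolding p_def a_def .
qed

section \<open>Norms of product functions\<close>

lemma nn_integral_lborel_product:
  fixes g :: "'a::euclidean_space \<Rightarrow> ennreal" and w :: "'b::euclidean_space \<Rightarrow> ennreal"
  assumes [measurable]: "g \<in> borel_measurable borel" "w \<in> borel_measurable borel"
  shows "(\<integral>\<^sup>+z. g (fst z) * w (snd z) \<partial>lborel) = (\<integral>\<^sup>+x. g x \<partial>lborel) * (\<integral>\<^sup>+y. w y \<partial>lborel)"
proof -
  have "(\<integral>\<^sup>+z. g (fst z) * w (snd z) \<partial>lborel) = (\<integral>\<^sup>+z. g (fst z) * w (snd z) \<partial>(lborel \<Otimes>\<^sub>M lborel))"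
    by (simp add: lborel_prod)
  also have "\<dots> = (\<integral>\<^sup>+x. \<integral>\<^sup>+y. g x * w y \<partial>lborel \<partial>lborel)"
    by (subst lborel.nn_integral_fst[symmetric]) auto
  also have "\<dots> = (\<integral>\<^sup>+x. g x \<partial>lborel) * (\<integral>\<^sup>+y. w y \<partial>lborel)"
    by (simp add: nn_integral_cmult nn_integral_multc)
  finally show ?thesis .
qed

lemma AE_lborel_fst:
  fixes P :: "'a::euclidean_space \<Rightarrow> bool"
  assumes "AE x in lborel. P x"
  shows "AE z in (lborel :: ('a \<times> 'b::euclidean_space) measure). P (fst z)"
proof -
  obtain N where N: "{x. \<not> P x} \<subseteq> N" "N \<in> null_sets lborel"
    using assms unfolding eventually_ae_filter by auto
  have Nm[measurable]: "N \<in> sets borel" using N(2) by auto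
  have "emeasure (lborel :: ('a \<times> 'b) measure) (N \<times> UNIV) = emeasure (lborel \<Otimes>\<^sub>M lborel) (N \<times> (UNIV :: 'b set))"
    by (simp add: lborel_prod)
  also have "\<dots> = emeasure lborel N * emeasure lborel (UNIV :: 'b set)"
    by (rule lborel.emeasure_pair_measure_Times) auto
  also have "\<dots> = 0" using N(2) by auto
  finally have "N \<times> UNIV \<in> null_sets (lborel :: ('a \<times> 'b) measure)"
    by (auto simp: null_sets_def intro!: borel_Times)
  moreover have "{z. \<not> P (fst z)} \<subseteq> N \<times> (UNIV :: 'b set)" using N(1) by auto
  ultimately show ?thesis unfolding eventually_ae_filter by auto
qed

text \<open>Tonelli's theorem is applied to \<open>lborel\<close>, whose products are again
  \<open>lborel\<close>; completed measures do not have this property. So \<open>f\<close> is first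
  replaced by a Borel function, which changes the product on a null set only.\<close>

lemma integral_lebesgue_product:
  fixes f :: "'a::euclidean_space \<Rightarrow> real" and w :: "'b::euclidean_space \<Rightarrow> real"
  assumes f: "f \<in> borel_measurable lebesgue" "\<And>x. f x \<ge> 0" and w: "w \<in> borel_measurable borel" "\<And>y. w y \<ge> 0"
  shows "integral\<^sup>L lebesgue (\<lambda>z. f (fst z) * w (snd z)) = integral\<^sup>L lebesgue f * integral\<^sup>L lebesgue w"
proof -
  obtain g0 where g0: "g0 \<in> borel_measurable lborel" "AE x in lborel. f x = g0 x"
    using completion_ex_borel_measurable_real[OF f(1)] by auto
  define g where "g x = max 0 (g0 x)" for x
  have g[measurable]: "g \<in> borel_measurable borel" using g0(1) unfolding g_def by simp
  have ge: "g x \<ge> 0" for x by (simp add: g_def)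
  have ae: "AE x in lborel. f x = g x" using g0(2) by eventually_elim (use f(2) in \<open>metis g_def max.absorb2\<close>)
  note [measurable] = w(1)
  have gl: "g \<in> borel_measurable lborel" "w \<in> borel_measurable lborel" by auto
  have m: "(\<lambda>z. g (fst z) * w (snd z)) \<in> borel_measurable (borel :: ('a \<times> 'b) measure)"
    by (intro borel_measurable_times measurable_compose[OF _ g] measurable_compose[OF _ w(1)]
        borel_measurable_continuous_onI continuous_intros)
  then have ml: "(\<lambda>z. g (fst z) * w (snd z)) \<in> borel_measurable (lborel :: ('a \<times> 'b) measure)" by simp
  have aep: "AE z in (lebesgue :: ('a \<times> 'b) measure). g (fst z) * w (snd z) = f (fst z) * w (snd z)"
    by (rule AE_completion[OF eventually_mono[OF AE_lborel_fst[OF ae]]]) simp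
  have mf: "(\<lambda>z. f (fst z) * w (snd z)) \<in> borel_measurable (lebesgue :: ('a \<times> 'b) measure)"
    by (rule borel_measurable_AE[OF measurable_completion[OF ml] aep]) 
  have "integral\<^sup>L lebesgue (\<lambda>z. f (fst z) * w (snd z)) = integral\<^sup>L lebesgue (\<lambda>z. g (fst z) * w (snd z))"
    by (rule integral_cong_AE[OF mf measurable_completion[OF ml]]) (use aep in \<open>auto elim: eventually_mono\<close>)
  also have "\<dots> = integral\<^sup>L lborel (\<lambda>z. g (fst z) * w (snd z))" by (rule integral_completion[OF ml])
  \<comment> \<open>The value 0 that \<open>enn2real\<close> gives to infinity is also the value of
    the integral of a non-integrable function.\<close>
  also have "\<dots> = enn2real (\<integral>\<^sup>+z. ennreal (g (fst z)) * ennreal (w (snd z)) \<partial>lborel)"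
    by (subst integral_eq_nn_integral[OF ml]) (auto simp: ge w ennreal_mult)
  also have "\<dots> = enn2real (\<integral>\<^sup>+x. ennreal (g x) \<partial>lborel) * enn2real (\<integral>\<^sup>+y. ennreal (w y) \<partial>lborel)"
    by (subst nn_integral_lborel_product) (auto simp: enn2real_mult)
  also have "enn2real (\<integral>\<^sup>+x. ennreal (g x) \<partial>lborel) = integral\<^sup>L lborel g"
    by (rule integral_eq_nn_integral[symmetric]) (auto simp: ge)
  also have "\<dots> = integral\<^sup>L lebesgue g" by (rule integral_completion[symmetric, OF gl(1)])
  also have "\<dots> = integral\<^sup>L lebesgue f"
    by (rule integral_cong_AE[OF measurable_completion[OF gl(1)] f(1)]) (use AE_completion[OF ae] in \<open>auto elim: eventually_mono\<close>)
  also have "enn2real (\<integral>\<^sup>+y. ennreal (w y) \<partial>lborel) = integral\<^sup>L lborel w"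
    by (rule integral_eq_nn_integral[symmetric]) (auto simp: w)
  also have "\<dots> = integral\<^sup>L lebesgue w" by (rule integral_completion[symmetric, OF gl(2)])
  finally show ?thesis .
qed

lemma open_imp_sets_lebesgue: "open S \<Longrightarrow> S \<in> sets lebesgue"
  by auto

lemma L2_norm_product:
  fixes f :: "'a::euclidean_space \<Rightarrow> complex" and u :: "real \<Rightarrow> real"
  assumes S: "open S" and T: "open T" and f: "f \<in> borel_measurable (lebesgue_on S)" and u: "continuous_on T u"
  shows "L2_norm (S \<times> T) (\<lambda>(x, y). f x * of_real (u y)) = L2_norm S f * L2_norm T u"
proof -
  have Sm: "S \<in> sets lebesgue" "T \<in> sets lebesgue" "S \<times> T \<in> sets lebesgue" by (intro open_imp_sets_lebesgue open_Times S T)+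
  define F where "F x = indicator S x *\<^sub>R (norm (f x))\<^sup>2" for x
  define W where "W y = indicator T y *\<^sub>R (u y)\<^sup>2" for y
  have "(\<lambda>x. (norm (f x))\<^sup>2) \<in> borel_measurable (lebesgue_on S)" using f by measurable
  then have F: "F \<in> borel_measurable lebesgue"
    unfolding F_def using Sm by (subst (asm) borel_measurable_restrict_space_iff) auto
  have W: "W \<in> borel_measurable borel"
    unfolding W_def using T u by (intro borel_measurable_continuous_on_indicator continuous_intros) auto
  have "integral\<^sup>L (lebesgue_on (S \<times> T)) (\<lambda>z. (norm ((\<lambda>(x, y). f x * of_real (u y)) z))\<^sup>2)
      = integral\<^sup>L lebesgue (\<lambda>z. F (fst z) * W (snd z))"
    using Sm(3) by (subst integral_restrict_space)
      (auto intro!: Bochner_Integration.integral_cong simp: F_def W_def indicator_def norm_mult power_mult_distrib)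
  also have "\<dots> = integral\<^sup>L lebesgue F * integral\<^sup>L lebesgue W"
    by (rule integral_lebesgue_product[OF F _ W]) (auto simp: F_def W_def)
  also have "integral\<^sup>L lebesgue F = integral\<^sup>L (lebesgue_on S) (\<lambda>x. (norm (f x))\<^sup>2)"
    unfolding F_def using Sm by (subst integral_restrict_space) auto
  also have "integral\<^sup>L lebesgue W = integral\<^sup>L (lebesgue_on T) (\<lambda>x. (norm (u x))\<^sup>2)"
    unfolding W_def using Sm by (subst integral_restrict_space) auto
  finally show ?thesis unfolding L2_norm_def by (simp add: real_sqrt_mult)
qed

section \<open>Mass of the Dirichlet eigenfunctions\<close>

lemma L2_bounded_imp_integrable:
  fixes f :: "'a::euclidean_space \<Rightarrow> 'b::euclidean_space"
  assumes "f \<in> L2 S" "open S" "bounded S"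
  shows "integrable (lebesgue_on S) f"
proof -
  have "S \<in> lmeasurable" using assms(2,3) by (simp add: lmeasurable_open)
  then interpret finite_measure "lebesgue_on S" by (rule finite_measure_lebesgue_on)
  show ?thesis
  proof (rule Bochner_Integration.integrable_bound[of _ "\<lambda>x. 1 + (norm (f x))\<^sup>2"])
    show "integrable (lebesgue_on S) (\<lambda>x. 1 + (norm (f x))\<^sup>2)"
      using assms(1) unfolding L2_def by auto
    show "f \<in> borel_measurable (lebesgue_on S)" using assms(1) unfolding L2_def by auto
    have "norm y \<le> norm (1 + (norm y)\<^sup>2)" for y :: 'b
    proof -
      have "2 * norm y \<le> 1 + (norm y)\<^sup>2" using zero_le_power2[of "norm y - 1"] by (simp add: power2_diff)
      then show ?thesis using norm_ge_zero[of y] unfolding real_norm_def by linarith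
    qed
    then show "AE x in lebesgue_on S. norm (f x) \<le> norm (1 + (norm (f x))\<^sup>2)" by (intro AE_I2)
  qed
qed

lemma integrable_test_function_scaleR:
  fixes f :: "'a::euclidean_space \<Rightarrow> 'b::euclidean_space" and \<psi> :: "'a \<Rightarrow> real"
  assumes \<psi>: "test_function T \<psi>" and S: "S \<in> sets lebesgue" and f: "integrable (lebesgue_on S) f"
  shows "integrable (lebesgue_on S) (\<lambda>x. \<psi> x *\<^sub>R f x)"
proof -
  obtain B where B: "B > 0" "\<And>x. \<bar>\<psi> x\<bar> \<le> B" using test_function_bounded[OF \<psi>] by metis
  have m: "\<psi> \<in> borel_measurable (lebesgue_on S)"
    by (rule continuous_imp_measurable_on_sets_lebesgue[OF continuous_on_subset[OF smooth_on_continuous[OF test_function_smooth[OF \<psi>]]] S]) auto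
  show ?thesis
  proof (rule Bochner_Integration.integrable_bound[of _ "\<lambda>y. B *\<^sub>R f y"])
    show "(\<lambda>y. \<psi> y *\<^sub>R f y) \<in> borel_measurable (lebesgue_on S)"
      using m f by (intro borel_measurable_scaleR) auto
    show "AE y in lebesgue_on S. norm (\<psi> y *\<^sub>R f y) \<le> norm (B *\<^sub>R f y)"
      using B by (intro AE_I2) (auto intro!: mult_right_mono)
  qed (use f in auto)
qed

text \<open>The weak derivatives in \<open>laplacian\<close> are moved onto the test function, which
  brings the equation into the form of \<open>unique_continuation\<close>; real and imaginary parts
  are then treated separately.\<close>

lemma dirichlet_eigenfunction_unique_continuation:
  fixes f :: "'a::euclidean_space \<Rightarrow> complex"
  assumes ef: "dirichlet_eigenfunction S \<nu> f" and nu: "\<nu> > 0"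
    and S: "open S" "connected S" "bounded S"
    and U: "open U" "U \<noteq> {}" "U \<subseteq> S"
  shows "\<not> (AE x in lebesgue. x \<in> U \<longrightarrow> f x = 0)"
proof
  assume zero: "AE x in lebesgue. x \<in> U \<longrightarrow> f x = 0"
  have Sm: "S \<in> sets lebesgue" using S(1) by auto
  have H2: "f \<in> H2 S" and eq: "AE x in lebesgue_on S. - laplacian S f x = \<nu> *\<^sub>R f x"
    using ef unfolding dirichlet_eigenfunction_def by auto
  have fL2: "f \<in> L2 S" using H2 unfolding H2_def H1_def by auto
  have fi: "integrable (lebesgue_on S) f" by (rule L2_bounded_imp_integrable[OF fL2 S(1,3)])
  note wd = H2_weak_derivatives[OF H2]
  have weak: "integral\<^sup>L (lebesgue_on S) (\<lambda>x. (\<Sum>b\<in>Basis. pd b (pd b \<psi>) x) *\<^sub>R f x)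
     = - \<nu> *\<^sub>R integral\<^sup>L (lebesgue_on S) (\<lambda>x. \<psi> x *\<^sub>R f x)" if \<psi>: "test_function S \<psi>" for \<psi> :: "'a \<Rightarrow> real"
  proof -
    have i2: "integrable (lebesgue_on S) (\<lambda>x. pd b (pd b \<psi>) x *\<^sub>R f x)" for b
      by (rule integrable_test_function_scaleR[OF test_function_pd[OF test_function_pd[OF \<psi>]] Sm fi])
    have id: "integrable (lebesgue_on S) (\<lambda>x. \<psi> x *\<^sub>R wderiv S b (wderiv S b f) x)" if "b \<in> Basis" for b
      by (rule integrable_test_function_scaleR[OF \<psi> Sm L2_bounded_imp_integrable[OF wd(3)[OF that] S(1,3)]])
    have ib: "integral\<^sup>L (lebesgue_on S) (\<lambda>x. pd b (pd b \<psi>) x *\<^sub>R f x)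
        = integral\<^sup>L (lebesgue_on S) (\<lambda>x. \<psi> x *\<^sub>R wderiv S b (wderiv S b f) x)" if b: "b \<in> Basis" for b
    proof -
      have "integral\<^sup>L (lebesgue_on S) (\<lambda>x. pd b (pd b \<psi>) x *\<^sub>R f x)
          = - integral\<^sup>L (lebesgue_on S) (\<lambda>x. pd b \<psi> x *\<^sub>R wderiv S b f x)"
        using wd(1)[OF b] test_function_pd[OF \<psi>] unfolding has_weak_deriv_def by blast
      also have "integral\<^sup>L (lebesgue_on S) (\<lambda>x. pd b \<psi> x *\<^sub>R wderiv S b f x)
          = - integral\<^sup>L (lebesgue_on S) (\<lambda>x. \<psi> x *\<^sub>R wderiv S b (wderiv S b f) x)"
        using wd(4)[OF b] \<psi> unfolding has_weak_deriv_def by blast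
      finally show ?thesis by simp
    qed
    have "integral\<^sup>L (lebesgue_on S) (\<lambda>x. (\<Sum>b\<in>Basis. pd b (pd b \<psi>) x) *\<^sub>R f x)
        = (\<Sum>b\<in>Basis. integral\<^sup>L (lebesgue_on S) (\<lambda>x. pd b (pd b \<psi>) x *\<^sub>R f x))"
      unfolding scaleR_sum_left by (rule Bochner_Integration.integral_sum) (rule i2)
    also have "\<dots> = (\<Sum>b\<in>Basis. integral\<^sup>L (lebesgue_on S) (\<lambda>x. \<psi> x *\<^sub>R wderiv S b (wderiv S b f) x))"
      by (rule sum.cong[OF refl ib])
    also have "\<dots> = integral\<^sup>L (lebesgue_on S) (\<lambda>x. \<psi> x *\<^sub>R laplacian S f x)"
      unfolding laplacian_def scaleR_sum_right by (rule Bochner_Integration.integral_sum[symmetric]) (rule id)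
    also have "\<dots> = integral\<^sup>L (lebesgue_on S) (\<lambda>x. (- \<nu>) *\<^sub>R (\<psi> x *\<^sub>R f x))"
    proof (rule integral_cong_AE)
      have "integrable (lebesgue_on S) (\<lambda>x. \<psi> x *\<^sub>R laplacian S f x)"
        unfolding laplacian_def scaleR_sum_right by (rule Bochner_Integration.integrable_sum) (rule id)
      then show "(\<lambda>x. \<psi> x *\<^sub>R laplacian S f x) \<in> borel_measurable (lebesgue_on S)" by auto
      show "(\<lambda>x. (- \<nu>) *\<^sub>R (\<psi> x *\<^sub>R f x)) \<in> borel_measurable (lebesgue_on S)"
        by (rule borel_measurable_integrable[OF integrable_scaleR_right[OF integrable_test_function_scaleR[OF \<psi> Sm fi]]])
      show "AE x in lebesgue_on S. \<psi> x *\<^sub>R laplacian S f x = (- \<nu>) *\<^sub>R (\<psi> x *\<^sub>R f x)"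
        using eq
      proof eventually_elim
        fix x assume "- laplacian S f x = \<nu> *\<^sub>R f x"
        then have "laplacian S f x = - (\<nu> *\<^sub>R f x)" by (metis minus_minus)
        then show "\<psi> x *\<^sub>R laplacian S f x = (- \<nu>) *\<^sub>R (\<psi> x *\<^sub>R f x)" by simp
      qed
    qed
    also have "\<dots> = (- \<nu>) *\<^sub>R integral\<^sup>L (lebesgue_on S) (\<lambda>x. \<psi> x *\<^sub>R f x)"
      by (rule integral_scaleR_right)
    finally show ?thesis .
  qed
  have part: "AE x in lebesgue. x \<in> S \<longrightarrow> L (f x) = 0" if L: "bounded_linear L" for L :: "complex \<Rightarrow> real"
  proof (rule unique_continuation[OF S(1,2) _ nu _ U])
    show "integrable (lebesgue_on S) (\<lambda>x. L (f x))" by (rule integrable_bounded_linear[OF L fi])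
    show "AE x in lebesgue. x \<in> U \<longrightarrow> L (f x) = 0"
      using zero by eventually_elim (simp add: linear_0 bounded_linear.linear[OF L])
    fix \<psi> :: "'a \<Rightarrow> real" assume \<psi>: "test_function S \<psi>"
    have sc: "L (r *\<^sub>R z) = r * L z" for r z using linear_scale[OF bounded_linear.linear[OF L]] by simp
    have i0: "integrable (lebesgue_on S) (\<lambda>x. \<psi> x *\<^sub>R f x)" by (rule integrable_test_function_scaleR[OF \<psi> Sm fi])
    have i2: "integrable (lebesgue_on S) (\<lambda>x. (\<Sum>b\<in>Basis. pd b (pd b \<psi>) x) *\<^sub>R f x)"
      unfolding scaleR_sum_left
      by (rule Bochner_Integration.integrable_sum)
         (rule integrable_test_function_scaleR[OF test_function_pd[OF test_function_pd[OF \<psi>]] Sm fi])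
    have "integral\<^sup>L (lebesgue_on S) (\<lambda>y. (\<Sum>b\<in>Basis. pd b (pd b \<psi>) y) * L (f y))
        = L (integral\<^sup>L (lebesgue_on S) (\<lambda>x. (\<Sum>b\<in>Basis. pd b (pd b \<psi>) x) *\<^sub>R f x))"
      using integral_bounded_linear[OF L i2] by (simp add: sc)
    also have "\<dots> = - \<nu> * L (integral\<^sup>L (lebesgue_on S) (\<lambda>x. \<psi> x *\<^sub>R f x))"
      unfolding weak[OF \<psi>] by (rule sc)
    also have "L (integral\<^sup>L (lebesgue_on S) (\<lambda>x. \<psi> x *\<^sub>R f x)) = integral\<^sup>L (lebesgue_on S) (\<lambda>y. \<psi> y * L (f y))"
      using integral_bounded_linear[OF L i0] by (simp add: sc)
    finally show "integral\<^sup>L (lebesgue_on S) (\<lambda>y. (\<Sum>b\<in>Basis. pd b (pd b \<psi>) y) * L (f y))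
        = - \<nu> * integral\<^sup>L (lebesgue_on S) (\<lambda>y. \<psi> y * L (f y))" .
  qed
  have "AE x in lebesgue. x \<in> S \<longrightarrow> f x = 0"
    using part[OF bounded_linear_Re] part[OF bounded_linear_Im]
    by eventually_elim (auto simp: complex_eq_iff)
  then have "AE x in lebesgue_on S. f x = 0" using Sm by (subst AE_restrict_space_iff) auto
  then show False using ef unfolding dirichlet_eigenfunction_def by blast
qed

section \<open>Lower bounds for the mass on open subsets\<close>

lemma integrable_L2_subset:
  assumes "f \<in> L2 S" "S \<in> sets lebesgue" "T \<in> sets lebesgue" "T \<subseteq> S"
  shows "integrable (lebesgue_on T) (\<lambda>x. (norm (f x))\<^sup>2)"
  by (rule integrable_lebesgue_on_subset[OF _ assms(2,3,4)]) (use assms(1) in \<open>simp add: L2_def\<close>)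

lemma L2_norm_power2: "(L2_norm S f)\<^sup>2 = integral\<^sup>L (lebesgue_on S) (\<lambda>x. (norm (f x))\<^sup>2)"
  unfolding L2_norm_def by (simp add: Bochner_Integration.integral_nonneg)

lemma integral_lebesgue_on_mono_set:
  fixes f :: "'a::euclidean_space \<Rightarrow> real"
  assumes f: "integrable (lebesgue_on S) f" and S: "S \<in> sets lebesgue" and T: "T \<in> sets lebesgue" "T \<subseteq> S"
    and nonneg: "\<And>x. x \<in> S \<Longrightarrow> 0 \<le> f x"
  shows "integral\<^sup>L (lebesgue_on T) f \<le> integral\<^sup>L (lebesgue_on S) f"
proof -
  have "integral\<^sup>L lebesgue (\<lambda>x. indicator T x *\<^sub>R f x) \<le> integral\<^sup>L lebesgue (\<lambda>x. indicator S x *\<^sub>R f x)"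
  proof (rule integral_mono)
    show "integrable lebesgue (\<lambda>x. indicator T x *\<^sub>R f x)"
      using integrable_lebesgue_on_subset[OF f S T] T(1) by (subst (asm) integrable_restrict_space) auto
    show "integrable lebesgue (\<lambda>x. indicator S x *\<^sub>R f x)"
      using f S by (subst (asm) integrable_restrict_space) auto
    show "indicator T x *\<^sub>R f x \<le> indicator S x *\<^sub>R f x" for x
      using nonneg T(2) by (auto simp: indicator_def)
  qed
  then show ?thesis using S T(1) by (simp add: integral_restrict_space)
qed

lemma dirichlet_eigensystem_norm:
  assumes "dirichlet_eigensystem S \<mu> \<phi>" "k \<ge> 1" shows "L2_norm S (\<phi> k) = 1" "\<phi> k \<in> L2 S"
proof -
  have 1: "integral\<^sup>L (lebesgue_on S) (\<lambda>x. \<phi> k x * cnj (\<phi> k x)) = 1"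
    using assms unfolding dirichlet_eigensystem_def by auto
  have "(\<lambda>x. \<phi> k x * cnj (\<phi> k x)) = (\<lambda>x. complex_of_real ((norm (\<phi> k x))\<^sup>2))"
    by (auto simp: complex_norm_square simp flip: of_real_power)
  with 1 have "complex_of_real (integral\<^sup>L (lebesgue_on S) (\<lambda>x. (norm (\<phi> k x))\<^sup>2)) = 1"
    by (metis integral_complex_of_real)
  then show "L2_norm S (\<phi> k) = 1" unfolding L2_norm_def by simp
  have "dirichlet_eigenfunction S ((\<mu> k)\<^sup>2) (\<phi> k)" using assms unfolding dirichlet_eigensystem_def by auto
  then show "\<phi> k \<in> L2 S" unfolding dirichlet_eigenfunction_def H2_def H1_def by auto
qed

lemma dirichlet_eigensystem_mass_pos:
  assumes S: "bounded_smooth_domain S" and sys: "dirichlet_eigensystem S \<mu> \<phi>" and k: "k \<ge> 1"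
    and U: "open U" "U \<noteq> {}" "U \<subseteq> S"
  shows "(L2_norm U (\<phi> k))\<^sup>2 > 0"
proof -
  have o: "open S" "connected S" "bounded S" using S unfolding bounded_smooth_domain_def by auto
  have Um: "U \<in> sets lebesgue" using U(1) by auto
  have i: "integrable (lebesgue_on U) (\<lambda>x. (norm (\<phi> k x))\<^sup>2)"
    by (rule integrable_L2_subset[OF dirichlet_eigensystem_norm(2)[OF sys k] _ Um U(3)]) (use o in auto)
  have "integral\<^sup>L (lebesgue_on U) (\<lambda>x. (norm (\<phi> k x))\<^sup>2) \<noteq> 0"
  proof
    assume "integral\<^sup>L (lebesgue_on U) (\<lambda>x. (norm (\<phi> k x))\<^sup>2) = 0"
    then have "AE x in lebesgue_on U. (norm (\<phi> k x))\<^sup>2 = 0"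
      using integral_nonneg_eq_0_iff_AE[OF i] by auto
    then have "AE x in lebesgue. x \<in> U \<longrightarrow> \<phi> k x = 0" using Um by (subst (asm) AE_restrict_space_iff) auto
    moreover have "dirichlet_eigenfunction S ((\<mu> k)\<^sup>2) (\<phi> k)" "(\<mu> k)\<^sup>2 > 0"
      using sys k unfolding dirichlet_eigensystem_def by auto
    ultimately show False using dirichlet_eigenfunction_unique_continuation[OF _ _ o U] by blast
  qed
  moreover have "integral\<^sup>L (lebesgue_on U) (\<lambda>x. (norm (\<phi> k x))\<^sup>2) \<ge> 0" by (rule Bochner_Integration.integral_nonneg) auto
  ultimately show ?thesis unfolding L2_norm_power2 by linarith
qed

text \<open>Unique continuation is needed because a finite number of the eigenfunctions does not affect
  \<open>not_concentrating\<close>.\<close>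

lemma eigenfunction_mass_lower_bound:
  assumes S: "bounded_smooth_domain S" and sys: "dirichlet_eigensystem S \<mu> \<phi>"
    and U: "open U" "U \<noteq> {}" "U \<subseteq> S" and nc: "U \<noteq> S \<Longrightarrow> not_concentrating S U \<phi>"
  obtains \<alpha> where "\<alpha> > 0" "\<And>k. k \<ge> 1 \<Longrightarrow> \<alpha> \<le> (L2_norm U (\<phi> k))\<^sup>2"
proof -
  note \<alpha>I = that
  show thesis
  proof (cases "U = S")
    case True
    then show ?thesis using \<alpha>I[of 1] dirichlet_eigensystem_norm(1)[OF sys] by simp
  next
    case False
    define A where "A k = (L2_norm U (\<phi> k))\<^sup>2" for k
    have pos: "A k > 0" if "k \<ge> 1" for k unfolding A_def by (rule dirichlet_eigensystem_mass_pos[OF S sys that U])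
    show ?thesis
    proof (rule ccontr)
      assume "\<not> thesis"
      then have neg: "\<not> (\<forall>k\<ge>1. e \<le> A k)" if "e > 0" for e using that \<alpha>I unfolding A_def by blast
      have small: "\<exists>k\<ge>1. A k < e" if e: "e > 0" for e
        using neg[OF e] by (auto simp: not_le)
      have step: "\<exists>k\<ge>1. A k < e \<and> N < k" if e: "e > 0" for e N
      proof -
        \<comment> \<open>A positive threshold not exceeding any mass of index at most
          \<open>N\<close>; an index with smaller mass must lie beyond \<open>N\<close>.\<close>
        define d where "d = Min (insert e (A ` {1..N}))"
        have "d > 0" unfolding d_def using e pos by (subst Min_gr_iff) auto
        then obtain k where k: "k \<ge> 1" "A k < d" using small by blast
        have "A k < e" using k(2) unfolding d_def by simp
        moreover have "N < k"
        proof (rule ccontr)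
          assume "\<not> N < k"
          then have "A k \<in> insert e (A ` {1..N})" using k(1) by auto
          then have "d \<le> A k" unfolding d_def by (intro Min_le) auto
          then show False using k(2) by simp
        qed
        ultimately show ?thesis using k(1) by blast
      qed
      \<comment> \<open>The masses along this increasing sequence of indices tend to 0, so it is a
        concentrating subsequence.\<close>
      have "\<exists>r. \<forall>n. (r n \<ge> 1 \<and> A (r n) < 1 / real (Suc n)) \<and> r n < r (Suc n)"
      proof (rule dependent_nat_choice)
        show "\<exists>x. 1 \<le> x \<and> A x < 1 / real (Suc 0)" using small[of 1] by auto
        show "\<exists>y. (1 \<le> y \<and> A y < 1 / real (Suc (Suc n))) \<and> x < y" for x n :: nat
          using step[of "1 / real (Suc (Suc n))" x] by auto
      qed
      then obtain r where r: "\<And>n. r n \<ge> 1" "\<And>n. A (r n) < 1 / real (Suc n)" "\<And>n. r n < r (Suc n)" by blast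
      have "strict_mono r" using r(3) by (simp add: strict_mono_Suc_iff)
      moreover have "(\<lambda>j. (L2_norm U (\<phi> (r j)))\<^sup>2 / (L2_norm S (\<phi> (r j)))\<^sup>2) \<longlonglongrightarrow> 0"
      proof (rule real_tendsto_sandwich[OF _ _ tendsto_const LIMSEQ_inverse_real_of_nat])
        show "\<forall>\<^sub>F n in sequentially. 0 \<le> (L2_norm U (\<phi> (r n)))\<^sup>2 / (L2_norm S (\<phi> (r n)))\<^sup>2" by simp
        show "\<forall>\<^sub>F n in sequentially. (L2_norm U (\<phi> (r n)))\<^sup>2 / (L2_norm S (\<phi> (r n)))\<^sup>2 \<le> inverse (real (Suc n))"
          using r(2) unfolding A_def dirichlet_eigensystem_norm(1)[OF sys r(1)]
          by (intro always_eventually allI) (simp add: inverse_eq_divide less_imp_le)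
      qed
      ultimately show False using nc[OF False] unfolding not_concentrating_def by blast
    qed
  qed
qed

section \<open>Uniform bounds\<close>

text \<open>\<open>Q\<close> varies with \<open>c\<close>, \<open>m\<close> and \<open>lam\<close>;
  quantifying it away leaves a property whose constants \<open>q1\<close> and \<open>c0\<close> can
  be uniform.\<close>

definition energy_bounded_below :: "real \<Rightarrow> real \<Rightarrow> real \<Rightarrow> real \<Rightarrow> (real \<Rightarrow> real) \<Rightarrow> bool" where
  "energy_bounded_below h q1 c0 lam u \<longleftrightarrow>
     (\<exists>Q. primitive_on 0 h u (D h u) \<and> primitive_on 0 h (D h u) (\<lambda>t. - lam * Q t * u t) \<and>
        (\<forall>t. 0 \<le> Q t \<and> Q t \<le> q1) \<and>
        (\<forall>t\<in>{0<..<h}. lam * c0 \<le> (D h u t)\<^sup>2 + lam * Q t * (u t)\<^sup>2))"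

text \<open>\<open>q0\<close> bounds \<open>Q\<close> from below, as \<open>1 / g\<close> is at
  least \<open>1 / cM\<close> and \<open>m\<^sup>2 / lam\<close> at most
  \<open>1 / (cM + \<epsilon>)\<close>. In \<open>c0\<close>, the normalization forces the supremum
  of \<open>u\<^sup>2\<close> to be at least \<open>cm / h\<close>, and
  \<open>(V + 1) / cm\<^sup>2\<close> bounds the variation of \<open>1 / g\<close>.\<close>

lemma eigenfunction_energy:
  assumes h: "h > 0" and cm: "0 < cm" "cm < cM" and eps: "\<epsilon> > 0"
    and c: "c \<in> KVset h cm cM V" and m: "m > 0" and lam: "lam \<ge> (cM + \<epsilon>) * m\<^sup>2"
    and u: "normalized_eigenfunction h c m lam u"
    and q0_def: "q0 = 1 / cM - 1 / (cM + \<epsilon>)"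
    and c0_def: "c0 = q0 * (cm / h) * exp (- ((1 + 1 / q0) * ((V + 1) / cm\<^sup>2)))"
  shows "energy_bounded_below h (1 / cm) c0 lam u"
proof -
  have ef: "A_eigenfunction h c m lam u" and diff: "u differentiable_on {0..h}" and cont: "continuous_on {0..h} (D h u)"
    and norm: "integral\<^sup>L (lebesgue_on {0<..<h}) (\<lambda>y. (u y)\<^sup>2 * inverse (c y)) = 1"
    using u unfolding normalized_eigenfunction_def by auto
  have lampos: "lam > 0" using lam m cm eps by (smt (verit) mult_pos_pos zero_less_power)
  obtain g N where g: "\<And>y. cm \<le> g y" "\<And>y. g y \<le> cM" "AE y in lebesgue_on {0<..<h}. g y = c y"
    and N: "\<And>s t. 0 < s \<Longrightarrow> s \<le> t \<Longrightarrow> t < h \<Longrightarrow> \<bar>g t - g s\<bar> \<le> N t - N s"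
      "\<And>s t. 0 < s \<Longrightarrow> s \<le> t \<Longrightarrow> t < h \<Longrightarrow> N t - N s \<le> V + 1"
    by (rule KVset_representative[OF c less_imp_le[OF cm(2)]], rule that) (assumption | blast)+
  define Q where "Q t = 1 / g t - m\<^sup>2 / lam" for t
  note up = eigenfunction_primitives(1)[OF h ef diff cont lampos cm(1) g(1,3)]
  have pp: "primitive_on 0 h (D h u) (\<lambda>t. - lam * Q t * u t)"
    unfolding Q_def by (rule eigenfunction_primitives(2)[OF h ef diff cont lampos cm(1) g(1,3)])
  have gpos: "0 < g t" for t using g(1)[of t] cm by linarith
  have q0: "q0 > 0" unfolding q0_def using cm eps by (simp add: frac_less2)
  have ml: "m\<^sup>2 / lam \<le> 1 / (cM + \<epsilon>)" using lam lampos cm eps by (simp add: field_simps)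
  have Qq0: "q0 \<le> Q t" for t
  proof -
    have "1 / cM \<le> 1 / g t" using g(2)[of t] gpos[of t] by (simp add: frac_le)
    then show ?thesis unfolding Q_def q0_def using ml by linarith
  qed
  have Qle: "Q t \<le> 1 / cm" for t
  proof -
    have "1 / g t \<le> 1 / cm" using g(1)[of t] cm by (simp add: frac_le)
    moreover have "0 \<le> m\<^sup>2 / lam" using lampos by simp
    ultimately show ?thesis unfolding Q_def by linarith
  qed
  \<comment> \<open>On values at least \<open>cm\<close> the reciprocal is Lipschitz with constant
    \<open>1 / cm\<^sup>2\<close>, so \<open>N / cm\<^sup>2\<close> controls the increments of
    \<open>Q\<close>.\<close>
  have QN: "\<bar>Q t - Q s\<bar> \<le> N t / cm\<^sup>2 - N s / cm\<^sup>2" if "0 < s" "s \<le> t" "t < h" for s t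
  proof -
    have "Q t - Q s = (g s - g t) / (g t * g s)"
      unfolding Q_def using gpos[of s] gpos[of t] by (simp add: field_simps)
    then have "\<bar>Q t - Q s\<bar> = \<bar>g t - g s\<bar> / (g t * g s)"
      using gpos[of s] gpos[of t] by (simp add: abs_mult abs_minus_commute)
    also have "\<dots> \<le> (N t - N s) / (cm * cm)"
      using N(1)[OF that] g(1)[of t] g(1)[of s] cm(1) by (intro frac_le mult_mono) auto
    finally show ?thesis by (simp add: diff_divide_distrib power2_eq_square)
  qed
  have NW: "N t / cm\<^sup>2 - N s / cm\<^sup>2 \<le> (V + 1) / cm\<^sup>2" if "0 < s" "s \<le> t" "t < h" for s t
    using divide_right_mono[OF N(2)[OF that], of "cm\<^sup>2"] by (simp add: diff_divide_distrib)
  have H: "cm / h \<le> \<kappa>" if \<kappa>: "\<And>t. t \<in> {0<..<h} \<Longrightarrow> (u t)\<^sup>2 \<le> \<kappa>" for \<kappa>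
  proof -
    \<comment> \<open>A non-integrable function has integral 0 by convention, so the value 1 implies
      integrability.\<close>
    have i: "integrable (lebesgue_on {0<..<h}) (\<lambda>y. (u y)\<^sup>2 * inverse (c y))"
      using norm not_integrable_integral_eq by fastforce
    have ci: "(\<lambda>_. \<kappa> / cm) absolutely_integrable_on {0..h}"
      by (rule absolutely_integrable_continuous_real) (rule continuous_on_const)
    have "1 \<le> integral\<^sup>L (lebesgue_on {0<..<h}) (\<lambda>_. \<kappa> / cm)"
      unfolding norm[symmetric]
    proof (rule integral_mono_AE[OF i integral_lebesgue_on_Ioo(1)[OF ci]])
      have "AE y in lebesgue_on {0<..<h}. y \<in> {0<..<h}"
        using AE_space[of "lebesgue_on {0<..<h}"] by simp
      with g(3) show "AE y in lebesgue_on {0<..<h}. (u y)\<^sup>2 * inverse (c y) \<le> \<kappa> / cm"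
      proof eventually_elim
        fix y assume y: "g y = c y" "y \<in> {0<..<h}"
        have "inverse (c y) \<le> inverse cm" "0 \<le> inverse (c y)" using g(1)[of y] y(1) cm by auto
        then have "(u y)\<^sup>2 * inverse (c y) \<le> \<kappa> * inverse cm"
          using \<kappa>[OF y(2)] by (intro mult_mono) (auto intro: order_trans[OF zero_le_power2])
        then show "(u y)\<^sup>2 * inverse (c y) \<le> \<kappa> / cm" by (simp add: divide_inverse)
      qed
    qed
    also have "\<dots> = h * (\<kappa> / cm)" unfolding integral_lebesgue_on_Ioo(2)[OF ci] using h by simp
    finally show ?thesis using h cm by (simp add: field_simps)
  qed
  have "lam * (q0 * (cm / h) * exp (- ((1 + 1 / q0) * ((V + 1) / cm\<^sup>2)))) \<le> (D h u y)\<^sup>2 + lam * Q y * (u y)\<^sup>2"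
    if "y \<in> {0<..<h}" for y
    by (rule energy_lower_bound[OF up pp lampos q0 Qq0 QN NW H that])
  then have "\<forall>t\<in>{0<..<h}. lam * c0 \<le> (D h u t)\<^sup>2 + lam * Q t * (u t)\<^sup>2"
    unfolding c0_def by blast
  moreover have "\<forall>t. 0 \<le> Q t \<and> Q t \<le> 1 / cm" using Qq0 q0 Qle by (meson less_imp_le order_trans)
  ultimately show ?thesis using up pp unfolding energy_bounded_below_def by blast
qed

lemma Aset_memberD:
  assumes "(m, lam) \<in> Aset h cM \<epsilon> \<mu> c" "dirichlet_eigensystem S \<mu> \<phi>"
  shows "lam \<ge> (cM + \<epsilon>) * m\<^sup>2" "m \<ge> \<mu> 1" "m > 0" "\<mu> 1 > 0"
  using assms unfolding Aset_def dirichlet_eigensystem_def by auto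

context
  fixes S :: "'a::euclidean_space set" and h cm cM \<epsilon> V :: real and \<mu> :: "nat \<Rightarrow> real" and \<phi> :: "nat \<Rightarrow> 'a \<Rightarrow> complex"
  assumes h: "h > 0" and sys: "dirichlet_eigensystem S \<mu> \<phi>"
    and cm: "0 < cm" "cm < cM" and eps: "\<epsilon> > 0"
begin

text \<open>\<open>lam0\<close> bounds all admissible eigenvalues from below, as \<mu> is smallest
  at index 1. It lets later estimates absorb terms that lack a factor \<open>lam\<close>.\<close>

lemma uniform_energy:
  obtains c0 lam0 where "c0 > 0" "lam0 > 0"
    "\<forall>c m lam u. c \<in> KVset h cm cM V \<longrightarrow> (m, lam) \<in> Aset h cM \<epsilon> \<mu> c \<longrightarrow> normalized_eigenfunction h c m lam u \<longrightarrow>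
      lam0 \<le> lam \<and> energy_bounded_below h (1 / cm) c0 lam u"
proof -
  define q0 where "q0 = 1 / cM - 1 / (cM + \<epsilon>)"
  define c0 where "c0 = q0 * (cm / h) * exp (- ((1 + 1 / q0) * ((V + 1) / cm\<^sup>2)))"
  define lam0 where "lam0 = (cM + \<epsilon>) * (\<mu> 1)\<^sup>2"
  have "q0 > 0" unfolding q0_def using cm eps by (simp add: frac_less2)
  then have "c0 > 0" using cm h by (simp add: c0_def)
  moreover have "\<mu> 1 > 0" using sys unfolding dirichlet_eigensystem_def by auto
  then have "lam0 > 0" using cm eps by (simp add: lam0_def)
  moreover have "\<forall>c m lam u. c \<in> KVset h cm cM V \<longrightarrow> (m, lam) \<in> Aset h cM \<epsilon> \<mu> c \<longrightarrow> normalized_eigenfunction h c m lam u \<longrightarrow>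
      lam0 \<le> lam \<and> energy_bounded_below h (1 / cm) c0 lam u"
  proof (intro allI impI conjI)
    fix c m lam u
    assume a: "c \<in> KVset h cm cM V" "(m, lam) \<in> Aset h cM \<epsilon> \<mu> c" "normalized_eigenfunction h c m lam u"
    note A = Aset_memberD[OF a(2) sys]
    have "lam0 \<le> (cM + \<epsilon>) * m\<^sup>2"
      unfolding lam0_def using A cm eps by (intro mult_left_mono power_mono) auto
    then show "lam0 \<le> lam" using A by linarith
    show "energy_bounded_below h (1 / cm) c0 lam u"
      by (rule eigenfunction_energy[OF h cm eps a(1) A(3,1) a(3) q0_def c0_def])
  qed
  ultimately show ?thesis by (rule that)
qed

text \<open>In the energy \<open>u\<^sup>2\<close> has coefficient at most \<open>lam / cm\<close>,
  and \<open>u'\<^sup>2\<close> has coefficient 1, at most \<open>lam / lam0\<close>. So the energy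
  is at most \<open>lam * k\<close> times the squared amplitude, and dividing by \<open>lam\<close>
  gives \<open>r = c0 / k\<close>.\<close>

lemma minimal_amplitude:
  obtains r where "r > 0" "\<forall>c\<in>KVset h cm cM V. ereal r \<le> rsq h cM \<epsilon> \<mu> c"
proof -
  obtain c0 lam0 where c0: "c0 > 0" "lam0 > 0" and E: "\<forall>c m lam u. c \<in> KVset h cm cM V \<longrightarrow>
      (m, lam) \<in> Aset h cM \<epsilon> \<mu> c \<longrightarrow> normalized_eigenfunction h c m lam u \<longrightarrow>
      lam0 \<le> lam \<and> energy_bounded_below h (1 / cm) c0 lam u"
    using uniform_energy .
  define k where "k = 1 / lam0 + 1 / cm"
  have k: "k > 0" using c0 cm by (simp add: k_def add_pos_pos)
  define r where "r = c0 / k"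
  have "r > 0" using c0 k by (simp add: r_def)
  moreover have "\<forall>c\<in>KVset h cm cM V. ereal r \<le> rsq h cM \<epsilon> \<mu> c"
    unfolding rsq_def
  proof (intro ballI Inf_greatest)
    fix c e assume c: "c \<in> KVset h cm cM V" and "e \<in> {ereal ((u y)\<^sup>2 + (D h u y)\<^sup>2) | y m lam u.
      y \<in> {0..h} \<and> (m, lam) \<in> Aset h cM \<epsilon> \<mu> c \<and> normalized_eigenfunction h c m lam u}"
    then obtain y m lam u where e: "e = ereal ((u y)\<^sup>2 + (D h u y)\<^sup>2)" "y \<in> {0..h}"
      "(m, lam) \<in> Aset h cM \<epsilon> \<mu> c" "normalized_eigenfunction h c m lam u" by blast
    obtain Q where lam: "lam0 \<le> lam" and up: "primitive_on 0 h u (D h u)" "primitive_on 0 h (D h u) (\<lambda>t. - lam * Q t * u t)"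
      and Q01: "\<forall>t. 0 \<le> Q t \<and> Q t \<le> 1 / cm"
      and GG: "\<forall>t\<in>{0<..<h}. lam * c0 \<le> (D h u t)\<^sup>2 + lam * Q t * (u t)\<^sup>2"
      using E[rule_format, OF c e(3,4)] unfolding energy_bounded_below_def by blast
    have Q: "0 \<le> Q t" "Q t \<le> 1 / cm" for t using Q01 by auto
    note G = GG[rule_format]
    have lampos: "lam > 0" using lam c0 by linarith
    \<comment> \<open>The energy bound holds in the open interval; since \<open>Z\<close> is closed,
      the endpoints follow by continuity.\<close>
    define Z where "Z = {t \<in> {0..h}. r \<le> (u t)\<^sup>2 + (D h u t)\<^sup>2}"
    have "closed Z" unfolding Z_def
      by (rule continuous_on_closed_Collect_le[OF continuous_on_const
            continuous_on_add[OF continuous_on_power[OF primitive_on_continuous[OF up(1)]]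
              continuous_on_power[OF primitive_on_continuous[OF up(2)]]] closed_atLeastAtMost])
    moreover have "{0<..<h} \<subseteq> Z"
    proof
      fix t assume t: "t \<in> {0<..<h}"
      have "lam * Q t * (u t)\<^sup>2 \<le> lam * (1 / cm) * (u t)\<^sup>2"
        using Q(2)[of t] lampos by (intro mult_right_mono mult_left_mono) auto
      then have "lam * c0 \<le> (D h u t)\<^sup>2 + lam * (1 / cm) * (u t)\<^sup>2" using G[OF t] by linarith
      also have "\<dots> \<le> lam * (k * ((u t)\<^sup>2 + (D h u t)\<^sup>2))"
      proof -
        have "1 * (D h u t)\<^sup>2 \<le> (lam / lam0) * (D h u t)\<^sup>2"
          using lam c0 by (intro mult_right_mono) auto
        moreover have "0 \<le> lam / lam0 * (u t)\<^sup>2" "0 \<le> lam / cm * (D h u t)\<^sup>2" using lampos c0 cm by auto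
        moreover have "lam * (k * ((u t)\<^sup>2 + (D h u t)\<^sup>2)) = lam / lam0 * (u t)\<^sup>2 + (lam / lam0) * (D h u t)\<^sup>2
            + lam * (1 / cm) * (u t)\<^sup>2 + lam / cm * (D h u t)\<^sup>2"
          unfolding k_def by (simp add: algebra_simps)
        ultimately show ?thesis by linarith
      qed
      finally have "c0 \<le> k * ((u t)\<^sup>2 + (D h u t)\<^sup>2)" using lampos by simp
      then have "r \<le> (u t)\<^sup>2 + (D h u t)\<^sup>2" unfolding r_def using k by (simp add: pos_divide_le_eq mult.commute)
      then show "t \<in> Z" using t by (simp add: Z_def)
    qed
    ultimately have "closure {0<..<h} \<subseteq> Z" by (intro closure_minimal)
    then have "y \<in> Z" using e(2) h closure_greaterThanLessThan[OF h] by auto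
    then show "ereal r \<le> e" unfolding e(1) Z_def by simp
  qed
  ultimately show ?thesis by (rule that)
qed

text \<open>Both sides of \<open>interval_mass_lower_bound\<close> become linear in
  \<open>lam\<close> once \<open>4 * l\<^sup>2\<close> is bounded by
  \<open>4 * l\<^sup>2 * lam / lam0\<close>; then \<open>lam\<close> cancels.\<close>

lemma interval_mass:
  assumes ab: "a < b" "{a<..<b} \<subseteq> {0<..<h}"
  obtains f0 where "f0 > 0" "\<forall>c m lam u. c \<in> KVset h cm cM V \<longrightarrow> (m, lam) \<in> Aset h cM \<epsilon> \<mu> c \<longrightarrow>
    normalized_eigenfunction h c m lam u \<longrightarrow> f0 \<le> integral\<^sup>L (lebesgue_on {a<..<b}) (\<lambda>y. (u y)\<^sup>2)"
proof -
  obtain c0 lam0 where c0: "c0 > 0" "lam0 > 0" and E: "\<forall>c m lam u. c \<in> KVset h cm cM V \<longrightarrow>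
      (m, lam) \<in> Aset h cM \<epsilon> \<mu> c \<longrightarrow> normalized_eigenfunction h c m lam u \<longrightarrow>
      lam0 \<le> lam \<and> energy_bounded_below h (1 / cm) c0 lam u"
    using uniform_energy .
  have ab': "0 \<le> a" "b \<le> h" using ab greaterThanLessThan_subseteq_greaterThanLessThan[of a b 0 h] by auto
  define l where "l = b - a"
  have l: "l > 0" using ab by (simp add: l_def)
  define k where "k = 4 * l\<^sup>2 / lam0 + 3 * l ^ 4 / cm"
  have k: "k > 0" using l c0 cm by (simp add: k_def add_pos_pos)
  define f0 where "f0 = c0 * (l ^ 5 / 30) / k"
  have "f0 > 0" using c0 l k by (simp add: f0_def)
  moreover have "\<forall>c m lam u. c \<in> KVset h cm cM V \<longrightarrow> (m, lam) \<in> Aset h cM \<epsilon> \<mu> c \<longrightarrow>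
    normalized_eigenfunction h c m lam u \<longrightarrow> f0 \<le> integral\<^sup>L (lebesgue_on {a<..<b}) (\<lambda>y. (u y)\<^sup>2)"
  proof (intro allI impI)
    fix c m lam u
    assume a: "c \<in> KVset h cm cM V" "(m, lam) \<in> Aset h cM \<epsilon> \<mu> c" "normalized_eigenfunction h c m lam u"
    obtain Q where lam: "lam0 \<le> lam" and up: "primitive_on 0 h u (D h u)" "primitive_on 0 h (D h u) (\<lambda>t. - lam * Q t * u t)"
      and Q01: "\<forall>t. 0 \<le> Q t \<and> Q t \<le> 1 / cm"
      and GG: "\<forall>t\<in>{0<..<h}. lam * c0 \<le> (D h u t)\<^sup>2 + lam * Q t * (u t)\<^sup>2"
      using E[rule_format, OF a] unfolding energy_bounded_below_def by blast
    have Q: "0 \<le> Q t" "Q t \<le> 1 / cm" for t using Q01 by auto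
    note G = GG[rule_format]
    have lampos: "lam > 0" using lam c0 by linarith
    note up' = primitive_on_subset[OF up(1) ab'] primitive_on_subset[OF up(2) ab']
    define I where "I = integral {a..b} (\<lambda>t. (u t)\<^sup>2)"
    have cu: "continuous_on {a..b} (\<lambda>t. (u t)\<^sup>2)" by (intro continuous_intros primitive_on_continuous[OF up'(1)])
    have I: "I \<ge> 0" unfolding I_def by (rule Henstock_Kurzweil_Integration.integral_nonneg)
      (use integrable_continuous_interval[OF cu] in auto)
    have "lam * c0 * (l ^ 5 / 30) \<le> (4 * l\<^sup>2 + 3 * l ^ 4 * (lam * (1 / cm))) * I"
      unfolding l_def I_def
      by (rule interval_mass_lower_bound[OF up' ab(1) lampos Q(1,2) G]) (use ab(2) in auto)
    also have "\<dots> \<le> lam * (k * I)"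
    proof -
      have "4 * l\<^sup>2 * 1 \<le> 4 * l\<^sup>2 * (lam / lam0)" using lam c0 by (intro mult_left_mono) auto
      then have "4 * l\<^sup>2 + 3 * l ^ 4 * (lam * (1 / cm)) \<le> lam * k" by (simp add: k_def algebra_simps)
      then show ?thesis using mult_right_mono[OF _ I] by (metis mult.assoc)
    qed
    finally have "c0 * (l ^ 5 / 30) \<le> k * I" using lampos by (simp add: mult.assoc)
    then have "f0 \<le> I" unfolding f0_def using k by (simp add: pos_divide_le_eq mult.commute)
    then show "f0 \<le> integral\<^sup>L (lebesgue_on {a<..<b}) (\<lambda>y. (u y)\<^sup>2)"
      unfolding I_def integral_lebesgue_on_Ioo(2)[OF absolutely_integrable_continuous_real[OF cu]] .
  qed
  ultimately show ?thesis by (rule that)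
qed

lemma normalized_eigenfunction_mass:
  assumes c: "c \<in> KVset h cm cM V" and u: "normalized_eigenfunction h c m lam u"
    and T: "T \<in> sets lebesgue" "T \<subseteq> {0<..<h}"
  shows "integrable (lebesgue_on T) (\<lambda>y. (u y)\<^sup>2)"
    "integral\<^sup>L (lebesgue_on T) (\<lambda>y. (u y)\<^sup>2) \<le> cM * integral\<^sup>L (lebesgue_on T) (\<lambda>y. (u y)\<^sup>2 * inverse (c y))"
proof -
  have norm: "integral\<^sup>L (lebesgue_on {0<..<h}) (\<lambda>y. (u y)\<^sup>2 * inverse (c y)) = 1"
    and cu: "continuous_on {0..h} u"
    using u differentiable_imp_continuous_on unfolding normalized_eigenfunction_def by auto
  have "continuous_on {0..h} (\<lambda>y. (u y)\<^sup>2)" by (intro continuous_intros cu)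
  then have "integrable (lebesgue_on {0<..<h}) (\<lambda>y. (u y)\<^sup>2)"
    by (intro integral_lebesgue_on_Ioo(1) absolutely_integrable_continuous_real)
  then show iu: "integrable (lebesgue_on T) (\<lambda>y. (u y)\<^sup>2)"
    by (rule integrable_lebesgue_on_subset[OF _ _ T]) simp
  have "integrable (lebesgue_on {0<..<h}) (\<lambda>y. (u y)\<^sup>2 * inverse (c y))"
    using norm not_integrable_integral_eq by fastforce
  then have i: "integrable (lebesgue_on T) (\<lambda>y. (u y)\<^sup>2 * inverse (c y))"
    by (rule integrable_lebesgue_on_subset[OF _ _ T]) simp
  have "c \<in> Kset h cm cM" using c unfolding KVset_def by auto
  from Kset_AE_bounds[OF this] have "AE y in lebesgue. y \<in> {0<..<h} \<longrightarrow> cm \<le> c y \<and> c y \<le> cM"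
    by (subst (asm) AE_restrict_space_iff) auto
  then have "AE y in lebesgue. y \<in> T \<longrightarrow> cm \<le> c y \<and> c y \<le> cM"
    by eventually_elim (use T(2) in auto)
  then have b: "AE y in lebesgue_on T. cm \<le> c y \<and> c y \<le> cM"
    using T(1) by (subst AE_restrict_space_iff) auto
  have "integral\<^sup>L (lebesgue_on T) (\<lambda>y. (u y)\<^sup>2) \<le> integral\<^sup>L (lebesgue_on T) (\<lambda>y. cM * ((u y)\<^sup>2 * inverse (c y)))"
  proof (rule integral_mono_AE[OF iu])
    show "integrable (lebesgue_on T) (\<lambda>y. cM * ((u y)\<^sup>2 * inverse (c y)))" using i by auto
    show "AE y in lebesgue_on T. (u y)\<^sup>2 \<le> cM * ((u y)\<^sup>2 * inverse (c y))"
      using b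
    proof eventually_elim
      fix y assume y: "cm \<le> c y \<and> c y \<le> cM"
      then have "1 \<le> cM * inverse (c y)" using cm by (simp add: field_simps)
      then have "(u y)\<^sup>2 * 1 \<le> (u y)\<^sup>2 * (cM * inverse (c y))" by (rule mult_left_mono) simp
      then show "(u y)\<^sup>2 \<le> cM * ((u y)\<^sup>2 * inverse (c y))" by (simp add: mult_ac)
    qed
  qed
  then show "integral\<^sup>L (lebesgue_on T) (\<lambda>y. (u y)\<^sup>2) \<le> cM * integral\<^sup>L (lebesgue_on T) (\<lambda>y. (u y)\<^sup>2 * inverse (c y))"
    by simp
qed

lemma weighted_interval_mass:
  assumes ab: "a < b" "{a<..<b} \<subseteq> {0<..<h}"
  shows "\<exists>f_ab > 0. \<forall>c \<in> KVset h cm cM V. \<forall>(m, lam) \<in> Aset h cM \<epsilon> \<mu> c. \<forall>u.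
           normalized_eigenfunction h c m lam u \<longrightarrow>
           integral\<^sup>L (lebesgue_on {a<..<b}) (\<lambda>y. (u y)\<^sup>2 * inverse (c y)) \<ge> f_ab"
proof -
  obtain f0 where f0: "f0 > 0" "\<forall>c m lam u. c \<in> KVset h cm cM V \<longrightarrow> (m, lam) \<in> Aset h cM \<epsilon> \<mu> c \<longrightarrow>
    normalized_eigenfunction h c m lam u \<longrightarrow> f0 \<le> integral\<^sup>L (lebesgue_on {a<..<b}) (\<lambda>y. (u y)\<^sup>2)"
    using interval_mass[OF ab] .
  have "f0 / cM \<le> integral\<^sup>L (lebesgue_on {a<..<b}) (\<lambda>y. (u y)\<^sup>2 * inverse (c y))"
    if a: "c \<in> KVset h cm cM V" "(m, lam) \<in> Aset h cM \<epsilon> \<mu> c" "normalized_eigenfunction h c m lam u" for c m lam u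
  proof -
    have "f0 \<le> cM * integral\<^sup>L (lebesgue_on {a<..<b}) (\<lambda>y. (u y)\<^sup>2 * inverse (c y))"
      by (rule order_trans[OF f0(2)[rule_format, OF a] normalized_eigenfunction_mass(2)[OF a(1,3) _ ab(2)]]) simp
    then show ?thesis using cm by (simp add: pos_divide_le_eq mult.commute)
  qed
  then show ?thesis using f0(1) cm by (intro exI[of _ "f0 / cM"]) auto
qed

text \<open>The norms factor. The numerator is at least \<open>sqrt (\<alpha> * f0)\<close>; the
  denominator is at most \<open>sqrt cM\<close>, because the cross-sectional factor has norm 1 and
  the weight \<open>1 / c\<close> is at least \<open>1 / cM\<close> almost everywhere.\<close>

lemma product_mass:
  assumes S: "bounded_smooth_domain S" and U: "U \<subseteq> S" "U \<noteq> {}" "open U"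
    and nc: "U \<noteq> S \<Longrightarrow> not_concentrating S U \<phi>" and ab: "a < b" "{a<..<b} \<subseteq> {0<..<h}"
  shows "\<exists>f_\<omega> > 0. \<forall>c \<in> KVset h cm cM V. \<forall>k \<ge> 1. \<forall>lam u.
           (\<mu> k, lam) \<in> Aset h cM \<epsilon> \<mu> c \<and> normalized_eigenfunction h c (\<mu> k) lam u \<longrightarrow>
           (let v = (\<lambda>(x', y). \<phi> k x' * of_real (u y));
                q = L2_norm (U \<times> {a<..<b}) v / L2_norm (S \<times> {0<..<h}) v
            in f_\<omega> \<le> q \<and> q \<le> 1)"
proof -
  obtain \<alpha> where \<alpha>: "\<alpha> > 0" "\<forall>k\<ge>1. \<alpha> \<le> (L2_norm U (\<phi> k))\<^sup>2"
    using eigenfunction_mass_lower_bound[OF S sys U(3,2,1) nc] by metis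
  obtain f0 where f0: "f0 > 0" "\<forall>c m lam u. c \<in> KVset h cm cM V \<longrightarrow> (m, lam) \<in> Aset h cM \<epsilon> \<mu> c \<longrightarrow>
    normalized_eigenfunction h c m lam u \<longrightarrow> f0 \<le> integral\<^sup>L (lebesgue_on {a<..<b}) (\<lambda>y. (u y)\<^sup>2)"
    using interval_mass[OF ab] .
  have So: "open S" using S unfolding bounded_smooth_domain_def by auto
  have Sm: "S \<in> sets lebesgue" "U \<in> sets lebesgue" using So U(3) by auto
  define f where "f = sqrt (\<alpha> * f0 / cM)"
  have "f > 0" using \<alpha> f0 cm by (simp add: f_def)
  moreover have "let v = (\<lambda>(x', y). \<phi> k x' * of_real (u y));
        q = L2_norm (U \<times> {a<..<b}) v / L2_norm (S \<times> {0<..<h}) v in f \<le> q \<and> q \<le> 1"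
    if A: "c \<in> KVset h cm cM V" "k \<ge> 1" "(\<mu> k, lam) \<in> Aset h cM \<epsilon> \<mu> c" "normalized_eigenfunction h c (\<mu> k) lam u" for c k lam u
  proof -
    note \<phi> = dirichlet_eigensystem_norm[OF sys A(2)]
    have i\<phi>: "integrable (lebesgue_on S) (\<lambda>x. (norm (\<phi> k x))\<^sup>2)" using \<phi>(2) unfolding L2_def by auto
    have \<phi>m: "\<phi> k \<in> borel_measurable (lebesgue_on S)" using \<phi>(2) unfolding L2_def by auto
    then have \<phi>U: "\<phi> k \<in> borel_measurable (lebesgue_on U)" using U(1) by (rule measurable_restrict_mono)
    have cu: "continuous_on {0..h} u"
      using A(4) differentiable_imp_continuous_on unfolding normalized_eigenfunction_def by auto
    have cu1: "continuous_on {0<..<h} u" by (rule continuous_on_subset[OF cu]) auto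
    have cu2: "continuous_on {a<..<b} u" by (rule continuous_on_subset[OF cu1 ab(2)])
    define Iab where "Iab = integral\<^sup>L (lebesgue_on {a<..<b}) (\<lambda>y. (u y)\<^sup>2)"
    define I where "I = integral\<^sup>L (lebesgue_on {0<..<h}) (\<lambda>y. (u y)\<^sup>2)"
    define W where "W = (L2_norm U (\<phi> k))\<^sup>2"
    have ui: "integrable (lebesgue_on {0<..<h}) (\<lambda>y. (u y)\<^sup>2)"
      by (rule normalized_eigenfunction_mass(1)[OF A(1,4)]) auto
    have Iab: "f0 \<le> Iab" unfolding Iab_def by (rule f0(2)[rule_format, OF A(1,3,4)])
    have le: "Iab \<le> I" unfolding Iab_def I_def
      by (rule integral_lebesgue_on_mono_set[OF ui _ _ ab(2)]) auto
    have Ic: "I \<le> cM"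
      using normalized_eigenfunction_mass(2)[OF A(1,4), of "{0<..<h}"] A(4)
      unfolding I_def normalized_eigenfunction_def by simp
    have W: "\<alpha> \<le> W" unfolding W_def by (rule \<alpha>(2)[rule_format, OF A(2)])
    have "W \<le> (L2_norm S (\<phi> k))\<^sup>2"
      unfolding W_def L2_norm_power2 by (rule integral_lebesgue_on_mono_set[OF i\<phi> Sm(1,2) U(1)]) simp
    then have W1: "W \<le> 1" unfolding \<phi>(1) by simp
    have nU: "L2_norm U (\<phi> k) = sqrt W" unfolding W_def L2_norm_def by (simp add: Bochner_Integration.integral_nonneg)
    have 1: "L2_norm (U \<times> {a<..<b}) (\<lambda>(x', y). \<phi> k x' * of_real (u y)) = sqrt W * sqrt Iab"
      unfolding L2_norm_product[OF U(3) open_greaterThanLessThan \<phi>U cu2] nU by (simp add: L2_norm_def Iab_def)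
    have 2: "L2_norm (S \<times> {0<..<h}) (\<lambda>(x', y). \<phi> k x' * of_real (u y)) = sqrt I"
      unfolding L2_norm_product[OF So open_greaterThanLessThan \<phi>m cu1] \<phi>(1) by (simp add: L2_norm_def I_def)
    have q: "sqrt W * sqrt Iab / sqrt I = sqrt (W * Iab / I)" by (simp add: real_sqrt_mult real_sqrt_divide)
    have Ipos: "I > 0" using f0(1) Iab le by linarith
    have "\<alpha> * f0 / cM \<le> W * Iab / I"
      using W Iab Ic Ipos \<alpha>(1) f0(1) by (intro frac_le mult_mono) auto
    moreover have "W * Iab / I \<le> 1"
    proof -
      have "W * Iab \<le> 1 * I" using W1 le W \<alpha>(1) Iab f0(1) by (intro mult_mono) auto
      then show ?thesis using Ipos by simp
    qed
    ultimately show ?thesis unfolding Let_def 1 2 q f_def by simp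
  qed
  ultimately show ?thesis by (intro exI[of _ f]) blast
qed

end

theorem theorem4p13:
  fixes \<Omega>' :: "(real ^ 'd) set"
    and h cm cM \<epsilon> V :: real
    and \<mu> :: "nat \<Rightarrow> real"
    and \<phi> :: "nat \<Rightarrow> real ^ 'd \<Rightarrow> complex"
  assumes "bounded_smooth_domain \<Omega>'"
    and "h > 0"
    and "dirichlet_eigensystem \<Omega>' \<mu> \<phi>"
    and "0 < cm" and "cm < cM" and "\<epsilon> > 0" and "V > 0"
  shows
    "((\<forall>c \<in> Kset h cm cM. TV h c < \<infinity> \<longrightarrow> rsq h cM \<epsilon> \<mu> c > 0) \<and>
      (INF c \<in> KVset h cm cM V. rsq h cM \<epsilon> \<mu> c) > 0) \<and>
     (\<forall>a b. a < b \<and> {a<..<b} \<subseteq> {0<..<h} \<longrightarrow>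
        (\<exists>f_ab > 0. \<forall>c \<in> KVset h cm cM V. \<forall>(m, lam) \<in> Aset h cM \<epsilon> \<mu> c. \<forall>u.
           normalized_eigenfunction h c m lam u \<longrightarrow>
           integral\<^sup>L (lebesgue_on {a<..<b}) (\<lambda>y. (u y)\<^sup>2 * inverse (c y)) \<ge> f_ab)) \<and>
     (\<forall>\<omega>' a b. \<omega>' \<subseteq> \<Omega>' \<and> \<omega>' \<noteq> {} \<and> open \<omega>' \<and> a < b \<and> {a<..<b} \<subseteq> {0<..<h} \<and>
        (\<omega>' \<noteq> \<Omega>' \<longrightarrow> not_concentrating \<Omega>' \<omega>' \<phi>) \<longrightarrow>
        (\<exists>f_\<omega> > 0. \<forall>c \<in> KVset h cm cM V. \<forall>k \<ge> 1. \<forall>lam u.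
           (\<mu> k, lam) \<in> Aset h cM \<epsilon> \<mu> c \<and> normalized_eigenfunction h c (\<mu> k) lam u \<longrightarrow>
           (let v = (\<lambda>(x', y). \<phi> k x' * of_real (u y));
                q = L2_norm (\<omega>' \<times> {a<..<b}) v / L2_norm (\<Omega>' \<times> {0<..<h}) v
            in f_\<omega> \<le> q \<and> q \<le> 1)))"
proof -
  note c = assms(2,3,4,5,6)
  show ?thesis
  proof (intro conjI)
    show "\<forall>c \<in> Kset h cm cM. TV h c < \<infinity> \<longrightarrow> rsq h cM \<epsilon> \<mu> c > 0"
    proof (intro ballI impI)
      fix c assume cK: "c \<in> Kset h cm cM" and "TV h c < \<infinity>"
      \<comment> \<open>A single coefficient is covered by the uniform estimate, with a bound
        \<open>V'\<close> for its own variation in place of \<open>V\<close>.\<close>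
      then obtain V' where "TV h c \<le> ereal V'" by (cases "TV h c") auto
      then have c': "c \<in> KVset h cm cM V'" using cK unfolding KVset_def by simp
      obtain r where r: "r > 0" "\<forall>c\<in>KVset h cm cM V'. ereal r \<le> rsq h cM \<epsilon> \<mu> c"
        using minimal_amplitude[OF c] .
      then show "rsq h cM \<epsilon> \<mu> c > 0" using r(2)[rule_format, OF c'] r(1) by (metis ereal_less(2) less_le_trans)
    qed
    obtain r where r: "r > 0" "\<forall>c\<in>KVset h cm cM V. ereal r \<le> rsq h cM \<epsilon> \<mu> c"
      using minimal_amplitude[OF c] .
    have "ereal r \<le> (INF c \<in> KVset h cm cM V. rsq h cM \<epsilon> \<mu> c)" by (rule INF_greatest) (rule r(2)[rule_format])
    then show "(INF c \<in> KVset h cm cM V. rsq h cM \<epsilon> \<mu> c) > 0" using r(1) by (metis ereal_less(2) less_le_trans)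
  qed (intro allI impI, elim conjE, rule weighted_interval_mass[OF c], assumption, assumption,
       intro allI impI, elim conjE, rule product_mass[OF c assms(1)], simp_all)
qed

end
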